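(* Let $p\ge5$, $\mathbb F$ a sufficiently large finite field of characteristic $p$, $G=\mathrm{GL}_2(\mathbb Q_p)$, $K=\mathrm{GL}_2(\mathbb Z_p)$, $Z$ the centre of $G$. For every $0\le r\le p-1$ and every $\lambda\in\mathbb F$, \[\dim_{\mathbb F}\pi(r,\lambda,1)^{T_1(p^n)}\ll n\qquad(n\ge1).\]
   Context: $\mathrm{Sym}^r\mathbb F^2$ is the symmetric power representation of $\mathrm{GL}_2(\mathbb F_p)$, inflated to $K$ and extended to $KZ$ by letting $\mathrm{diag}(p,p)$ act trivially. $I(\mathrm{Sym}^r\mathbb F^2)=\mathrm{c\text{-}Ind}_{KZ}^G\mathrm{Sym}^r\mathbb F^2$ (compact induction); its endomorphism ring is $\mathbb F[T]$ for the standard (Barthel–Livné) Hecke operator $T$, and $\pi(r,\lambda,1)=\pi(r,\lambda)=I(\mathrm{Sym}^r\mathbb F^2)/(T-\lambda)$. $T_1(p^n)=\begin{pmatrix}1+p\mathbb Z_p&p^n\mathbb Z_p\\ p^n\mathbb Z_p&1+p\mathbb Z_p\end{pmatrix}$. *)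

theory Defs
  imports
    "HOL-Analysis.Determinants"
    "HOL-Computational_Algebra.Polynomial_Factorial"
    "HOL-Algebra.AbelCoset"
    "Berlekamp_Zassenhaus.Finite_Field"
    "Jordan_Normal_Form.Missing_VectorSpace"
begin

hide_const (open) Polynomial.smult Modules.module

section \<open>The p-adic integers and the p-adic numbers\<close>

text \<open>The prime \<open>p\<close> is the cardinality of the type variable \<open>'p\<close>. The ring of p-adic integers is
  the inverse limit of the rings \<open>\<int>/p^n\<close>; the \<open>n\<close>-th component is represented by its residue
  in \<open>{0..<p^n}\<close>, which the equation below forces.\<close>

typedef 'p padic_int =
  "{x :: nat \<Rightarrow> int. \<forall>n. x n = x (Suc n) mod int CARD('p) ^ n}"
  by (rule exI[of _ "\<lambda>_. 0"]) simp

setup_lifting type_definition_padic_int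

lemma padic_int_eqI: "(\<And>n. Rep_padic_int x n = Rep_padic_int y n) \<Longrightarrow> x = y"
  by (metis Rep_padic_int_inject ext)

lemma Rep_padic_int_Suc:
  "Rep_padic_int (x :: 'p padic_int) (Suc n) mod int CARD('p) ^ n = Rep_padic_int x n"
  using Rep_padic_int[of x] by (metis (mono_tags, lifting) mem_Collect_eq)

lemma Rep_padic_int_mod_self [simp]:
  "Rep_padic_int (x :: 'p padic_int) n mod int CARD('p) ^ n = Rep_padic_int x n"
  by (metis Rep_padic_int_Suc mod_mod_trivial)

lemma padic_mod_step:
  fixes a :: int
  shows "a mod p ^ Suc n mod p ^ n = a mod p ^ n"
  by (rule mod_mod_cancel) (simp add: le_imp_power_dvd)

instantiation padic_int :: (prime_card) comm_ring_1
begin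

lift_definition zero_padic_int :: "'a padic_int" is "\<lambda>_. 0" by simp

lift_definition one_padic_int :: "'a padic_int" is "\<lambda>n. 1 mod int CARD('a) ^ n"
  unfolding padic_mod_step by blast

lift_definition plus_padic_int :: "'a padic_int \<Rightarrow> 'a padic_int \<Rightarrow> 'a padic_int"
  is "\<lambda>x y n. (x n + y n) mod int CARD('a) ^ n"
  unfolding padic_mod_step by (metis mod_add_eq)

lift_definition uminus_padic_int :: "'a padic_int \<Rightarrow> 'a padic_int"
  is "\<lambda>x n. (- x n) mod int CARD('a) ^ n"
  unfolding padic_mod_step by (metis mod_minus_eq)

lift_definition minus_padic_int :: "'a padic_int \<Rightarrow> 'a padic_int \<Rightarrow> 'a padic_int"
  is "\<lambda>x y n. (x n - y n) mod int CARD('a) ^ n"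
  unfolding padic_mod_step by (metis mod_diff_eq)

lift_definition times_padic_int :: "'a padic_int \<Rightarrow> 'a padic_int \<Rightarrow> 'a padic_int"
  is "\<lambda>x y n. (x n * y n) mod int CARD('a) ^ n"
  unfolding padic_mod_step by (metis mod_mult_eq)

instance
proof
  fix a b c :: "'a padic_int"
  note rep = plus_padic_int.rep_eq times_padic_int.rep_eq uminus_padic_int.rep_eq
    minus_padic_int.rep_eq zero_padic_int.rep_eq one_padic_int.rep_eq
  show "a + b + c = a + (b + c)" "a + b = b + a" "0 + a = a" "- a + a = 0" "a - b = a + - b"
    "a * b * c = a * (b * c)" "a * b = b * a" "1 * a = a" "(a + b) * c = a * c + b * c"
    by (rule padic_int_eqI, simp add: rep mod_simps algebra_simps)+
  show "(0 :: 'a padic_int) \<noteq> 1"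
  proof transfer
    have "prime (int CARD('a))" by (rule prime_card_int)
    then have "1 mod int CARD('a) ^ 1 = 1"
      using prime_gt_1_int by fastforce
    then show "(\<lambda>_. 0) \<noteq> (\<lambda>n. 1 mod int CARD('a) ^ n)"
      by (metis zero_neq_one)
  qed
qed

end

lemma Rep_padic_int_mod:
  "Rep_padic_int (x :: 'p padic_int) (n + k) mod int CARD('p) ^ n = Rep_padic_int x n"
proof (induction k)
  case (Suc k)
  have "Rep_padic_int x (n + Suc k) mod int CARD('p) ^ n
      = Rep_padic_int x (Suc (n + k)) mod int CARD('p) ^ (n + k) mod int CARD('p) ^ n"
    by (subst mod_mod_cancel) (simp_all add: le_imp_power_dvd)
  with Suc show ?case
    by (simp only: Rep_padic_int_Suc)
qed simp

instance padic_int :: (prime_card) idom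
proof
  fix x y :: "'a padic_int"
  let ?p = "int CARD('a)"
  assume "x \<noteq> 0" "y \<noteq> 0"
  then obtain m k where mk: "Rep_padic_int x m \<noteq> 0" "Rep_padic_int y k \<noteq> 0"
    by (metis Rep_padic_int_inject zero_padic_int.rep_eq ext)
  define a b where "a = Rep_padic_int x (m + k)" and "b = Rep_padic_int y (m + k)"
  have na: "\<not> ?p ^ m dvd a" and nb: "\<not> ?p ^ k dvd b"
    using mk Rep_padic_int_mod[of x m k] Rep_padic_int_mod[of y k m]
    by (auto simp: a_def b_def add.commute mod_eq_0_iff_dvd)
  have prm: "prime_elem ?p"
    using prime_card_int by blast
  have nz: "a \<noteq> 0" "b \<noteq> 0" using na nb by auto
  have nu: "\<not> is_unit ?p" using prm by auto
  have "multiplicity ?p a < m" "multiplicity ?p b < k"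
    using na nb nz nu by (meson multiplicity_dvd' not_less)+
  then have "multiplicity ?p (a * b) < m + k"
    using prime_elem_multiplicity_mult_distrib[OF prm nz] by simp
  then have "\<not> ?p ^ (m + k) dvd a * b"
    using nz nu by (metis mult_eq_0_iff multiplicity_geI not_less)
  then have "Rep_padic_int (x * y) (m + k) \<noteq> 0"
    by (simp add: times_padic_int.rep_eq a_def b_def mod_eq_0_iff_dvd)
  then show "x * y \<noteq> 0"
    by (auto simp: zero_padic_int.rep_eq)
qed

type_synonym 'p padic = "'p padic_int fract"

section \<open>The groups\<close>

definition GL2 :: "('a::field ^ 2 ^ 2) monoid" where
  "GL2 = \<lparr>carrier = {A. invertible A}, mult = (**), one = mat 1\<rparr>"

definition Z2 :: "('a::field ^ 2 ^ 2) set" where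
  "Z2 = {z \<in> carrier GL2. \<forall>g \<in> carrier GL2. z ** g = g ** z}"

abbreviation padic_mat :: "'p::prime_card padic_int ^ 2 ^ 2 \<Rightarrow> 'p padic ^ 2 ^ 2" where
  "padic_mat \<equiv> map_matrix to_fract"

definition K2 :: "('p::prime_card padic ^ 2 ^ 2) set" where
  "K2 = padic_mat ` {A. invertible A}"

definition KZ :: "('p::prime_card padic ^ 2 ^ 2) set" where
  "KZ = K2 <#>\<^bsub>GL2\<^esub> Z2"

definition T1 :: "nat \<Rightarrow> ('p::prime_card padic ^ 2 ^ 2) set" where
  "T1 n = padic_mat ` {A.
     of_nat CARD('p) dvd A $ 1 $ 1 - 1 \<and> of_nat CARD('p) ^ n dvd A $ 1 $ 2 \<and>
     of_nat CARD('p) ^ n dvd A $ 2 $ 1 \<and> of_nat CARD('p) dvd A $ 2 $ 2 - 1}"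

section \<open>Symmetric powers\<close>

text \<open>The polynomial ring \<open>F[X,Y]\<close> is represented as \<open>F[X][Y]\<close>, and \<open>Sym^r F^2\<close> is the space
  of homogeneous polynomials \<open>c\<^sub>0 X^r + c\<^sub>1 X^(r-1) Y + \<dots> + c\<^sub>r Y^r\<close>.\<close>

definition Sym :: "nat \<Rightarrow> 'f::field poly poly set" where
  "Sym r = range (\<lambda>c. \<Sum>i\<le>r. monom (monom (c i) (r - i)) i)"

definition lin_form :: "'f::field \<Rightarrow> 'f \<Rightarrow> 'f poly poly" where
  "lin_form a c = monom (monom a 1) 0 + monom (monom c 0) 1"

text \<open>The left action \<open>P \<mapsto> P(aX + cY, bX + dY)\<close> of the matrix with rows \<open>(a, b)\<close> and \<open>(c, d)\<close>:
  on \<open>X = e\<^sub>1\<close>, \<open>Y = e\<^sub>2\<close> this is the standard representation.\<close>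

definition Sym_act :: "'f::field ^ 2 ^ 2 \<Rightarrow> 'f poly poly \<Rightarrow> 'f poly poly" where
  "Sym_act A P =
     poly (map_poly (\<lambda>q. poly (map_poly (\<lambda>a. [:[:a:]:]) q) (lin_form (A $ 1 $ 1) (A $ 2 $ 1))) P)
       (lin_form (A $ 1 $ 2) (A $ 2 $ 2))"

text \<open>Reduction \<open>\<int>\<^sub>p \<rightarrow> \<bbbF>\<^sub>p \<rightarrow> F\<close>; it is a ring homomorphism if \<open>F\<close> has characteristic \<open>p\<close>.\<close>

definition padic_red :: "'p padic_int \<Rightarrow> 'f::field" where
  "padic_red x = of_int (Rep_padic_int x 1)"

text \<open>The inflation of \<open>Sym^r F^2\<close> to \<open>K\<close>, extended to \<open>KZ\<close> with \<open>diag(p, p)\<close> acting trivially: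
  every element of \<open>KZ\<close> is uniquely of the form \<open>p^m k\<close> with \<open>m \<in> \<int>\<close> and \<open>k \<in> K\<close>, and it
  acts through \<open>k\<close> (lemmas \<open>KZ_decomp\<close> and \<open>KZ_act_eq\<close>).\<close>

definition KZ_int_part :: "'p::prime_card padic ^ 2 ^ 2 \<Rightarrow> 'p padic_int ^ 2 ^ 2" where
  "KZ_int_part g =
     (THE A. invertible A \<and> (\<exists>m::int. g = mat (of_nat CARD('p) powi m) ** padic_mat A))"

definition KZ_act :: "'p::prime_card padic ^ 2 ^ 2 \<Rightarrow> 'f::field poly poly \<Rightarrow> 'f poly poly" where
  "KZ_act g = Sym_act (map_matrix padic_red (KZ_int_part g))"

section \<open>Compact induction\<close>

text \<open>The functions \<open>f : G \<rightarrow> Sym^r F^2\<close> with \<open>f(\<kappa>g) = \<kappa>(f(g))\<close> for \<open>\<kappa> \<in> KZ\<close> whose support is a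
  finite union of cosets \<open>KZ g\<close>, extended by zero from \<open>G\<close> to all matrices. As \<open>KZ\<close> is open and
  compact modulo the centre and acts smoothly, these are exactly the locally constant equivariant
  functions with support compact modulo the centre.\<close>

definition cInd :: "nat \<Rightarrow> ('f::field, 'p::prime_card padic ^ 2 ^ 2 \<Rightarrow> 'f poly poly) module" where
  "cInd r = \<lparr>carrier = {f.
       (\<forall>g. g \<notin> carrier GL2 \<longrightarrow> f g = 0) \<and>
       (\<forall>g \<in> carrier GL2. f g \<in> Sym r) \<and>
       (\<forall>\<kappa> \<in> KZ. \<forall>g \<in> carrier GL2. f (\<kappa> ** g) = KZ_act \<kappa> (f g)) \<and>
       finite {KZ #>\<^bsub>GL2\<^esub> g | g. g \<in> carrier GL2 \<and> f g \<noteq> 0}},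
     mult = undefined, one = undefined,
     zero = (\<lambda>_. 0), add = (\<lambda>f g x. f x + g x), smult = (\<lambda>c f x. [:[:c:]:] * f x)\<rparr>"

definition right_transl ::
    "'p::prime_card padic ^ 2 ^ 2 \<Rightarrow> ('p padic ^ 2 ^ 2 \<Rightarrow> 'v) \<Rightarrow> 'p padic ^ 2 ^ 2 \<Rightarrow> 'v" where
  "right_transl h f = (\<lambda>g. f (g ** h))"

section \<open>The Hecke operator\<close>

text \<open>The endomorphisms of the compact induction form the convolution algebra of the functions
  \<open>\<phi> : G \<rightarrow> End(Sym^r F^2)\<close> with finite support modulo \<open>KZ\<close> and
  \<open>\<phi>(\<kappa>1 g \<kappa>2) = \<kappa>1 \<circ> \<phi>(g) \<circ> \<kappa>2\<close>, where \<open>\<phi>\<close> maps \<open>f\<close> to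
  \<open>g \<mapsto> \<Sum>\<^bsub>yKZ \<in> G/KZ\<^esub> \<phi>(y)(f(y^(-1) g))\<close>. The operator \<open>T\<close> of Barthel and Livne belongs to
  the \<open>\<phi>\<close> with support \<open>KZ \<alpha>^(-1) KZ\<close>, \<open>\<alpha> = diag(1, p)\<close>, and \<open>\<phi>(\<alpha>^(-1)) = U\<close>
  for the projection \<open>U\<close> below. The value of \<open>\<phi>\<close> does not depend on the chosen factorization
  (lemma \<open>hecke_phi_eq\<close>), and the sum has \<open>p + 1\<close> terms, which do not depend on the
  chosen representatives.\<close>

definition alpha :: "'p::prime_card padic ^ 2 ^ 2" where
  "alpha = vector [vector [1, 0], vector [0, of_nat CARD('p)]]"

definition hecke_supp :: "('p::prime_card padic ^ 2 ^ 2) set" where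
  "hecke_supp = {\<kappa>1 ** matrix_inv alpha ** \<kappa>2 | \<kappa>1 \<kappa>2. \<kappa>1 \<in> KZ \<and> \<kappa>2 \<in> KZ}"

text \<open>\<open>X^(r-i) Y^i \<mapsto> 0\<close> for \<open>i \<noteq> r\<close> and \<open>Y^r \<mapsto> Y^r\<close>.\<close>

definition U_op :: "nat \<Rightarrow> 'f::field poly poly \<Rightarrow> 'f poly poly" where
  "U_op r P = monom (coeff P r) r"

definition hecke_phi ::
    "nat \<Rightarrow> 'p::prime_card padic ^ 2 ^ 2 \<Rightarrow> 'f::field poly poly \<Rightarrow> 'f poly poly" where
  "hecke_phi r g P =
     (if g \<in> hecke_supp
      then let (\<kappa>1, \<kappa>2) = (SOME (\<kappa>1, \<kappa>2). \<kappa>1 \<in> KZ \<and> \<kappa>2 \<in> KZ \<and> g = \<kappa>1 ** matrix_inv alpha ** \<kappa>2)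
           in KZ_act \<kappa>1 (U_op r (KZ_act \<kappa>2 P))
      else 0)"

definition hecke_T ::
    "nat \<Rightarrow> ('p::prime_card padic ^ 2 ^ 2 \<Rightarrow> 'f::field poly poly) \<Rightarrow> 'p padic ^ 2 ^ 2 \<Rightarrow> 'f poly poly"
  where
  "hecke_T r f g =
     (if g \<in> carrier GL2
      then \<Sum>C \<in> {y <#\<^bsub>GL2\<^esub> KZ | y. y \<in> hecke_supp}.
             let y = (SOME y. y \<in> C) in hecke_phi r y (f (matrix_inv y ** g))
      else 0)"

section \<open>The representation \<open>\<pi>(r, \<lambda>)\<close>\<close>

text \<open>\<open>\<pi>(r, \<lambda>)\<close> is the quotient of the compact induction by the image of \<open>T - \<lambda>\<close>, with the cosets
  of that image as elements. The ring fields \<open>mult\<close> and \<open>one\<close> of the module records are irrelevant for modules.\<close>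

definition quot_module :: "('a, 'b) module \<Rightarrow> 'b set \<Rightarrow> ('a, 'b set) module" where
  "quot_module M W = \<lparr>carrier = a_rcosets\<^bsub>M\<^esub> W, mult = undefined, one = undefined,
     zero = W, add = (<+>\<^bsub>M\<^esub>), smult = (\<lambda>c A. \<Union>a \<in> A. W +>\<^bsub>M\<^esub> (c \<odot>\<^bsub>M\<^esub> a))\<rparr>"

definition pi_rep ::
    "nat \<Rightarrow> 'f::field \<Rightarrow> ('f, ('p::prime_card padic ^ 2 ^ 2 \<Rightarrow> 'f poly poly) set) module" where
  "pi_rep r lam =
     quot_module (cInd r) ((\<lambda>f g. hecke_T r f g - [:[:lam:]:] * f g) ` carrier (cInd r))"

text \<open>\<open>G\<close> acts on functions by right translation and on cosets \<open>W + f\<close> elementwise.\<close>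

definition invariants ::
    "('f, ('p::prime_card padic ^ 2 ^ 2 \<Rightarrow> 'v) set) module \<Rightarrow> ('p padic ^ 2 ^ 2) set \<Rightarrow>
     ('f, ('p padic ^ 2 ^ 2 \<Rightarrow> 'v) set) module" where
  "invariants V H = V\<lparr>carrier := {A \<in> carrier V. \<forall>h \<in> H. right_transl h ` A = A}\<rparr>"

definition ring_of_field :: "'f::field ring" where
  "ring_of_field = \<lparr>carrier = UNIV, mult = (*), one = 1, zero = 0, add = (+)\<rparr>"

section \<open>Well-definedness\<close>

lemma Rep_of_nat: "Rep_padic_int (of_nat k :: 'p::prime_card padic_int) n = int k mod int CARD('p) ^ n"
  by (induction k) (simp_all add: zero_padic_int.rep_eq one_padic_int.rep_eq plus_padic_int.rep_eq mod_simps)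

lemma p_not_unit: "\<not> (of_nat CARD('p) :: 'p::prime_card padic_int) dvd 1"
proof
  assume "(of_nat CARD('p) :: 'p padic_int) dvd 1"
  then obtain y :: "'p padic_int" where "1 = of_nat CARD('p) * y" by blast
  then have "Rep_padic_int (1 :: 'p padic_int) 1 = Rep_padic_int (of_nat CARD('p) * y) 1" by simp
  moreover have "int CARD('p) > 1" using prime_card_int prime_gt_1_int by blast
  ultimately show False by (simp add: one_padic_int.rep_eq times_padic_int.rep_eq Rep_of_nat)
qed

lemma to_fract_of_nat: "to_fract (of_nat k :: 'a::idom) = of_nat k"
  by (induction k) simp_all

lemma to_fract_power: "to_fract (x ^ k :: 'a::idom) = to_fract x ^ k"
  by (induction k) simp_all

lemma scalar_mat_nth: "(mat c ** (M :: 'a::comm_ring_1 ^ 2 ^ 2)) $ i $ j = c * M $ i $ j"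
  using exhaust_2[of i] by (auto simp: matrix_matrix_mult_def mat_def sum_2)

lemma det_unit: "invertible (A :: 'a::comm_ring_1 ^ 2 ^ 2) \<Longrightarrow> det A dvd 1"
  unfolding invertible_def by (metis det_I det_mul dvd_triv_left)

lemma p_nonzero: "(of_nat CARD('p) :: 'p::prime_card padic) \<noteq> 0"
proof
  assume "(of_nat CARD('p) :: 'p::prime_card padic) = 0"
  then have "to_fract (of_nat CARD('p) :: 'p padic_int) = to_fract 0"
    by (simp add: to_fract_of_nat)
  then have *: "(of_nat CARD('p) :: 'p padic_int) = 0" by (simp only: to_fract_eq_iff)
  then have "Rep_padic_int (of_nat CARD('p) :: 'p padic_int) 2 = Rep_padic_int (0 :: 'p padic_int) 2" by (simp only: *)
  moreover have "int CARD('p) > 1" using prime_card_int prime_gt_1_int by blast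
  moreover from this have "int CARD('p) < int CARD('p) ^ 2"
    using power_strict_increasing[of 1 2 "int CARD('p)"] by simp
  ultimately show False
    unfolding Rep_of_nat zero_padic_int.rep_eq by simp
qed

lemma KZ_decomp_unique_aux:
  fixes A A' :: "'p::prime_card padic_int ^ 2 ^ 2"
  assumes "invertible A" "invertible A'" "m \<le> m'"
    and eq: "mat (of_nat CARD('p) powi m) ** padic_mat A = mat (of_nat CARD('p) powi m') ** padic_mat A'"
  shows "m = m' \<and> A = A'"
proof -
  let ?P = "of_nat CARD('p) :: 'p padic" and ?p = "of_nat CARD('p) :: 'p padic_int"
  define k where "k = nat (m' - m)"
  have m': "m' = m + int k" using assms by (simp add: k_def)
  have P: "?P \<noteq> 0" by (rule p_nonzero)
  have pw: "?P powi m' = ?P powi m * ?P ^ k" using P by (simp add: m' power_int_add)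
  have ent: "A $ i $ j = ?p ^ k * A' $ i $ j" for i j
  proof -
    have "?P powi m * to_fract (A $ i $ j) = ?P powi m * (?P ^ k * to_fract (A' $ i $ j))"
      using arg_cong[OF eq, of "\<lambda>M. M $ i $ j"] by (simp add: scalar_mat_nth pw mult.assoc)
    then have "to_fract (A $ i $ j) = ?P ^ k * to_fract (A' $ i $ j)" using P by simp
    also have "\<dots> = to_fract (?p ^ k * A' $ i $ j)"
      by (simp add: to_fract_power to_fract_of_nat)
    finally show ?thesis by (simp only: to_fract_eq_iff)
  qed
  have "?p ^ k dvd det A" by (simp add: det_2 ent)
  then have "?p ^ k dvd 1" using det_unit[OF assms(1)] dvd_trans by blast
  then have "k = 0" using p_not_unit[where 'p = 'p]
    by (metis dvd_power dvd_trans gr0I)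
  then show ?thesis using ent m' by (simp add: vec_eq_iff)
qed

lemma KZ_int_part_eq:
  fixes A :: "'p::prime_card padic_int ^ 2 ^ 2"
  assumes "invertible A"
  shows "KZ_int_part (mat (of_nat CARD('p) powi m) ** padic_mat A) = A"
  unfolding KZ_int_part_def
proof (rule the_equality)
  fix B :: "'p padic_int ^ 2 ^ 2"
  assume "invertible B \<and> (\<exists>m'. mat (of_nat CARD('p) powi m) ** padic_mat A = mat (of_nat CARD('p) powi m') ** padic_mat B)"
  then show "B = A" using KZ_decomp_unique_aux assms by (metis linorder_le_cases)
qed (use assms in blast)

lemma padic_mat_mult: "padic_mat (A ** B) = padic_mat A ** padic_mat B"
  by (simp add: vec_eq_iff matrix_matrix_mult_def sum_2)

definition subst_XY :: "('f::field poly poly) \<Rightarrow> 'f poly poly \<Rightarrow> 'f poly poly \<Rightarrow> 'f poly poly" where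
  "subst_XY u v P = poly (map_poly (\<lambda>q. poly (map_poly (\<lambda>a. [:[:a:]:]) q) u) P) v"

lemma map_poly_hom:
  assumes "comm_ring_hom f"
  shows "comm_ring_hom (\<lambda>q. poly (map_poly f q) u)"
proof -
  interpret f: comm_ring_hom f by fact
  interpret map_poly_comm_ring_hom f ..
  show ?thesis by unfold_locales (simp_all add: hom_distribs)
qed

lemma subst_XY_hom: "comm_ring_hom (subst_XY u v)"
  unfolding subst_XY_def
  by (intro map_poly_hom) (unfold_locales, auto simp: one_pCons)

lemma subst_XY_simps: "subst_XY u v [:[:a:]:] = [:[:a:]:]" "subst_XY u v [:[:0,1:]:] = u" "subst_XY u v [:0,1:] = v"
proof -
  interpret i: comm_ring_hom "\<lambda>q. poly (map_poly (\<lambda>a. [:[:a:]:]) q) u"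
    by (intro map_poly_hom) (unfold_locales, auto simp: one_pCons)
  have "map_poly (\<lambda>a. [:[:a:]:]) [:a:] = [:[:[:a:]:]:]" for a :: 'a
    by (subst Polynomial.map_poly_pCons) simp_all
  then have a: "poly (map_poly (\<lambda>a. [:[:a:]:]) [:a:]) u = [:[:a:]:]" for a :: 'a by simp
  show "subst_XY u v [:[:a:]:] = [:[:a:]:]"
    unfolding subst_XY_def by (subst Polynomial.map_poly_pCons) (simp_all add: a)
  have "map_poly (\<lambda>a. [:[:a:]:]) [:0, 1:] = [:0, 1 :: 'a poly poly:]"
    by (simp add: Polynomial.map_poly_pCons pCons_one)
  then show "subst_XY u v [:[:0,1:]:] = u"
    unfolding subst_XY_def by (subst Polynomial.map_poly_pCons) simp_all
  show "subst_XY u v [:0,1:] = v"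
    unfolding subst_XY_def by (subst Polynomial.map_poly_pCons) (simp_all add: Polynomial.map_poly_pCons)
qed

lemma poly_poly_hom_ext:
  fixes P :: "'f::field poly poly" and f g :: "'f poly poly \<Rightarrow> 'f poly poly"
  assumes "comm_ring_hom f" "comm_ring_hom g"
    "\<And>a. f [:[:a:]:] = g [:[:a:]:]" "f [:[:0,1:]:] = g [:[:0,1:]:]" "f [:0,1:] = g [:0,1:]"
  shows "f P = g P"
proof -
  interpret f: comm_ring_hom f by fact
  interpret g: comm_ring_hom g by fact
  have c: "f [:q:] = g [:q:]" for q
  proof (induction q)
    case (pCons a q)
    have "[:pCons a q:] = [:[:a:]:] + [:[:0,1:]:] * [:q:]" by simp
    then show ?case using pCons assms by (simp only: f.hom_add f.hom_mult g.hom_add g.hom_mult)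
  qed simp
  show ?thesis
  proof (induction P)
    case (pCons q P)
    have "pCons q P = [:q:] + [:0,1:] * P" by simp
    then show ?case using pCons assms c by (simp only: f.hom_add f.hom_mult g.hom_add g.hom_mult)
  qed simp
qed

lemma Sym_act_subst_XY: "Sym_act A = subst_XY (lin_form (A $ 1 $ 1) (A $ 2 $ 1)) (lin_form (A $ 1 $ 2) (A $ 2 $ 2))"
  by (simp add: fun_eq_iff Sym_act_def subst_XY_def)

lemma Sym_act_hom: "comm_ring_hom (Sym_act A)"
  unfolding Sym_act_subst_XY by (rule subst_XY_hom)

lemma lin_form_alt: "lin_form a c = [:[:a:]:] * [:[:0,1:]:] + [:[:c:]:] * [:0,1:]"
  by (simp add: lin_form_def monom_altdef)

lemma Sym_act_simps:
  "Sym_act A [:[:a:]:] = [:[:a:]:]" 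
  "Sym_act A [:[:0,1:]:] = lin_form (A $ 1 $ 1) (A $ 2 $ 1)"
  "Sym_act A [:0,1:] = lin_form (A $ 1 $ 2) (A $ 2 $ 2)"
  unfolding Sym_act_subst_XY subst_XY_simps by simp_all

lemma Sym_act_mult: "Sym_act (A ** B) P = Sym_act A (Sym_act B P)"
proof -
  interpret a: comm_ring_hom "Sym_act A" by (rule Sym_act_hom)
  interpret b: comm_ring_hom "Sym_act B" by (rule Sym_act_hom)
  have "comm_ring_hom (\<lambda>P. Sym_act A (Sym_act B P))"
    by unfold_locales (simp_all add: a.hom_add b.hom_add a.hom_mult b.hom_mult)
  have lf: "Sym_act A (lin_form x y) = lin_form (A $ 1 $ 1 * x + A $ 1 $ 2 * y) (A $ 2 $ 1 * x + A $ 2 $ 2 * y)" for x y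
    unfolding lin_form_alt a.hom_add a.hom_mult Sym_act_simps
    by (simp add: algebra_simps)
  show ?thesis
    by (rule poly_poly_hom_ext[of "Sym_act (A ** B)" "\<lambda>P. Sym_act A (Sym_act B P)"]) 
      (use Sym_act_hom \<open>comm_ring_hom (\<lambda>P. Sym_act A (Sym_act B P))\<close> in
       \<open>simp_all add: Sym_act_simps lf matrix_matrix_mult_def sum_2\<close>)
qed

lemma U_op_eq:
  assumes "P \<in> Sym r"
  shows "U_op r P = Sym_act (vector [vector [0, 0], vector [0, 1]]) P"
proof -
  let ?D = "vector [vector [0, 0], vector [0, 1]] :: 'a ^ 2 ^ 2"
  interpret comm_ring_hom "Sym_act ?D" by (rule Sym_act_hom)
  obtain c where P: "P = (\<Sum>i\<le>r. monom (monom (c i) (r - i)) i)"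
    using assms by (auto simp: Sym_def)
  have m: "monom (monom a j) i = [:[:a:]:] * [:[:0,1:]:] ^ j * [:0,1:] ^ i" for a :: 'a and i j
    by (simp add: monom_altdef poly_const_pow smult_power)
  have "Sym_act ?D (monom (monom a j) i) = (if j = 0 then monom (monom a j) i else 0)" for a i j
    unfolding m hom_mult hom_power Sym_act_simps by (simp add: lin_form_alt pCons_one)
  then have "Sym_act ?D P = (\<Sum>i\<le>r. if r - i = 0 then monom (monom (c i) (r - i)) i else 0)"
    by (simp only: P hom_sum)
  also have "\<dots> = (\<Sum>i\<le>r. if i = r then monom (monom (c i) (r - i)) i else 0)"
    by (rule sum.cong) auto
  also have "\<dots> = monom (monom (c r) 0) r" by simp
  also have "monom (c r) 0 = coeff P r"
    by (simp add: P coeff_sum)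
  finally show ?thesis by (simp add: U_op_def)
qed

lemma Sym_sum: "finite I \<Longrightarrow> (\<And>i. i \<in> I \<Longrightarrow> f i \<in> Sym r) \<Longrightarrow> sum f I \<in> Sym r"
proof (induction I rule: finite_induct)
  case empty
  show ?case by (auto simp: Sym_def intro!: image_eqI[of _ _ "\<lambda>_. 0"])
next
  case (insert x F)
  have "f x \<in> Sym r" "sum f F \<in> Sym r" using insert by auto
  then obtain c d where "f x = (\<Sum>i\<le>r. monom (monom (c i) (r - i)) i)" 
     "sum f F = (\<Sum>i\<le>r. monom (monom (d i) (r - i)) i)" unfolding Sym_def image_iff by blast
  then have "sum f (insert x F) = (\<Sum>i\<le>r. monom (monom (c i + d i) (r - i)) i)"
    using insert by (simp add: sum.distrib add_monom[symmetric])
  then show ?case by (auto simp: Sym_def)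
qed

lemma Sym_monom: "i \<le> r \<Longrightarrow> j = r - i \<Longrightarrow> monom (monom a j) i \<in> Sym r"
  unfolding Sym_def
  by (rule image_eqI[of _ _ "\<lambda>k. if k = i then a else 0"])
    (simp_all add: sum.remove[of "{..r}" i])

lemma Sym_mult: 
  assumes "P \<in> Sym r" "Q \<in> Sym s" shows "P * Q \<in> Sym (r + s)"
proof -
  obtain c d where "P = (\<Sum>i\<le>r. monom (monom (c i) (r - i)) i)" 
     "Q = (\<Sum>i\<le>s. monom (monom (d i) (s - i)) i)" using assms unfolding Sym_def image_iff by blast
  then show ?thesis
    by (simp only: sum_product) (auto simp: mult_monom intro!: Sym_sum Sym_monom)
qed

lemma Sym_power: "P \<in> Sym r \<Longrightarrow> P ^ k \<in> Sym (r * k)"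
proof (induction k)
  case 0
  show ?case using Sym_monom[of 0 0 0 1] by simp
qed (simp add: Sym_mult)

lemma Sym_act_closed: "P \<in> Sym r \<Longrightarrow> Sym_act A P \<in> Sym r"
proof -
  interpret comm_ring_hom "Sym_act A" by (rule Sym_act_hom)
  assume "P \<in> Sym r"
  then obtain c where P: "P = (\<Sum>i\<le>r. monom (monom (c i) (r - i)) i)"
    by (auto simp: Sym_def)
  have m: "monom (monom a j) i = [:[:a:]:] * ([:[:0,1:]:] ^ j * [:0,1:] ^ i)" for a :: 'a and i j
    by (simp add: monom_altdef poly_const_pow smult_power)
  have l: "lin_form a c \<in> Sym 1" for a c :: 'a
    unfolding lin_form_def using Sym_sum[of "UNIV" "\<lambda>b. if b then monom (monom a 1) 0 else monom (monom c 0) 1" 1]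
    by (simp add: UNIV_bool Sym_monom add.commute)
  have "Sym_act A (monom (monom a (r - i)) i) \<in> Sym r" if "i \<le> r" for a i
  proof -
    have "[:[:a:]:] * (lin_form (A $ 1 $ 1) (A $ 2 $ 1) ^ (r - i) * lin_form (A $ 1 $ 2) (A $ 2 $ 2) ^ i) \<in> Sym (0 + (1 * (r - i) + 1 * i))"
      using Sym_monom[of 0 0 0 a] by (intro Sym_mult Sym_power l) (simp add: monom_0)
    then show ?thesis using that
      unfolding m hom_mult hom_power Sym_act_simps by simp
  qed
  then show ?thesis by (auto simp: P hom_sum intro!: Sym_sum)
qed

lemma padic_red_hom:
  assumes "CHAR('f::field) = CARD('p)"
  shows "comm_ring_hom (padic_red :: 'p::prime_card padic_int \<Rightarrow> 'f)"
proof -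
  have h: "of_int (a mod int CARD('p)) = (of_int a :: 'f)" for a
  proof -
    have "(of_int (int CARD('p)) :: 'f) = 0" using of_nat_CHAR[where 'a = 'f] assms by simp
    then show ?thesis
      using arg_cong[OF mult_div_mod_eq[of "int CARD('p)" a], of "of_int :: int \<Rightarrow> 'f"]
      by (simp only: of_int_add of_int_mult) simp
  qed
  have p: "int CARD('p) > 1" using prime_card_int prime_gt_1_int by blast
  show ?thesis
    by unfold_locales (simp_all add: padic_red_def plus_padic_int.rep_eq times_padic_int.rep_eq
      zero_padic_int.rep_eq one_padic_int.rep_eq h p)
qed

lemma KZ_act_eq:
  fixes A :: "'p::prime_card padic_int ^ 2 ^ 2"
  assumes "invertible A"
  shows "KZ_act (mat (of_nat CARD('p) powi m) ** padic_mat A) = Sym_act (map_matrix padic_red A)"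
  by (simp add: KZ_act_def KZ_int_part_eq[OF assms])

lemma padic_p_dvd:
  fixes x :: "'p::prime_card padic_int"
  assumes "Rep_padic_int x 1 = 0"
  shows "\<exists>y. x = of_nat CARD('p) * y \<and> (\<forall>n. Rep_padic_int y n = Rep_padic_int x (Suc n) div int CARD('p))"
proof -
  let ?p = "int CARD('p)"
  have p: "?p > 1" using prime_card_int prime_gt_1_int by blast
  define f where "f n = Rep_padic_int x (Suc n) div ?p" for n
  have ff: "f n = f (Suc n) mod ?p ^ n" for n
  proof -
    have "f n = (Rep_padic_int x (Suc (Suc n)) mod ?p ^ Suc n) div ?p"
      by (simp only: f_def Rep_padic_int_Suc)
    then show ?thesis
      using p unfolding f_def power_Suc
      by (subst (asm) zmod_zmult2_eq) simp_all
  qed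
  have R: "Rep_padic_int (Abs_padic_int f :: 'p padic_int) = f"
    by (rule Abs_padic_int_inverse) (use ff in blast)
  have d: "?p * f n = Rep_padic_int x (Suc n)" for n
  proof -
    have "Rep_padic_int x (1 + n) mod ?p ^ 1 = 0" using Rep_padic_int_mod[of x 1 n] assms by simp
    then have "?p dvd Rep_padic_int x (Suc n)" by (simp add: dvd_eq_mod_eq_0)
    then show ?thesis by (simp add: f_def)
  qed
  have "x = of_nat CARD('p) * Abs_padic_int f"
    by (rule padic_int_eqI) (simp add: times_padic_int.rep_eq Rep_of_nat R mod_simps d Rep_padic_int_Suc)
  then show ?thesis using R f_def by metis
qed

lemma padic_unit:
  fixes x :: "'p::prime_card padic_int"
  assumes "Rep_padic_int x 1 \<noteq> 0"
  shows "x dvd 1"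
proof -
  let ?p = "int CARD('p)"
  have prm: "prime ?p" by (rule prime_card_int)
  have cop: "coprime (Rep_padic_int x n) (?p ^ n)" for n
  proof (cases n)
    case (Suc k)
    have "\<not> ?p dvd Rep_padic_int x n"
      using Rep_padic_int_mod[of x 1 k] assms Suc by auto
    then have "coprime ?p (Rep_padic_int x n)" using prm by (rule prime_imp_coprime[rotated])
    then show ?thesis by (metis coprime_commute coprime_power_right_iff)
  qed simp
  have "\<exists>b. [Rep_padic_int x n * b = 1] (mod ?p ^ n)" for n
    using cop cong_solve_coprime_int by blast
  then obtain b where b: "\<And>n. [Rep_padic_int x n * b n = 1] (mod ?p ^ n)" by metis
  define f where "f n = b n mod ?p ^ n" for n
  have fb: "[Rep_padic_int x n * f n = 1] (mod ?p ^ n)" for n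
    using b[of n] by (simp add: f_def cong_def mod_simps)
  have ff: "f n = f (Suc n) mod ?p ^ n" for n
  proof -
    have "[Rep_padic_int x (Suc n) * f (Suc n) = 1] (mod ?p ^ n)"
      using fb[of "Suc n"] by (rule cong_dvd_modulus) (simp add: le_imp_power_dvd)
    then have "[Rep_padic_int x n * f (Suc n) = 1] (mod ?p ^ n)"
      unfolding cong_def by (subst (asm) mod_mult_left_eq[symmetric]) (simp only: Rep_padic_int_Suc)
    then have "[Rep_padic_int x n * f (Suc n) = Rep_padic_int x n * f n] (mod ?p ^ n)"
      using fb[of n] cong_sym cong_trans by blast
    then have "[f (Suc n) = f n] (mod ?p ^ n)"
      using cop[of n] cong_mult_lcancel by blast
    then show ?thesis by (simp add: cong_def f_def)
  qed
  have R: "Rep_padic_int (Abs_padic_int f :: 'p padic_int) = f"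
    by (rule Abs_padic_int_inverse) (use ff in blast)
  have "x * Abs_padic_int f = 1"
    by (rule padic_int_eqI) (use fb in \<open>simp add: times_padic_int.rep_eq one_padic_int.rep_eq R cong_def\<close>)
  then show ?thesis by (metis dvd_triv_left)
qed

lemma padic_decomp_aux:
  fixes x :: "'p::prime_card padic_int"
  shows "Rep_padic_int x m \<noteq> 0 \<Longrightarrow> \<exists>k u. u dvd 1 \<and> x = of_nat CARD('p) ^ k * u"
proof (induction m arbitrary: x)
  case 0
  then show ?case using Rep_padic_int_mod_self[of x 0] by simp
next
  case (Suc m)
  show ?case
  proof (cases "Rep_padic_int x 1 = 0")
    case True
    then obtain y where y: "x = of_nat CARD('p) * y" "Rep_padic_int y m = Rep_padic_int x (Suc m) div int CARD('p)"
      using padic_p_dvd by blast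
    have "int CARD('p) dvd Rep_padic_int x (Suc m)"
      using Rep_padic_int_mod[of x 1 m] True by auto
    with y Suc.prems have "Rep_padic_int y m \<noteq> 0"
      by (metis dvd_div_eq_0_iff)
    then obtain k u where "u dvd 1" "y = of_nat CARD('p) ^ k * u" using Suc.IH by blast
    then show ?thesis using y by (intro exI[of _ "Suc k"] exI[of _ u]) (simp add: mult.assoc)
  next
    case False
    then show ?thesis using padic_unit by (intro exI[of _ 0] exI[of _ x]) simp
  qed
qed

lemma padic_decomp:
  fixes x :: "'p::prime_card padic_int"
  assumes "x \<noteq> 0" shows "\<exists>k u. u dvd 1 \<and> x = of_nat CARD('p) ^ k * u"
proof -
  obtain m where "Rep_padic_int x m \<noteq> 0"
    using assms padic_int_eqI[of x 0] by (auto simp: zero_padic_int.rep_eq)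
  then show ?thesis by (rule padic_decomp_aux)
qed

lemma padic_field_decomp:
  fixes c :: "'p::prime_card padic"
  assumes "c \<noteq> 0" shows "\<exists>m u. u dvd 1 \<and> c = of_nat CARD('p) powi m * to_fract u"
proof -
  obtain x y :: "'p padic_int" where c: "c = Fraction_Field.Fract x y" "y \<noteq> 0" by (cases c)
  then have "x \<noteq> 0" using assms by (auto simp: Fraction_Field.fract_collapse)
  then obtain k u where x: "u dvd 1" "x = of_nat CARD('p) ^ k * u" using padic_decomp by blast
  obtain l v where y: "v dvd 1" "y = of_nat CARD('p) ^ l * v" using padic_decomp c by blast
  obtain w where w: "v * w = 1" using y by (auto simp: dvd_def)
  have c': "c = to_fract x / to_fract y" using c by (simp add: Fract_conv_to_fract)
  have P: "(of_nat CARD('p) :: 'p padic) \<noteq> 0" by (rule p_nonzero)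
  have w': "to_fract v * to_fract w = 1" using w by (metis to_fract_1 to_fract_mult)
  then have v': "1 / to_fract v = to_fract w" by (metis mult_zero_left nonzero_mult_div_cancel_left zero_neq_one)
  have "c = of_nat CARD('p) ^ k / of_nat CARD('p) ^ l * to_fract u * (1 / to_fract v)"
    by (simp add: c' x y to_fract_power to_fract_of_nat)
  also have "of_nat CARD('p) ^ k / of_nat CARD('p) ^ l = (of_nat CARD('p) :: 'p padic) powi (int k - int l)"
    using P by (simp add: power_int_diff)
  finally have "c = of_nat CARD('p) powi (int k - int l) * to_fract (u * w)"
    by (simp add: v' mult.assoc)
  moreover have "u * w dvd 1" using x w by (metis dvd_triv_right is_unit_mult_iff)
  ultimately show ?thesis by blast
qed

lemma center_scalar: "z \<in> Z2 \<Longrightarrow> \<exists>c. c \<noteq> 0 \<and> (z :: 'a::field ^ 2 ^ 2) = mat c"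
proof -
  assume z: "z \<in> Z2"
  define u :: "'a ^ 2 ^ 2" where "u = vector [vector [1, 1], vector [0, 1]]"
  define w :: "'a ^ 2 ^ 2" where "w = vector [vector [1, 0], vector [1, 1]]"
  have "invertible u" "invertible w"
    by (simp_all add: invertible_det_nz det_2 u_def w_def)
  then have c: "z ** u = u ** z" "z ** w = w ** z" using z by (auto simp: Z2_def GL2_def)
  have "z $ 1 $ 2 = 0" "z $ 2 $ 1 = 0" "z $ 1 $ 1 = z $ 2 $ 2"
    using c by (simp_all add: u_def w_def vec_eq_iff forall_2 matrix_matrix_mult_def sum_2)
  then have "z = mat (z $ 1 $ 1)" by (simp add: vec_eq_iff forall_2 mat_def)
  moreover have "z $ 1 $ 1 \<noteq> 0"
    using z \<open>z $ 1 $ 2 = 0\<close> \<open>z $ 1 $ 1 = z $ 2 $ 2\<close> by (auto simp: Z2_def GL2_def invertible_det_nz det_2)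
  ultimately show ?thesis by blast
qed

lemma scalar_comm: "(M :: 'a::comm_ring_1 ^ 2 ^ 2) ** mat c = mat c ** M"
  by (simp add: vec_eq_iff forall_2 mat_def matrix_matrix_mult_def sum_2 mult.commute)

lemma scalar_mult: "mat c ** (mat d :: 'a::comm_ring_1 ^ 2 ^ 2) = mat (c * d)"
  by (simp add: vec_eq_iff forall_2 mat_def matrix_matrix_mult_def sum_2)

lemma scalar_triple:
  fixes X Y Z :: "'a::comm_ring_1 ^ 2 ^ 2"
  shows "(mat a ** X) ** (mat b ** Y) ** (mat c ** Z) = mat (a * (b * c)) ** (X ** Y ** Z)"
proof -
  have sc: "mat c ** M = (\<chi> i j. c * M $ i $ j)" for c and M :: "'a ^ 2 ^ 2"
    by (simp add: vec_eq_iff scalar_mat_nth)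
  show ?thesis
    unfolding sc by (simp add: vec_eq_iff matrix_matrix_mult_def sum_2 algebra_simps)
qed

lemma KZ_decomp:
  assumes "(g :: 'p::prime_card padic ^ 2 ^ 2) \<in> KZ"
  shows "\<exists>m A. invertible A \<and> g = mat (of_nat CARD('p) powi m) ** padic_mat A"
proof -
  obtain B z where B: "invertible B" "z \<in> Z2" "g = padic_mat B ** z"
    using assms by (auto simp: KZ_def K2_def set_mult_def GL2_def)
  then obtain c where c: "c \<noteq> 0" "z = mat c" using center_scalar by blast
  then obtain m u where u: "u dvd 1" "c = of_nat CARD('p) powi m * to_fract u" using padic_field_decomp by blast
  then obtain v where v: "u * v = 1" by (auto simp: dvd_def)
  have "invertible (mat u :: 'p padic_int ^ 2 ^ 2)"
    unfolding invertible_def using v by (intro exI[of _ "mat v"]) (simp add: scalar_mult mult.commute)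
  then have inv: "invertible (mat u ** B)" using B by (simp add: invertible_mult)
  have "padic_mat (mat u) = mat (to_fract u)" by (simp add: vec_eq_iff mat_def)
  then have "g = mat (of_nat CARD('p) powi m) ** padic_mat (mat u ** B)"
    unfolding B(3) c(2) u(2) padic_mat_mult scalar_comm[of "padic_mat B"]
    by (simp add: scalar_mult matrix_mul_assoc)
  with inv show ?thesis by blast
qed

abbreviation "diag_p \<equiv> vector [vector [of_nat CARD('p), 0], vector [0, 1]] :: 'p::prime_card padic_int ^ 2 ^ 2"

lemma alpha_inv: "matrix_inv (alpha :: 'p::prime_card padic ^ 2 ^ 2) = mat (of_nat CARD('p) powi (-1)) ** padic_mat diag_p"
proof -
  let ?M = "mat (of_nat CARD('p) powi (-1)) ** padic_mat diag_p :: 'p padic ^ 2 ^ 2"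
  have "alpha ** ?M = mat 1" "?M ** alpha = mat 1"
    using p_nonzero[where 'p = 'p]
    by (simp_all add: vec_eq_iff forall_2 mat_def matrix_matrix_mult_def sum_2 alpha_def to_fract_of_nat)
  note M = this
  have "alpha ** matrix_inv alpha = (mat 1 :: 'p padic ^ 2 ^ 2)"
    unfolding matrix_inv_def by (rule someI2[where a = ?M]) (use M in auto)
  then have "?M ** (alpha ** matrix_inv alpha) = ?M" by simp
  then show ?thesis by (simp only: matrix_mul_assoc M(2) matrix_mul_lid)
qed

lemma hecke_decomp_unique_aux:
  fixes A A' B B' :: "'p::prime_card padic_int ^ 2 ^ 2"
  assumes "invertible A" "invertible A'" "invertible B" "invertible B'" "m \<le> m'"
    and eq: "mat (of_nat CARD('p) powi m) ** padic_mat (A ** diag_p ** B) = mat (of_nat CARD('p) powi m') ** padic_mat (A' ** diag_p ** B')"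
  shows "A ** diag_p ** B = A' ** diag_p ** B'"
proof -
  let ?P = "of_nat CARD('p) :: 'p padic" and ?p = "of_nat CARD('p) :: 'p padic_int"
  let ?N = "A ** diag_p ** B" and ?N' = "A' ** diag_p ** B'"
  define k where "k = nat (m' - m)"
  have m': "m' = m + int k" using assms by (simp add: k_def)
  have P: "?P \<noteq> 0" by (rule p_nonzero)
  have p: "?p \<noteq> 0" using P by (metis to_fract_0 to_fract_of_nat)
  have pw: "?P powi m' = ?P powi m * ?P ^ k" using P by (simp add: m' power_int_add)
  have ent: "?N $ i $ j = ?p ^ k * ?N' $ i $ j" for i j
  proof -
    have "?P powi m * to_fract (?N $ i $ j) = ?P powi m * (?P ^ k * to_fract (?N' $ i $ j))"
      using arg_cong[OF eq, of "\<lambda>M. M $ i $ j"] by (simp add: scalar_mat_nth pw mult.assoc)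
    then have "to_fract (?N $ i $ j) = ?P ^ k * to_fract (?N' $ i $ j)" using P by simp
    also have "\<dots> = to_fract (?p ^ k * ?N' $ i $ j)"
      by (simp add: to_fract_power to_fract_of_nat)
    finally show ?thesis by (simp only: to_fract_eq_iff)
  qed
  have D: "det diag_p = ?p" by (simp add: det_2)
  have "det ?N = ?p ^ k * ?p ^ k * det ?N'" unfolding det_2[of ?N] det_2[of ?N'] ent by (simp add: algebra_simps)
  then have "?p * (det A * det B) = ?p * (?p ^ k * ?p ^ k * det A' * det B')" by (simp add: det_mul D ac_simps)
  then have e: "det A * det B = ?p ^ k * (?p ^ k * det A' * det B')" using p by (simp add: mult.assoc)
  have "det A * det B dvd 1" using det_unit[OF assms(1)] det_unit[OF assms(3)] by (simp add: is_unit_mult_iff)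
  then have "?p ^ k dvd 1" unfolding e by (metis dvd_mult_left)
  then have "k = 0" using p_not_unit[where 'p = 'p]
    by (metis dvd_power dvd_trans gr0I)
  then show ?thesis using ent by (simp add: vec_eq_iff)
qed

lemma hecke_phi_eq:
  fixes P :: "'f::field poly poly" and \<kappa>1 \<kappa>2 :: "'p::prime_card padic ^ 2 ^ 2"
  assumes char: "CHAR('f) = CARD('p)" and P: "P \<in> Sym r" and k: "\<kappa>1 \<in> KZ" "\<kappa>2 \<in> KZ"
  shows "hecke_phi r (\<kappa>1 ** matrix_inv alpha ** \<kappa>2) P = KZ_act \<kappa>1 (U_op r (KZ_act \<kappa>2 P))"
proof -
  interpret red: comm_ring_hom "padic_red :: 'p padic_int \<Rightarrow> 'f" using char by (rule padic_red_hom)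
  let ?r = "map_matrix padic_red :: 'p padic_int ^ 2 ^ 2 \<Rightarrow> 'f ^ 2 ^ 2"
  have rp: "padic_red (of_nat CARD('p) :: 'p padic_int) = (0::'f)"
    using char of_nat_CHAR[where 'a = 'f] by (simp add: red.hom_of_nat)
  have rm: "?r (A ** B) = ?r A ** ?r B" for A B
    by (simp add: vec_eq_iff matrix_matrix_mult_def sum_2 red.hom_add red.hom_mult)
  have rD: "?r diag_p = vector [vector [0, 0], vector [0, 1]]"
    by (simp add: vec_eq_iff forall_2 rp)
  have key: "\<exists>m A B. invertible A \<and> invertible B \<and>
      k1 ** matrix_inv alpha ** k2 = mat (of_nat CARD('p) powi m) ** padic_mat (A ** diag_p ** B) \<and>
      KZ_act k1 (U_op r (KZ_act k2 P)) = Sym_act (?r (A ** diag_p ** B)) P"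
    if "k1 \<in> KZ" "k2 \<in> KZ" for k1 k2 :: "'p padic ^ 2 ^ 2"
  proof -
    obtain m A where A: "invertible A" "k1 = mat (of_nat CARD('p) powi m) ** padic_mat A" using KZ_decomp \<open>k1 \<in> KZ\<close> by blast
    obtain l B where B: "invertible B" "k2 = mat (of_nat CARD('p) powi l) ** padic_mat B" using KZ_decomp \<open>k2 \<in> KZ\<close> by blast
    have pw: "(of_nat CARD('p) :: 'p padic) powi m * (of_nat CARD('p) powi -1 * of_nat CARD('p) powi l) = of_nat CARD('p) powi (m - 1 + l)"
      using p_nonzero[where 'p = 'p] by (simp add: power_int_add power_int_diff field_simps)
    have "k1 ** matrix_inv alpha ** k2 = mat (of_nat CARD('p) powi m * (of_nat CARD('p) powi -1 * of_nat CARD('p) powi l)) ** padic_mat (A ** diag_p ** B)"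
      unfolding A(2) B(2) alpha_inv padic_mat_mult by (rule scalar_triple)
    moreover have "KZ_act k1 (U_op r (KZ_act k2 P)) = Sym_act (?r (A ** diag_p ** B)) P"
      unfolding A(2) B(2) KZ_act_eq[OF A(1)] KZ_act_eq[OF B(1)] U_op_eq[OF Sym_act_closed[OF P]]
      by (simp only: rm rD Sym_act_mult)
    ultimately show ?thesis using A(1) B(1) unfolding pw by blast
  qed
  define Q where "Q = (\<lambda>(k1, k2). k1 \<in> KZ \<and> k2 \<in> KZ \<and> \<kappa>1 ** matrix_inv alpha ** \<kappa>2 = k1 ** matrix_inv alpha ** k2)"
  obtain k1 k2 where s: "(SOME x. Q x) = (k1, k2)" by (cases "SOME x. Q x")
  have "Q (\<kappa>1, \<kappa>2)" using k by (simp add: Q_def)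
  then have "Q (k1, k2)" using someI[of Q] s by metis
  then have Q: "k1 \<in> KZ" "k2 \<in> KZ" "\<kappa>1 ** matrix_inv alpha ** \<kappa>2 = k1 ** matrix_inv alpha ** k2"
    by (auto simp: Q_def)
  have "KZ_act k1 (U_op r (KZ_act k2 P)) = KZ_act \<kappa>1 (U_op r (KZ_act \<kappa>2 P))"
    using key[OF Q(1,2)] key[OF k] Q(3) hecke_decomp_unique_aux by (metis linorder_le_cases)
  moreover have "\<kappa>1 ** matrix_inv alpha ** \<kappa>2 \<in> hecke_supp" using k by (auto simp: hecke_supp_def)
  ultimately show ?thesis using s unfolding hecke_phi_def Q_def by (simp add: case_prod_unfold Let_def)
qed

end

theory Submission
  imports Defs "HOL-Library.Function_Algebras"
begin

text \<open>
  The cosets \<open>KZ g\<close> are the vertices of the tree of \<open>GL\<^sub>2(\<rat>\<^sub>p)\<close>, and the compact induction is spanned by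
  functions supported on one vertex (atoms). The group \<open>T\<^sub>1(p\<^sup>n)\<close> fixes a path with \<open>2n + 1\<close> vertices, whose
  complement falls into \<open>2 + (2n - 1)(p - 1)\<close> branches. On every branch some \<open>\<gamma> \<in> T\<^sub>1(p\<^sup>n)\<close> (a unipotent
  element at the two ends, \<open>diag(1 + p, 1)\<close> elsewhere) acts, in a suitable coordinate, as an affine map
  \<open>x \<mapsto> a x - c\<close> with \<open>a \<equiv> 1\<close> and \<open>c\<close> prime to \<open>p\<close>. It permutes the vertices of each depth \<open>d\<close> transitively,
  and the stabilizer of a vertex acts on \<open>Sym\<^sup>r\<close> by a single Jordan block because \<open>r < p\<close>; so the
  \<open>\<gamma>\<close>-coinvariants of the functions of depth \<open>d\<close> on a branch are one-dimensional. The part of \<open>T\<close> that increases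
  the depth is zero on coinvariants, and the part that decreases it is surjective.

  Let \<open>S\<close> be \<open>\<gamma> - 1\<close> on each branch. Representatives of invariants lie in the preimage under \<open>S\<close> of
  \<open>D = (T - \<lambda>) I + E\<close>, where \<open>E\<close> consists of the functions supported on the path. On the finite space \<open>V\<close> of
  functions of depth at most \<open>k\<close>, the kernel and the cokernel of \<open>S\<close> modulo \<open>D\<close> have the same size, and by the
  above the cokernel is spanned by the classes of depth \<open>k\<close> and \<open>k - 1\<close>, two for each branch. This bounds the
  number of invariant classes independently of \<open>k\<close>, by \<open>q\<close> to a power linear in \<open>n\<close>.
\<close>

section \<open>Two-by-two matrices and the group KZ\<close>

text \<open>The element acting is chosen region by region, which keeps its action affine on every
  branch, at the price that \<open>S\<close> need not commute with \<open>T\<close>. The damage is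
  confined: \<open>T\<close> reaches only neighbours, and a neighbour lying in another region is on
  the path. This is why \<open>E\<close> is added: the enlarged space absorbs the error made by
  restricting an image of T - lambda to one region, and it costs at most (r + 1)(2n + 1) dimensions.
  Let A_d be the class of depth d on a branch. Since T A_(d+1) is A_d plus an outward part that
  vanishes, A_d = lambda A_(d+1) in the cokernel; and lambda A_0 = 0, because the vertex before
  depth 0 is on the path. For either kind of lambda this kills A_d. But the relation for A_d
  involves functions of depth d + 2, so within depth at most k it is available only for d <= k - 2,
  and two depths survive. Since the field is finite, dimensions are handled as cardinalities. The
  part of the image of T - lambda inside the finite space is not controlled, but it occurs on both
  sides of the estimate and cancels.\<close>

type_synonym 'p pmat = "'p padic ^ 2 ^ 2"

definition mat2 :: "'a::zero \<Rightarrow> 'a \<Rightarrow> 'a \<Rightarrow> 'a \<Rightarrow> 'a ^ 2 ^ 2" where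
  "mat2 a b c d = vector [vector [a, b], vector [c, d]]"

lemma mat2_nth [simp]:
  "mat2 a b c d $ 1 $ 1 = a" "mat2 a b c d $ 1 $ 2 = b" "mat2 a b c d $ 2 $ 1 = c" "mat2 a b c d $ 2 $ 2 = d"
  by (simp_all add: mat2_def)

lemma mat2_eta: "mat2 (A $ 1 $ 1) (A $ 1 $ 2) (A $ 2 $ 1) (A $ 2 $ 2) = A"
  by (simp add: vec_eq_iff forall_2)

lemma mat2_cases: obtains a b c d where "A = mat2 a b c d"
  by (metis mat2_eta)

lemma mat2_eq_iff [simp]: "mat2 a b c d = mat2 a' b' c' d' \<longleftrightarrow> a = a' \<and> b = b' \<and> c = c' \<and> d = d'"
  by (auto simp: vec_eq_iff forall_2)

lemma mat2_mult [simp]: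
  "mat2 a b c d ** mat2 a' b' c' d' = mat2 (a * a' + b * c') (a * b' + b * d') (c * a' + d * c') (c * b' + d * d')"
  by (simp add: vec_eq_iff forall_2 matrix_matrix_mult_def sum_2)

lemma mat_mat2: "mat x = mat2 x 0 0 x"
  by (simp add: vec_eq_iff forall_2 mat_def)

lemma det_mat2 [simp]: "det (mat2 a b c d) = a * d - b * c"
  by (simp add: det_2)

lemma map_matrix_mat2 [simp]: "map_matrix f (mat2 a b c d) = mat2 (f a) (f b) (f c) (f d)"
  by (simp add: vec_eq_iff forall_2)

lemma invertible_iff_det_unit: "invertible (A :: 'a::comm_ring_1 ^ 2 ^ 2) \<longleftrightarrow> det A dvd 1"
proof
  assume "det A dvd 1"
  then obtain e where e: "1 = det A * e" by (auto simp: dvd_def)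
  obtain a b c d where A: "A = mat2 a b c d" by (rule mat2_cases)
  let ?B = "mat2 (e * d) (- e * b) (- e * c) (e * a)"
  have "A ** ?B = mat 1" "?B ** A = mat 1"
    using e by (simp_all add: A mat_mat2 algebra_simps)
  then show "invertible A" unfolding invertible_def by blast
qed (rule det_unit)

lemma matrix_inv_right: "invertible (A :: 'a::field ^ 2 ^ 2) \<Longrightarrow> A ** matrix_inv A = mat 1"
  and matrix_inv_left: "invertible (A :: 'a::field ^ 2 ^ 2) \<Longrightarrow> matrix_inv A ** A = mat 1"
  unfolding matrix_inv_def invertible_def by (metis (mono_tags, lifting) someI_ex)+

lemma mat_inv_unique:
  fixes A :: "'a::field ^ 2 ^ 2"
  assumes "A ** B = mat 1"
  shows "matrix_inv A = B"
proof -
  have "B ** A = mat 1" using assms matrix_left_right_inverse by blast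
  then have "invertible A" using assms unfolding invertible_def by blast
  then have "A ** matrix_inv A = mat 1" by (rule matrix_inv_right)
  then have "B ** (A ** matrix_inv A) = B" by simp
  then show ?thesis using \<open>B ** A = mat 1\<close> by (simp add: matrix_mul_assoc)
qed

lemma carrier_GL2 [simp]: "carrier GL2 = {A. invertible A}"
  by (simp add: GL2_def)

lemma invertible_inv [simp]: "invertible (A :: 'a::field ^ 2 ^ 2) \<Longrightarrow> invertible (matrix_inv A)"
  using matrix_inv_left matrix_inv_right unfolding invertible_def by blast

lemma mul_inv_cancel_right [simp]:
  "invertible (A :: 'a::field ^ 2 ^ 2) \<Longrightarrow> B ** matrix_inv A ** A = B"
  "invertible (A :: 'a::field ^ 2 ^ 2) \<Longrightarrow> B ** A ** matrix_inv A = B"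
  by (simp_all add: matrix_mul_assoc[symmetric] matrix_inv_left matrix_inv_right)

lemma mul_inv_cancel_left [simp]:
  "invertible (A :: 'a::field ^ 2 ^ 2) \<Longrightarrow> matrix_inv A ** (A ** B) = B"
  "invertible (A :: 'a::field ^ 2 ^ 2) \<Longrightarrow> A ** (matrix_inv A ** B) = B"
  by (simp_all add: matrix_mul_assoc matrix_inv_left matrix_inv_right)

lemma matrix_inv_mult:
  assumes "invertible (A :: 'a::field ^ 2 ^ 2)" "invertible (B :: 'a ^ 2 ^ 2)"
  shows "matrix_inv (A ** B) = matrix_inv B ** matrix_inv A"
  by (rule mat_inv_unique) (use assms in \<open>simp add: matrix_mul_assoc matrix_inv_right\<close>)

lemma matrix_inv_inv: "invertible (A :: 'a::field ^ 2 ^ 2) \<Longrightarrow> matrix_inv (matrix_inv A) = A"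
  by (rule mat_inv_unique) (simp add: matrix_inv_left)

abbreviation pp :: "'p::prime_card padic" where "pp \<equiv> of_nat CARD('p)"

lemma pp_nonzero [simp]: "(pp :: 'p::prime_card padic) \<noteq> 0"
  by (rule p_nonzero)

lemma to_fract_numeral_simps [simp]:
  "to_fract (of_nat k :: 'a::idom) = of_nat k" "to_fract (of_int i :: 'a::idom) = of_int i"
  by (rule to_fract_of_nat) (cases i rule: int_cases2, simp_all add: to_fract_of_nat)

section \<open>Elements of KZ as scalar powers of p times integral matrices\<close>

lemma KZ_I:
  assumes "invertible (A :: 'p::prime_card padic_int ^ 2 ^ 2)"
  shows "mat (pp powi m) ** padic_mat A \<in> KZ"
proof -
  have "(mat (pp powi m) :: 'p pmat) \<in> Z2"
    unfolding Z2_def by (auto simp: scalar_comm) (simp add: invertible_iff_det_unit mat_mat2 dvd_field_iff)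
  then have "padic_mat A ** mat (pp powi m) \<in> KZ"
    using assms by (auto simp: KZ_def K2_def set_mult_def GL2_def)
  then show ?thesis by (simp only: scalar_comm)
qed

lemma KZ_iff: "g \<in> KZ \<longleftrightarrow> (\<exists>m A. invertible A \<and> g = mat (pp powi m) ** padic_mat A)"
  using KZ_I KZ_decomp by blast

lemma padic_mat_one: "padic_mat (mat 1) = mat 1"
  by (simp add: mat_mat2)

lemma KZ_scaled_mult:
  "(mat a ** padic_mat A) ** (mat b ** padic_mat B) = mat (a * b) ** padic_mat (A ** B)"
  for A :: "'p::prime_card padic_int ^ 2 ^ 2"
  by (cases A rule: mat2_cases, cases B rule: mat2_cases)
    (simp add: mat_mat2 padic_mat_mult[symmetric] algebra_simps)

lemma KZ_mult: "k \<in> KZ \<Longrightarrow> l \<in> KZ \<Longrightarrow> k ** l \<in> KZ"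
  for k l :: "'p::prime_card padic ^ 2 ^ 2"
proof -
  assume "k \<in> KZ" "l \<in> KZ"
  then obtain a b A B where "invertible A" "invertible B"
    "k = mat (pp powi a) ** padic_mat A" "l = mat (pp powi b) ** padic_mat B"
    unfolding KZ_iff by blast
  then have "k ** l = mat (pp powi (a + b)) ** padic_mat (A ** B)" "invertible (A ** B)"
    by (simp_all add: KZ_scaled_mult power_int_add invertible_mult)
  then show ?thesis unfolding KZ_iff by blast
qed

lemma KZ_one: "mat 1 \<in> KZ"
  using KZ_I[of "mat 1" 0] by (simp add: invertible_iff_det_unit padic_mat_one)

lemma KZ_inverse_ex:
  assumes "(k :: 'p::prime_card padic ^ 2 ^ 2) \<in> KZ"
  shows "\<exists>l\<in>KZ. k ** l = mat 1"
proof -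
  obtain a A where A: "invertible A" "k = mat (pp powi a) ** padic_mat A"
    using assms unfolding KZ_iff by blast
  then obtain B where B: "A ** B = mat 1" "B ** A = mat 1" unfolding invertible_def by blast
  then have "invertible B" unfolding invertible_def by blast
  then have "mat (pp powi (- a)) ** padic_mat B \<in> KZ" by (rule KZ_I)
  moreover have "k ** (mat (pp powi (- a)) ** padic_mat B) = mat 1"
    using power_int_add[of "pp :: 'p padic" a "-a"] by (simp add: A KZ_scaled_mult B padic_mat_one)
  ultimately show ?thesis by blast
qed

lemma KZ_invertible [simp]: "(k :: 'p::prime_card padic ^ 2 ^ 2) \<in> KZ \<Longrightarrow> invertible k"
  using KZ_inverse_ex matrix_left_right_inverse unfolding invertible_def by blast

lemma KZ_inv: "(k :: 'p::prime_card padic ^ 2 ^ 2) \<in> KZ \<Longrightarrow> matrix_inv k \<in> KZ"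
  using KZ_inverse_ex mat_inv_unique by metis

lemma KZ_mat2:
  fixes a b c d :: "'p::prime_card padic_int"
  assumes "(a * d - b * c) dvd 1"
  shows "mat2 (to_fract a) (to_fract b) (to_fract c) (to_fract d) \<in> KZ"
  using KZ_I[of "mat2 a b c d" 0] assms by (simp add: invertible_iff_det_unit)

lemma KZ_scalar_mat2:
  assumes "x = pp powi m" shows "mat2 x 0 0 (x :: 'p::prime_card padic) \<in> KZ"
  using KZ_I[of "mat 1" m] assms by (simp add: invertible_iff_det_unit padic_mat_one mat_mat2)

text \<open>Writing \<open>g\<close> as p^m A with \<open>A\<close> invertible over the p-adic
  integers, the determinant has valuation 2m, so a unit determinant forces m = 0. This is the test
  that keeps different neighbours of a vertex apart.\<close>

lemma KZ_det_one:
  fixes g :: "'p::prime_card padic ^ 2 ^ 2"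
  assumes "g \<in> KZ" "det g = to_fract u" "u dvd 1"
  shows "g $ i $ j \<in> range to_fract"
proof -
  obtain m A where A: "invertible A" "g = mat (pp powi m) ** padic_mat A"
    using assms KZ_iff by blast
  have d: "det A dvd 1" using A det_unit by blast
  have e: "to_fract u = pp powi m * pp powi m * to_fract (det A)"
  proof -
    have "det (padic_mat A) = to_fract (det A)" by (simp add: det_2)
    then show ?thesis using A assms by (simp add: det_mul mat_mat2)
  qed
  have "m = 0"
  proof (cases m rule: int_cases2)
    case (nonneg k)
    then have "to_fract u = to_fract (of_nat CARD('p) ^ k * of_nat CARD('p) ^ k * det A)"
      using e by (simp add: to_fract_power)
    then have "u = of_nat CARD('p) ^ k * of_nat CARD('p) ^ k * det A" by (simp only: to_fract_eq_iff)
    then have "of_nat CARD('p) ^ k dvd (1 :: 'p padic_int)" using assms(3)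
      by (metis dvd_mult_left)
    then have "k = 0" using p_not_unit[where 'p = 'p] by (metis dvd_power dvd_trans gr0I)
    then show ?thesis using nonneg by simp
  next
    case (nonpos k)
    then have "to_fract u * (pp ^ k * pp ^ k) = to_fract (det A)"
      using e by (simp add: power_int_minus field_simps)
    then have "to_fract (u * (of_nat CARD('p) ^ k * of_nat CARD('p) ^ k)) = to_fract (det A)"
      by (simp add: to_fract_power)
    then have "u * (of_nat CARD('p) ^ k * of_nat CARD('p) ^ k) = det A" by (simp only: to_fract_eq_iff)
    then have "of_nat CARD('p) ^ k dvd (1 :: 'p padic_int)" using d
      by (metis dvd_mult_right)
    then have "k = 0" using p_not_unit[where 'p = 'p] by (metis dvd_power dvd_trans gr0I)
    then show ?thesis using nonpos by simp
  qed
  then show ?thesis using A by simp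
qed

section \<open>Functions supported on one coset\<close>

lemma Sym_act_one: "Sym_act (mat 1) P = P"
proof -
  have "comm_ring_hom (\<lambda>P :: 'a poly poly. P)" by unfold_locales auto
  then show ?thesis
    by (rule poly_poly_hom_ext[of "Sym_act (mat 1)" "\<lambda>P. P", OF Sym_act_hom])
      (simp_all only: Sym_act_simps mat_mat2 mat2_nth lin_form_alt, simp_all add: pCons_one)
qed

type_synonym ('p, 'f) gl2_fun = "'p pmat \<Rightarrow> 'f poly poly"

locale gl2 =
  fixes ptype :: "'p::prime_card itself" and r :: nat and lam :: "'f::{field,finite}"
  assumes char: "CHAR('f) = CARD('p)" and r_le: "r \<le> CARD('p) - 1" and p_ge: "CARD('p) \<ge> 5"
begin

definition red :: "'p padic_int \<Rightarrow> 'f" where "red = padic_red"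

sublocale red: comm_ring_hom red
  unfolding red_def using char by (rule padic_red_hom)

lemma red_mult_mat: "map_matrix red (A ** B) = map_matrix red A ** map_matrix red B" for A B :: "'p padic_int ^ 2 ^ 2"
  by (simp add: vec_eq_iff matrix_matrix_mult_def sum_2 red.hom_add red.hom_mult)

abbreviation act :: "'p pmat \<Rightarrow> 'f poly poly \<Rightarrow> 'f poly poly" where
  "act \<equiv> KZ_act"

lemma act_eq: "invertible A \<Longrightarrow> act (mat (pp powi m) ** padic_mat A) = Sym_act (map_matrix red A)"
  by (simp add: KZ_act_eq red_def)

lemma act_mult:
  assumes "k \<in> KZ" "l \<in> KZ" shows "act (k ** l) P = act k (act l P)"
proof -
  obtain a b A B where AB: "invertible A" "invertible B"
    "k = mat (pp powi a) ** padic_mat A" "l = mat (pp powi b) ** padic_mat B"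
    using assms unfolding KZ_iff by blast
  then have "k ** l = mat (pp powi (a + b)) ** padic_mat (A ** B)" "invertible (A ** B)"
    by (simp_all add: KZ_scaled_mult power_int_add invertible_mult)
  then show ?thesis using AB by (simp add: act_eq red_mult_mat Sym_act_mult)
qed

lemma act_hom: "k \<in> KZ \<Longrightarrow> comm_ring_hom (act k)"
  using act_eq unfolding KZ_iff by (metis Sym_act_hom)

lemma act_Sym: "k \<in> KZ \<Longrightarrow> P \<in> Sym r \<Longrightarrow> act k P \<in> Sym r"
  using act_eq unfolding KZ_iff by (metis Sym_act_closed)

lemma act_const: "k \<in> KZ \<Longrightarrow> act k [:[:c:]:] = [:[:c:]:]"
  using act_eq unfolding KZ_iff by (metis Sym_act_simps(1))

lemma act_linear:
  assumes "k \<in> KZ"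
  shows "act k (P + Q) = act k P + act k Q" "act k 0 = 0" "act k (P - Q) = act k P - act k Q"
    "act k ([:[:c:]:] * P) = [:[:c:]:] * act k P"
proof -
  interpret comm_ring_hom "act k" using assms by (rule act_hom)
  show "act k (P + Q) = act k P + act k Q" "act k 0 = 0" "act k (P - Q) = act k P - act k Q"
    by (simp_all add: hom_distribs)
  show "act k ([:[:c:]:] * P) = [:[:c:]:] * act k P"
    by (simp only: hom_mult act_const[OF assms])
qed

lemma act_mat2:
  assumes "(a * d - b * c) dvd 1"
  shows "act (mat2 (to_fract a) (to_fract b) (to_fract c) (to_fract d)) = Sym_act (mat2 (red a) (red b) (red c) (red d))"
  using act_eq[of "mat2 a b c d" 0] assms by (simp add: invertible_iff_det_unit)

lemma act_scalar: "act (mat2 (pp powi m) 0 0 (pp powi m)) P = P"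
  using act_eq[of "mat 1" m] by (simp add: invertible_iff_det_unit mat_mat2) (metis Sym_act_one mat_mat2)

lemma act_one: "act (mat 1) P = P"
  using act_scalar[of 0] by (simp add: mat_mat2)

lemma Sym_zero: "0 \<in> Sym s"
  using Sym_sum[of "{}" undefined s] by simp

lemma Sym_add: "P \<in> Sym s \<Longrightarrow> Q \<in> Sym s \<Longrightarrow> P + Q \<in> Sym s" for P Q :: "'f poly poly"
  using Sym_sum[of UNIV "\<lambda>b. if b then P else Q" s] by (simp add: UNIV_bool add.commute)

lemma Sym_scale: "P \<in> Sym s \<Longrightarrow> [:[:c:]:] * P \<in> Sym s" for P :: "'f poly poly"
  using Sym_mult[OF Sym_monom[of 0 0 0 c]] by (simp add: monom_0)

lemma const_neg_one: "[:[:- 1:]:] * Q = - (Q :: 'f poly poly)"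
proof -
  have "[:[:- 1:]:] = (- 1 :: 'f poly poly)" by (simp add: one_pCons)
  then show ?thesis by (simp only: mult_minus1)
qed

lemma Sym_image:
  "Sym s \<subseteq> (\<lambda>c. \<Sum>i\<le>s. monom (monom (c i) (s - i)) i) ` PiE {..s} (\<lambda>_. UNIV :: 'f set)"
proof
  fix P :: "'f poly poly" assume "P \<in> Sym s"
  then obtain c where "P = (\<Sum>i\<le>s. monom (monom (c i) (s - i)) i)" by (auto simp: Sym_def)
  also have "\<dots> = (\<Sum>i\<le>s. monom (monom ((restrict c {..s}) i) (s - i)) i)" by simp
  finally show "P \<in> (\<lambda>c. \<Sum>i\<le>s. monom (monom (c i) (s - i)) i) ` PiE {..s} (\<lambda>_. UNIV :: 'f set)"
    by (rule image_eqI[where x = "restrict c {..s}"]) simp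
qed

lemma finite_Sym: "finite (Sym s :: 'f poly poly set)"
  and card_Sym: "card (Sym s :: 'f poly poly set) \<le> CARD('f) ^ Suc s"
proof -
  have fin: "finite (PiE {..s} (\<lambda>_. UNIV :: 'f set))" by (rule finite_PiE) simp_all
  show "finite (Sym s :: 'f poly poly set)" using fin Sym_image by (rule finite_surj)
  have "card (Sym s :: 'f poly poly set) \<le> card (PiE {..s} (\<lambda>_. UNIV :: 'f set))"
    using fin Sym_image by (rule surj_card_le)
  also have "\<dots> = CARD('f) ^ Suc s" by (subst card_PiE) simp_all
  finally show "card (Sym s :: 'f poly poly set) \<le> CARD('f) ^ Suc s" .
qed

section \<open>Vertices of the tree as cosets KZ g, and the compact induction on them\<close>

definition orb :: "'p pmat \<Rightarrow> ('p pmat) set" where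
  "orb g = {k ** g | k. k \<in> KZ}"

lemma orb_self [simp]: "g \<in> orb g"
  unfolding orb_def using KZ_one by (metis (mono_tags, lifting) matrix_mul_lid mem_Collect_eq)

lemma orb_I: "k \<in> KZ \<Longrightarrow> k ** g \<in> orb g"
  unfolding orb_def by blast

lemma orb_eq: "h \<in> orb g \<Longrightarrow> orb h = orb g"
proof -
  assume "h \<in> orb g"
  then obtain k where k: "k \<in> KZ" "h = k ** g" by (auto simp: orb_def)
  have 1: "l ** h = (l ** k) ** g" for l by (simp add: k matrix_mul_assoc)
  have 2: "l ** g = (l ** matrix_inv k) ** h" for l using k(1) by (simp add: k matrix_mul_assoc)
  show ?thesis
    using 1 2 k(1) KZ_mult KZ_inv unfolding orb_def by (smt (verit) Collect_cong)
qed

lemma orb_sym: "h \<in> orb g \<longleftrightarrow> g \<in> orb h"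
  using orb_eq orb_self by metis

lemma orb_iff: "invertible g \<Longrightarrow> h \<in> orb g \<longleftrightarrow> h ** matrix_inv g \<in> KZ"
  unfolding orb_def by (auto simp: matrix_inv_right) (metis mul_inv_cancel_right(1))

lemma orb_invertible: "h \<in> orb g \<Longrightarrow> invertible g \<Longrightarrow> invertible h"
  unfolding orb_def by (auto intro: invertible_mult)

lemma orb_mult_right: "h \<in> orb g \<Longrightarrow> h ** x \<in> orb (g ** x)"
  unfolding orb_def by (auto simp: matrix_mul_assoc)

lemma orb_mult_right_iff: "invertible x \<Longrightarrow> h ** x \<in> orb (g ** x) \<longleftrightarrow> h \<in> orb g"
  using orb_mult_right[of h g x] orb_mult_right[of "h ** x" "g ** x" "matrix_inv x"] by auto

lemma r_coset_orb: "KZ #>\<^bsub>GL2\<^esub> g = orb g"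
  by (auto simp: r_coset_def orb_def GL2_def)

definition ind_fns :: "('p, 'f) gl2_fun set" where
  "ind_fns = {f. (\<forall>g. \<not> invertible g \<longrightarrow> f g = 0) \<and> (\<forall>g. f g \<in> Sym r) \<and>
     (\<forall>k \<in> KZ. \<forall>g. f (k ** g) = act k (f g)) \<and> finite (orb ` {g. f g \<noteq> 0})}"

text \<open>Outside GL2 the functions vanish, so the conditions hold there for free and their
  quantifiers may range over all matrices.\<close>

lemma ind_fns_carrier: "carrier (cInd r) = ind_fns"
proof -
  have 1: "{KZ #>\<^bsub>GL2\<^esub> g |g. g \<in> carrier GL2 \<and> f g \<noteq> 0} = orb ` {g. f g \<noteq> 0}"
    if "\<forall>g. \<not> invertible g \<longrightarrow> f g = 0" for f :: "('p, 'f) gl2_fun"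
    using that by (auto simp: r_coset_orb)
  have 2: "(\<forall>k\<in>KZ. \<forall>g\<in>carrier GL2. f (k ** g) = act k (f g)) \<longleftrightarrow> (\<forall>k\<in>KZ. \<forall>g. f (k ** g) = act k (f g))"
    if f: "\<forall>g. \<not> invertible g \<longrightarrow> f g = 0" for f :: "('p, 'f) gl2_fun"
  proof (intro iffI ballI allI)
    fix k g :: "'p pmat" assume *: "\<forall>k\<in>KZ. \<forall>g\<in>carrier GL2. f (k ** g) = act k (f g)" "k \<in> KZ"
    show "f (k ** g) = act k (f g)"
    proof (cases "invertible g")
      case False
      then have "\<not> invertible (k ** g)" using *(2)
        by (metis KZ_inv KZ_invertible invertible_mult mul_inv_cancel_left(1))
      then show ?thesis using False f *(2) by (simp add: act_linear)
    qed (use * in auto)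
  qed auto
  have 3: "(\<forall>g\<in>carrier GL2. f g \<in> Sym r) \<longleftrightarrow> (\<forall>g. f g \<in> Sym r)"
    if f: "\<forall>g. \<not> invertible g \<longrightarrow> f g = 0" for f :: "('p, 'f) gl2_fun"
    using that Sym_zero by (metis carrier_GL2 mem_Collect_eq)
  show ?thesis
    unfolding cInd_def ind_fns_def partial_object.simps
    by (rule Collect_cong) (use 1 2 3 in auto)
qed

lemma ind_fns_D:
  assumes "f \<in> ind_fns"
  shows "\<not> invertible g \<Longrightarrow> f g = 0" "f g \<in> Sym r" "k \<in> KZ \<Longrightarrow> f (k ** g) = act k (f g)"
    "finite (orb ` {g. f g \<noteq> 0})"
  using assms by (auto simp: ind_fns_def)

lemma ind_fns_I:
  assumes "\<And>g. \<not> invertible g \<Longrightarrow> f g = 0" "\<And>g. f g \<in> Sym r" "\<And>k g. k \<in> KZ \<Longrightarrow> f (k ** g) = act k (f g)"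
    "finite (orb ` {g. f g \<noteq> 0})"
  shows "f \<in> ind_fns"
  using assms by (simp add: ind_fns_def)

lemma ind_fns_zero: "0 \<in> ind_fns"
  by (rule ind_fns_I) (simp_all add: Sym_zero act_linear)

lemma ind_fns_add: assumes "f \<in> ind_fns" "g \<in> ind_fns" shows "f + g \<in> ind_fns"
proof -
  have "{x. (f + g) x \<noteq> 0} \<subseteq> {x. f x \<noteq> 0} \<union> {x. g x \<noteq> 0}" by auto
  then have "orb ` {x. (f + g) x \<noteq> 0} \<subseteq> orb ` {x. f x \<noteq> 0} \<union> orb ` {x. g x \<noteq> 0}" by blast
  then have "finite (orb ` {x. (f + g) x \<noteq> 0})"
    by (rule finite_subset) (simp add: ind_fns_D(4)[OF assms(1)] ind_fns_D(4)[OF assms(2)])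
  then show ?thesis by (intro ind_fns_I) (simp_all add: ind_fns_D[OF assms(1)] ind_fns_D[OF assms(2)] act_linear Sym_add)
qed

definition scale :: "'f \<Rightarrow> ('x \<Rightarrow> 'f poly poly) \<Rightarrow> 'x \<Rightarrow> 'f poly poly" where
  "scale c f = (\<lambda>x. [:[:c:]:] * f x)"

lemma scale_simps: "scale c (f + g) = scale c f + scale c g" "scale c (scale d f) = scale (c * d) f" "scale 1 f = f" "scale 0 f = 0"
  "scale (c + d) f = scale c f + scale d f" "scale c 0 = 0" "scale c (f - g) = scale c f - scale c g" "scale (-1) f = - f"
proof -
  have "[:[:c + d:]:] = [:[:c:]:] + [:[:d:]:]" "[:[:c * d:]:] = [:[:c:]:] * [:[:d:]:]" by simp_all
  then show "scale (c + d) f = scale c f + scale d f" "scale c (scale d f) = scale (c * d) f"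
    unfolding scale_def fun_eq_iff plus_fun_apply by (simp_all only: distrib_right mult.assoc simp_thms)
  show "scale (-1) f = - f" unfolding scale_def fun_eq_iff uminus_apply const_neg_one by blast
qed (simp_all only: scale_def fun_eq_iff plus_fun_apply minus_apply distrib_left right_diff_distrib, simp_all add: pCons_one)

lemma ind_fns_scale: assumes "f \<in> ind_fns" shows "scale c f \<in> ind_fns"
proof -
  have "{x. scale c f x \<noteq> 0} \<subseteq> {x. f x \<noteq> 0}" by (auto simp: scale_def)
  then have "orb ` {x. scale c f x \<noteq> 0} \<subseteq> orb ` {x. f x \<noteq> 0}" by (rule image_mono)
  then have "finite (orb ` {x. scale c f x \<noteq> 0})" by (rule finite_subset) (rule ind_fns_D(4)[OF assms])
  then show ?thesis
    by (intro ind_fns_I) (simp_all add: scale_def ind_fns_D[OF assms] act_linear Sym_scale del: mult_pCons_left)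
qed

lemma ind_fns_uminus: "f \<in> ind_fns \<Longrightarrow> - f \<in> ind_fns"
  using ind_fns_scale[of f "-1"] by (simp add: scale_simps)

lemma ind_fns_diff: "f \<in> ind_fns \<Longrightarrow> g \<in> ind_fns \<Longrightarrow> f - g \<in> ind_fns"
  using ind_fns_add[of f "-g"] ind_fns_uminus by simp

definition atom :: "'p pmat \<Rightarrow> 'f poly poly \<Rightarrow> 'p pmat \<Rightarrow> 'f poly poly" where
  "atom g w = (\<lambda>x. if x \<in> orb g then act (x ** matrix_inv g) w else 0)"

lemma atom_apply: "k \<in> KZ \<Longrightarrow> invertible g \<Longrightarrow> atom g w (k ** g) = act k w"
  by (simp add: atom_def orb_I)

lemma atom_outside: "x \<notin> orb g \<Longrightarrow> atom g w x = 0"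
  by (simp add: atom_def)

text \<open>A vertex has many representatives; passing from \<open>g\<close> to
  \<open>k ** g\<close> is compensated by applying \<open>k\<close> to the value.\<close>

lemma atom_eqI:
  assumes "invertible g" "k \<in> KZ" "h = k ** g" "v = act k w"
  shows "atom h v = atom g w"
proof (rule ext)
  fix x
  have h: "orb h = orb g" using assms orb_I orb_eq by blast
  show "atom h v x = atom g w x"
  proof (cases "x \<in> orb g")
    case True
    then obtain l where l: "l \<in> KZ" "x = l ** h" using h by (auto simp: orb_def)
    then have "atom h v x = act l v" using assms by (simp add: atom_apply invertible_mult)
    moreover have "x = (l ** k) ** g" by (simp add: l assms matrix_mul_assoc)
    then have "atom g w x = act (l ** k) w" using assms l KZ_mult atom_apply by blast
    ultimately show ?thesis using l assms act_mult by simp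
  qed (simp add: atom_outside h)
qed

lemma atom_linear:
  assumes "invertible g"
  shows "atom g (v + w) = atom g v + atom g w" "atom g 0 = 0" "atom g (v - w) = atom g v - atom g w"
    "atom g ([:[:c:]:] * w) = scale c (atom g w)"
  using assms by (auto simp: atom_def fun_eq_iff scale_def orb_iff act_linear simp del: mult_pCons_left)

lemma atom_ind_fns: assumes "invertible g" "w \<in> Sym r" shows "atom g w \<in> ind_fns"
proof -
  have "orb ` {x. atom g w x \<noteq> 0} \<subseteq> {orb g}"
    using orb_eq by (auto simp: atom_def)
  then have "finite (orb ` {x. atom g w x \<noteq> 0})" using finite_subset by blast
  moreover have "atom g w (k ** x) = act k (atom g w x)" if "k \<in> KZ" for k x
  proof (cases "x \<in> orb g")
    case True
    then obtain l where l: "l \<in> KZ" "x = l ** g" by (auto simp: orb_def)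
    have "k ** x = (k ** l) ** g" by (simp add: l matrix_mul_assoc)
    then have "atom g w (k ** x) = act (k ** l) w" using that l assms KZ_mult atom_apply by metis
    then show ?thesis using l that assms by (simp add: atom_apply act_mult)
  next
    case False
    then have "k ** x \<notin> orb g" using that orb_I orb_eq orb_self by metis
    then show ?thesis using False that by (simp add: atom_outside act_linear)
  qed
  moreover have "atom g w x \<in> Sym r" for x
    using assms by (auto simp: atom_def Sym_zero orb_iff act_Sym)
  moreover have "atom g w x = 0" if "\<not> invertible x" for x
    using that assms orb_invertible by (auto simp: atom_def)
  ultimately show ?thesis by (auto simp: ind_fns_def)
qed

text \<open>Induction on the number of vertices in the support: subtracting the atom with value
  \<open>f g\<close> at \<open>g\<close> clears one vertex and touches no other. The set
  \<open>\<Omega>\<close> keeps track of where the atoms used may lie.\<close>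

lemma ind_fns_induct:
  assumes "f \<in> ind_fns" and "\<And>x. f x \<noteq> 0 \<Longrightarrow> x \<in> \<Omega>" and "Q 0"
    and "\<And>f g w. Q f \<Longrightarrow> f \<in> ind_fns \<Longrightarrow> invertible g \<Longrightarrow> g \<in> \<Omega> \<Longrightarrow> w \<in> Sym r \<Longrightarrow> Q (f + atom g w)"
  shows "Q f"
  using assms(1,2)
proof (induction "card (orb ` {g. f g \<noteq> 0})" arbitrary: f rule: less_induct)
  case less
  show ?case
  proof (cases "f = 0")
    case False
    then obtain g where g: "f g \<noteq> 0" by (auto simp: fun_eq_iff)
    then have inv: "invertible g" using ind_fns_D(1) less.prems(1) by blast
    let ?a = "atom g (f g)"
    have fg: "f g \<in> Sym r" using ind_fns_D(2) less.prems by blast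
    have d: "f - ?a \<in> ind_fns" using less.prems(1) fg inv by (intro ind_fns_diff atom_ind_fns)
    have eq: "f x = ?a x" if x: "x \<in> orb g" for x
    proof -
      obtain k where k: "k \<in> KZ" "x = k ** g" using x by (auto simp: orb_def)
      then show ?thesis using inv ind_fns_D(3)[OF less.prems(1)] by (simp add: atom_apply)
    qed
    have s: "x \<notin> orb g \<and> f x \<noteq> 0" if "(f - ?a) x \<noteq> 0" for x
      using that eq[of x] atom_outside[of x g] by (cases "x \<in> orb g") auto
    have "orb ` {x. (f - ?a) x \<noteq> 0} \<subset> orb ` {x. f x \<noteq> 0}"
    proof -
      have "orb g \<notin> orb ` {x. (f - ?a) x \<noteq> 0}" using s orb_self by blast
      moreover have "orb g \<in> orb ` {x. f x \<noteq> 0}" using g by blast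
      ultimately show ?thesis using s by blast
    qed
    then have "card (orb ` {x. (f - ?a) x \<noteq> 0}) < card (orb ` {x. f x \<noteq> 0})"
      by (rule psubset_card_mono[OF ind_fns_D(4)[OF less.prems(1)]])
    then have "Q (f - ?a)" by (rule less.hyps) (use d s less.prems(2) in blast)+
    then have "Q ((f - ?a) + ?a)" using d inv less.prems(2)[OF g] fg by (rule assms(4))
    then show ?thesis by simp
  qed (use assms in simp)
qed

end

section \<open>The Hecke operator on the tree\<close>

context gl2
begin

section \<open>The p + 1 neighbours of a vertex\<close>

definition parent_mat :: "'p pmat" where "parent_mat = mat2 pp 0 0 1"

text \<open>The names refer to coordinates \<open>mat2 1 x 0 (pp ^ d)\<close>: left multiplication
  by \<open>child_mat i\<close> leads to depth \<open>Suc d\<close> and changes \<open>x\<close> by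
  a multiple of p^d, while \<open>parent_mat\<close> leads, up to a scalar, from a positive depth
  back to the previous one.\<close>

definition child_mat :: "nat \<Rightarrow> 'p pmat" where "child_mat i = mat2 1 (- of_nat i) 0 pp"

lemma unit_if_not_p_dvd: "\<not> of_nat CARD('p) dvd x \<Longrightarrow> (x :: 'p padic_int) dvd 1"
  using padic_unit padic_p_dvd by (metis dvd_triv_left)

lemma odd_prime: "prime CARD('p)" "odd CARD('p)"
  using prime_card[where 'a = 'p] p_ge prime_odd_nat by force+

lemma padic_dvd_digit:
  fixes x y :: "'p padic_int"
  assumes "y dvd 1"
  shows "\<exists>i<CARD('p). of_nat CARD('p) dvd of_nat i * y + x"
proof -
  let ?p = "of_nat CARD('p) :: 'p padic_int"
  obtain z where z: "y * z = 1" using assms by (auto simp: dvd_def)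
  \<comment> \<open>The digit is the residue of -x/y modulo \<open>p\<close>, with \<open>z\<close>
    the inverse of \<open>y\<close>.\<close>
  define i where "i = nat (Rep_padic_int (- x * z) 1)"
  have p0: "int CARD('p) > 0" by simp
  have R: "Rep_padic_int (- x * z) 1 = Rep_padic_int (- x * z) 1 mod int CARD('p)"
    by (metis Rep_padic_int_mod_self power_one_right)
  have "0 \<le> Rep_padic_int (- x * z) 1" using R p0 pos_mod_sign by metis
  then have i: "int i = Rep_padic_int (- x * z) 1" by (simp add: i_def)
  have "i < CARD('p)" using R p0 i by (metis of_nat_less_iff pos_mod_bound)
  moreover have "Rep_padic_int (of_nat i + x * z) 1 = 0"
  proof -
    have "Rep_padic_int (of_nat i + x * z) 1 = (int i mod int CARD('p) + Rep_padic_int (x * z) 1) mod int CARD('p)"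
      by (simp add: plus_padic_int.rep_eq Rep_of_nat)
    also have "\<dots> = (Rep_padic_int (- x * z) 1 + Rep_padic_int (x * z) 1) mod int CARD('p) ^ 1"
      by (simp add: i mod_simps)
    also have "\<dots> = Rep_padic_int (- x * z + x * z) 1" by (simp only: plus_padic_int.rep_eq)
    also have "\<dots> = 0" by (simp add: zero_padic_int.rep_eq)
    finally show ?thesis .
  qed
  then obtain t where "of_nat i + x * z = ?p * t" using padic_p_dvd by blast
  then have "?p dvd of_nat i + x * z" by simp
  then have "?p dvd (of_nat i + x * z) * y" by simp
  moreover have "(of_nat i + x * z) * y = of_nat i * y + x * (y * z)" by (simp add: algebra_simps)
  ultimately show ?thesis using z by (metis mult.right_neutral)
qed

lemma alpha_inv_mat2: "matrix_inv (alpha :: 'p pmat) = mat2 1 0 0 (1 / pp)"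
  by (rule mat_inv_unique) (simp add: alpha_def mat_mat2 flip: mat2_def)

lemma scalar_KZ [simp]: "mat2 pp 0 0 pp \<in> (KZ :: ('p pmat) set)"
  using KZ_scalar_mat2[of pp 1] by simp

lemma swap_KZ [simp]: "mat2 0 1 1 0 \<in> (KZ :: ('p pmat) set)"
  using KZ_mat2[of 0 0 1 1] by simp

lemma unip_KZ [simp]: "mat2 1 (to_fract x) 0 1 \<in> (KZ :: ('p pmat) set)"
  using KZ_mat2[of 1 1 x 0] by simp

lemma unip_nat_KZ [simp]: "mat2 1 (- of_nat i) 0 1 \<in> (KZ :: ('p pmat) set)"
  using unip_KZ[of "- of_nat i"] by simp

lemma child_mat_decomp: "child_mat i = (mat2 pp 0 0 pp ** mat2 0 1 1 0) ** matrix_inv alpha ** (mat2 0 1 1 0 ** mat2 1 (- of_nat i) 0 1)"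
  by (simp add: child_mat_def alpha_inv_mat2)

lemma parent_mat_decomp: "parent_mat = mat2 pp 0 0 pp ** matrix_inv alpha ** mat 1"
  by (simp add: parent_mat_def alpha_inv_mat2 mat_mat2)

lemma hecke_supp_I: "k \<in> KZ \<Longrightarrow> l \<in> KZ \<Longrightarrow> k ** matrix_inv alpha ** l \<in> hecke_supp"
  for k l :: "'p pmat"
  unfolding hecke_supp_def by blast

lemma hecke_supp_mult: "g \<in> hecke_supp \<Longrightarrow> k \<in> KZ \<Longrightarrow> k ** g \<in> hecke_supp"
  "g \<in> hecke_supp \<Longrightarrow> k \<in> KZ \<Longrightarrow> g ** k \<in> hecke_supp"
  for g k :: "'p pmat"
proof -
  assume "g \<in> hecke_supp" "k \<in> KZ"
  then obtain a b where ab: "a \<in> KZ" "b \<in> KZ" "g = a ** matrix_inv alpha ** b" "k \<in> KZ"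
    by (auto simp: hecke_supp_def)
  have "k ** g = (k ** a) ** matrix_inv alpha ** b" "g ** k = a ** matrix_inv alpha ** (b ** k)"
    by (simp_all add: ab matrix_mul_assoc)
  then show "k ** g \<in> hecke_supp" "g ** k \<in> hecke_supp" using ab KZ_mult hecke_supp_I by metis+
qed

lemma parent_mat_supp: "parent_mat \<in> hecke_supp"
  unfolding parent_mat_decomp by (intro hecke_supp_I KZ_one) simp

lemma child_mat_supp: "child_mat i \<in> hecke_supp"
  unfolding child_mat_decomp by (intro hecke_supp_I KZ_mult) simp_all

lemma parent_mat_inv [simp]: "invertible parent_mat" and child_mat_inv [simp]: "invertible (child_mat i)"
  by (simp_all add: invertible_iff_det_unit parent_mat_def child_mat_def dvd_field_iff)

lemma alpha_invertible [simp]: "invertible (alpha :: 'p pmat)"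
  by (simp add: invertible_iff_det_unit alpha_def dvd_field_iff flip: mat2_def)

lemma supp_invertible [simp]: "g \<in> hecke_supp \<Longrightarrow> invertible (g :: 'p pmat)"
  by (auto simp: hecke_supp_def intro!: invertible_mult)

text \<open>Up to left factors from KZ only the bottom row (c, d) of the integral matrix
  \<open>A\<close> matters, as a point of the projective line over the residue field: c = 0 gives
  the parent, and otherwise -d/c is the label of the child.\<close>

lemma supp_orbs:
  assumes "h \<in> hecke_supp"
  shows "h \<in> orb parent_mat \<or> (\<exists>i<CARD('p). h \<in> orb (child_mat i))"
proof -
  obtain k l where kl: "k \<in> KZ" "l \<in> KZ" "h = k ** matrix_inv alpha ** l"
    using assms by (auto simp: hecke_supp_def)
  obtain m A where A: "invertible A" "l = mat (pp powi m) ** padic_mat A"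
    using kl(2) KZ_iff by blast
  obtain a b c d where abcd: "A = mat2 a b c d" by (rule mat2_cases)
  let ?p = "of_nat CARD('p) :: 'p padic_int"
  have det: "(a * d - b * c) dvd 1" using A abcd by (simp add: invertible_iff_det_unit)
  then obtain e where e: "(a * d - b * c) * e = 1" by (auto simp: dvd_def)
  have h: "h = (k ** mat2 (pp powi (m - 1)) 0 0 (pp powi (m - 1))) ** (parent_mat ** padic_mat A)"
    unfolding kl A(2) alpha_inv_mat2 abcd parent_mat_def
    by (simp add: mat_mat2 matrix_mul_assoc[symmetric] power_int_diff)
  have kk: "k ** mat2 (pp powi (m - 1)) 0 0 (pp powi (m - 1)) \<in> KZ"
    using kl by (intro KZ_mult KZ_scalar_mat2) auto
  have red: "h \<in> orb g" if "parent_mat ** padic_mat A = q ** g" "q \<in> KZ" for q g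
    unfolding h that(1) matrix_mul_assoc by (intro orb_I KZ_mult kk that)
  show ?thesis
  proof (cases "Rep_padic_int c 1 = 0")
    case True
    then obtain c' where c: "c = ?p * c'" using padic_p_dvd by blast
    let ?q = "mat2 (to_fract a) (to_fract (?p * b)) (to_fract c') (to_fract d)"
    have "parent_mat ** padic_mat A = ?q ** parent_mat" by (simp add: abcd parent_mat_def c algebra_simps)
    moreover have "?q \<in> KZ" by (rule KZ_mat2) (use det in \<open>simp add: c algebra_simps\<close>)
    ultimately show ?thesis using red by blast
  next
    case False
    then have "c dvd 1" by (rule padic_unit)
    then obtain i where i: "i < CARD('p)" "?p dvd of_nat i * c + d" using padic_dvd_digit by blast
    then obtain y where y: "of_nat i * c + d = ?p * y" by blast
    then have d: "d = ?p * y - of_nat i * c" by (metis add_diff_cancel_left')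
    let ?q = "mat2 (to_fract (?p * a)) (to_fract (of_nat i * a + b)) (to_fract c) (to_fract y)"
    have "parent_mat ** padic_mat A = ?q ** child_mat i" by (simp add: abcd parent_mat_def child_mat_def d algebra_simps)
    moreover have "?q \<in> KZ" by (rule KZ_mat2) (use det in \<open>simp add: d algebra_simps\<close>)
    ultimately show ?thesis using red i by blast
  qed
qed

lemma orb_det1:
  assumes "g \<in> orb h" "invertible h" "g = q ** h" "det q = 1"
  shows "q $ i $ j \<in> range (to_fract :: 'p padic_int \<Rightarrow> _)"
proof -
  have "q \<in> KZ" using assms orb_iff by auto
  then show ?thesis using KZ_det_one[of q 1] assms by simp
qed

lemma inv_p_not_integral: "x / pp \<notin> range (to_fract :: 'p padic_int \<Rightarrow> _)"
  if "x = to_fract y" "\<not> of_nat CARD('p) dvd (y :: 'p padic_int)" for x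
proof
  assume "x / pp \<in> range (to_fract :: 'p padic_int \<Rightarrow> _)"
  then obtain z :: "'p padic_int" where "x / pp = to_fract z" by blast
  then have "to_fract y = to_fract (of_nat CARD('p) * z)" using that by (simp add: field_simps)
  then have "y = of_nat CARD('p) * z" by (simp only: to_fract_eq_iff)
  then show False using that by simp
qed

text \<open>The quotient of the two representatives has determinant 1, so it would be integral if
  they lay in one orbit; but it contains the entry 1/p.\<close>

lemma orb_disjoint1: "parent_mat \<notin> orb (child_mat i)"
proof
  assume "parent_mat \<in> orb (child_mat i)"
  then have "mat2 pp (of_nat i) 0 (1 / pp) $ 2 $ 2 \<in> range (to_fract :: 'p padic_int \<Rightarrow> _)"
    by (rule orb_det1) (simp, simp add: parent_mat_def child_mat_def, simp)
  then show False using inv_p_not_integral[of 1 1] p_not_unit by auto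
qed

lemma p_dvd_of_int: "of_nat CARD('p) dvd (of_int i :: 'p padic_int) \<longleftrightarrow> int CARD('p) dvd i"
proof
  have Ri: "Rep_padic_int (of_int i :: 'p padic_int) (Suc 0) = i mod int CARD('p)" for i
  proof (cases i rule: int_cases2)
    case (nonpos k)
    have "Rep_padic_int (- of_nat k :: 'p padic_int) (Suc 0) = (- int k) mod int CARD('p)"
      by (simp add: uminus_padic_int.rep_eq Rep_of_nat mod_simps)
    then show ?thesis using nonpos by simp
  qed (simp add: Rep_of_nat)
  assume "of_nat CARD('p) dvd (of_int i :: 'p padic_int)"
  then obtain y where "(of_int i :: 'p padic_int) = of_nat CARD('p) * y" by blast
  then have "Rep_padic_int (of_int i :: 'p padic_int) (Suc 0) = Rep_padic_int (of_nat CARD('p) * y) (Suc 0)" by simp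
  also have "\<dots> = 0" by (simp add: times_padic_int.rep_eq Rep_of_nat)
  finally show "int CARD('p) dvd i" by (simp add: Ri dvd_eq_mod_eq_0)
next
  assume "int CARD('p) dvd i"
  then obtain j where "i = int CARD('p) * j" by blast
  then show "of_nat CARD('p) dvd (of_int i :: 'p padic_int)" by simp
qed

lemma orb_disjoint2: "i < CARD('p) \<Longrightarrow> j < CARD('p) \<Longrightarrow> child_mat i \<in> orb (child_mat j) \<Longrightarrow> i = j"
proof (rule ccontr)
  assume a: "i < CARD('p)" "j < CARD('p)" "child_mat i \<in> orb (child_mat j)" "i \<noteq> j"
  let ?d = "int j - int i"
  have "mat2 1 (of_int ?d / pp) 0 1 $ 1 $ 2 \<in> range (to_fract :: 'p padic_int \<Rightarrow> _)"
    using a(3) by (rule orb_det1) (simp, simp add: child_mat_def field_simps, simp)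
  then have "of_nat CARD('p) dvd (of_int ?d :: 'p padic_int)"
    using inv_p_not_integral[of "of_int ?d" "of_int ?d"] by auto
  then have "int CARD('p) dvd ?d" by (simp only: p_dvd_of_int)
  moreover have "\<bar>?d\<bar> < int CARD('p)" using a by simp
  ultimately have "?d = 0" using dvd_imp_le_int by (metis abs_of_nat not_le)
  then show False using a by simp
qed

section \<open>The cosets in the convolution sum\<close>

lemma l_coset: "(y :: 'p pmat) <#\<^bsub>GL2\<^esub> KZ = {y ** k | k. k \<in> KZ}"
  by (auto simp: l_coset_def GL2_def)

lemma l_coset_self: "(y :: 'p pmat) \<in> y <#\<^bsub>GL2\<^esub> KZ"
proof -
  have "y = y ** mat 1" by simp
  then show ?thesis unfolding l_coset using KZ_one by blast
qed

lemma alpha_mat2: "alpha = mat2 1 0 0 pp"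
  by (simp add: alpha_def mat2_def)

lemma alpha_conj: "(alpha :: 'p pmat) = mat2 pp 0 0 pp ** mat2 0 1 1 0 ** matrix_inv alpha ** mat2 0 1 1 0"
  by (simp add: alpha_inv_mat2) (simp add: alpha_mat2)

text \<open>The swap lies in KZ and exchanges the diagonal entries, so \<open>alpha\<close> belongs,
  up to a scalar, to the double coset of its own inverse.\<close>

lemma supp_inverse: "y \<in> hecke_supp \<Longrightarrow> matrix_inv y \<in> hecke_supp" for y :: "'p pmat"
proof -
  assume "y \<in> hecke_supp"
  then obtain a b where ab: "a \<in> KZ" "b \<in> KZ" "y = a ** matrix_inv alpha ** b" by (auto simp: hecke_supp_def)
  have "matrix_inv y = matrix_inv b ** alpha ** matrix_inv a"
    using ab by (simp add: matrix_inv_mult invertible_mult matrix_inv_inv matrix_mul_assoc)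
  also have "\<dots> = (matrix_inv b ** (mat2 pp 0 0 pp ** mat2 0 1 1 0)) ** matrix_inv alpha ** (mat2 0 1 1 0 ** matrix_inv a)"
    by (subst alpha_conj) (simp only: matrix_mul_assoc)
  also have "\<dots> \<in> hecke_supp" using ab by (intro hecke_supp_I KZ_mult KZ_inv) simp_all
  finally show ?thesis .
qed

definition lcosets :: "('p pmat) set set" where
  "lcosets = {y <#\<^bsub>GL2\<^esub> KZ | y. y \<in> hecke_supp}"

lemma l_coset_eq:
  assumes "(y' :: 'p pmat) \<in> y <#\<^bsub>GL2\<^esub> KZ" shows "y' <#\<^bsub>GL2\<^esub> KZ = y <#\<^bsub>GL2\<^esub> KZ"
proof -
  obtain k where k: "k \<in> KZ" "y' = y ** k" using assms by (auto simp: l_coset)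
  have 1: "y' ** l = y ** (k ** l)" for l by (simp add: k matrix_mul_assoc)
  have 2: "y ** l = y' ** (matrix_inv k ** l)" for l :: "'p pmat"
    using k by (simp add: matrix_mul_assoc[symmetric])
  show ?thesis unfolding l_coset using 1 2 k KZ_mult KZ_inv by (smt (verit) Collect_cong)
qed

text \<open>Inversion carries the cosets y KZ to cosets KZ y^-1, of which \<open>supp_orbs\<close>
  leaves at most p + 1. Finiteness is essential, since \<open>sum\<close> over an infinite set is 0
  by convention.\<close>

lemma lcosets_finite: "finite lcosets"
proof -
  let ?R = "insert parent_mat (child_mat ` {..<CARD('p)})"
  have "lcosets \<subseteq> (\<lambda>g. matrix_inv g <#\<^bsub>GL2\<^esub> KZ) ` ?R"
  proof
    fix C assume "C \<in> lcosets"
    then obtain y where y: "y \<in> hecke_supp" "C = y <#\<^bsub>GL2\<^esub> KZ" by (auto simp: lcosets_def)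
    then obtain g where g: "g \<in> ?R" "matrix_inv y \<in> orb g" using supp_orbs supp_inverse by blast
    then obtain k where k: "k \<in> KZ" "matrix_inv y = k ** g" by (auto simp: orb_def)
    have gi: "invertible g" using g by auto
    have "y = matrix_inv (k ** g)" using k y matrix_inv_inv supp_invertible by metis
    then have "y = matrix_inv g ** matrix_inv k" using gi k by (simp add: matrix_inv_mult)
    then have "y \<in> matrix_inv g <#\<^bsub>GL2\<^esub> KZ" using k KZ_inv by (auto simp: l_coset)
    then show "C \<in> (\<lambda>g. matrix_inv g <#\<^bsub>GL2\<^esub> KZ) ` ?R" using l_coset_eq y g by blast
  qed
  then show ?thesis by (rule finite_subset) simp
qed

lemma hecke_phi_KZ:
  fixes y k :: "'p pmat" and w :: "'f poly poly"
  assumes "y \<in> hecke_supp" "k \<in> KZ" "w \<in> Sym r"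
  shows "hecke_phi r (y ** k) w = hecke_phi r y (act k w)" "hecke_phi r (k ** y) w = act k (hecke_phi r y w)"
proof -
  obtain a b where ab: "a \<in> KZ" "b \<in> KZ" "y = a ** matrix_inv alpha ** b" using assms by (auto simp: hecke_supp_def)
  have 1: "y ** k = a ** matrix_inv alpha ** (b ** k)" "k ** y = (k ** a) ** matrix_inv alpha ** b"
    by (simp_all add: ab matrix_mul_assoc)
  show "hecke_phi r (y ** k) w = hecke_phi r y (act k w)"
    unfolding 1 using ab assms by (simp add: hecke_phi_eq[OF char] KZ_mult act_mult act_Sym)
  show "hecke_phi r (k ** y) w = act k (hecke_phi r y w)"
    unfolding 1 using ab assms by (simp add: hecke_phi_eq[OF char] KZ_mult act_mult)
qed

lemma U_op_linear: "U_op r (P + Q) = U_op r P + U_op r Q" "U_op r 0 = 0" "U_op r ([:[:c:]:] * P) = [:[:c:]:] * U_op r P"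
  for P Q :: "'f poly poly"
  by (simp_all add: U_op_def add_monom smult_monom)

lemma hecke_phi_linear:
  fixes y :: "'p pmat" and v w :: "'f poly poly"
  assumes "v \<in> Sym r" "w \<in> Sym r"
  shows "hecke_phi r y (v + w) = hecke_phi r y v + hecke_phi r y w" "hecke_phi r y (0 :: 'f poly poly) = 0"
    "hecke_phi r y ([:[:c:]:] * w) = [:[:c:]:] * hecke_phi r y w"
proof -
  have "hecke_phi r y (v + w) = hecke_phi r y v + hecke_phi r y w \<and> hecke_phi r y (0 :: 'f poly poly) = 0 \<and>
    hecke_phi r y ([:[:c:]:] * w) = [:[:c:]:] * hecke_phi r y w"
  proof (cases "y \<in> hecke_supp")
    case True
    then obtain a b where ab: "a \<in> KZ" "b \<in> KZ" "y = a ** matrix_inv alpha ** b" by (auto simp: hecke_supp_def)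
    show ?thesis unfolding ab(3) using ab assms
      by (simp add: hecke_phi_eq[OF char] Sym_add Sym_scale Sym_zero act_linear U_op_linear del: mult_pCons_left)
  qed (simp add: hecke_phi_def)
  then show "hecke_phi r y (v + w) = hecke_phi r y v + hecke_phi r y w" "hecke_phi r y (0 :: 'f poly poly) = 0"
    "hecke_phi r y ([:[:c:]:] * w) = [:[:c:]:] * hecke_phi r y w" by auto
qed

lemma U_op_mat2: "P \<in> Sym r \<Longrightarrow> U_op r P = Sym_act (mat2 0 0 0 1) P" for P :: "'f poly poly"
  by (simp add: U_op_eq mat2_def)

lemma act_p: "act (mat2 pp 0 0 pp) P = P"
  using act_scalar[of 1] by simp

lemma hecke_phi_parent_mat:
  assumes "(w :: 'f poly poly) \<in> Sym r" shows "hecke_phi r parent_mat w = Sym_act (mat2 0 0 0 1) w"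
  unfolding parent_mat_decomp hecke_phi_eq[OF char assms scalar_KZ KZ_one] act_p act_one U_op_mat2[OF assms] ..

lemma act_swap: "act (mat2 0 1 1 0) = Sym_act (mat2 0 1 1 0)"
  using act_mat2[of 0 0 1 1] by simp

lemma act_unip: "act (mat2 1 (to_fract x) 0 1) = Sym_act (mat2 1 (red x) 0 1)"
  using act_mat2[of 1 1 x 0] by simp

lemma act_unip_nat: "act (mat2 1 (- of_nat i) 0 1) = Sym_act (mat2 1 (- of_nat i) 0 1)"
  using act_unip[of "- of_nat i"] by (simp add: red.hom_uminus red.hom_of_nat)

text \<open>The operator is the action of the reduction of \<open>child_mat i\<close> modulo
  \<open>p\<close>, a singular matrix; likewise for \<open>parent_mat\<close>, which reduces to the
  projection to \<open>Y^r\<close>.\<close>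

lemma hecke_phi_child_mat:
  assumes "(w :: 'f poly poly) \<in> Sym r" shows "hecke_phi r (child_mat i) w = Sym_act (mat2 1 (- of_nat i) 0 0) w"
proof -
  have k: "mat2 pp 0 0 pp ** mat2 0 1 1 0 \<in> (KZ :: ('p pmat) set)"
    "mat2 0 1 1 0 ** mat2 1 (- of_nat i) 0 1 \<in> (KZ :: ('p pmat) set)"
    by (intro KZ_mult scalar_KZ swap_KZ unip_nat_KZ)+
  show ?thesis
    unfolding child_mat_decomp hecke_phi_eq[OF char assms k] act_mult[OF scalar_KZ swap_KZ]
      act_mult[OF swap_KZ unip_nat_KZ] act_p U_op_mat2[OF act_Sym[OF swap_KZ act_Sym[OF unip_nat_KZ assms]]]
    by (simp add: act_swap act_unip_nat flip: Sym_act_mult)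
qed

section \<open>The Hecke operator on atoms\<close>

abbreviation T :: "('p, 'f) gl2_fun \<Rightarrow> 'p pmat \<Rightarrow> 'f poly poly" where
  "T \<equiv> hecke_T r"

lemma hecke_T_apply:
  "T f g = (if invertible g then \<Sum>C \<in> lcosets. let y = (SOME y. y \<in> C) in hecke_phi r y (f (matrix_inv y ** g)) else 0)"
  by (simp add: hecke_T_def lcosets_def)

lemma T_linear:
  assumes "f \<in> ind_fns" "g \<in> ind_fns"
  shows "T (f + g) = T f + T g" "T 0 = 0" "T (scale c g) = scale c (T g)"
  using hecke_phi_linear[OF ind_fns_D(2)[OF assms(1)] ind_fns_D(2)[OF assms(2)]] hecke_phi_linear(2)[OF ind_fns_D(2)[OF assms(1)] ind_fns_D(2)[OF assms(2)]]
  by (auto simp: fun_eq_iff hecke_T_apply scale_def Let_def sum.distrib sum_distrib_left simp del: mult_pCons_left)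

text \<open>At \<open>x\<close> only the coset of \<open>x g\<^sup>-\<^sup>1\<close> contributes.\<close>

lemma T_atom_apply:
  assumes "invertible g" "w \<in> Sym r" "invertible x"
  shows "T (atom g w) x = hecke_phi r (x ** matrix_inv g) w"
proof -
  let ?z = "x ** matrix_inv g"
  define t where "t C = (let y = (SOME y. y \<in> C) in hecke_phi r y (atom g w (matrix_inv y ** x)))" for C
  have c: "\<exists>y. y \<in> hecke_supp \<and> C = y <#\<^bsub>GL2\<^esub> KZ \<and> t C = hecke_phi r y (atom g w (matrix_inv y ** x))" if C: "C \<in> lcosets" for C
  proof -
    obtain y0 where y0: "y0 \<in> hecke_supp" "C = y0 <#\<^bsub>GL2\<^esub> KZ" using C unfolding lcosets_def by blast
    then have "y0 \<in> C" using l_coset_self by simp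
    define y where "y = (SOME y. y \<in> C)"
    have "y \<in> C" unfolding y_def using \<open>y0 \<in> C\<close> by (rule someI)
    then have "y \<in> hecke_supp" using y0 hecke_supp_mult(2) by (auto simp: l_coset)
    moreover have "C = y <#\<^bsub>GL2\<^esub> KZ" using l_coset_eq \<open>y \<in> C\<close> y0 by blast
    moreover have "t C = hecke_phi r y (atom g w (matrix_inv y ** x))" unfolding t_def y_def Let_def ..
    ultimately show ?thesis by blast
  qed
  have on: "?z \<in> C" if C: "C \<in> lcosets" "t C \<noteq> 0" for C
  proof -
    obtain y where y: "y \<in> hecke_supp" "C = y <#\<^bsub>GL2\<^esub> KZ" "t C = hecke_phi r y (atom g w (matrix_inv y ** x))"
      using c C by blast
    then have "atom g w (matrix_inv y ** x) \<noteq> 0" using C assms hecke_phi_linear(2)[OF assms(2,2)] by auto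
    then have "matrix_inv y ** x \<in> orb g" using atom_outside by blast
    then have "matrix_inv y ** x ** matrix_inv g \<in> KZ" using assms orb_iff by blast
    moreover have "?z = y ** (matrix_inv y ** x ** matrix_inv g)" using y by (simp add: matrix_mul_assoc matrix_inv_right)
    ultimately show ?thesis using y by (auto simp: l_coset)
  qed
  have val: "t C = hecke_phi r ?z w" if C: "C \<in> lcosets" "?z \<in> C" for C
  proof -
    obtain y where y: "y \<in> hecke_supp" "C = y <#\<^bsub>GL2\<^esub> KZ" "t C = hecke_phi r y (atom g w (matrix_inv y ** x))"
      using c C by blast
    then obtain k where k: "k \<in> KZ" "?z = y ** k" using C by (auto simp: l_coset)
    have "x = y ** k ** g" using k(2) assms by (metis mul_inv_cancel_right(1))
    then have "matrix_inv y ** x = k ** g" using y by (simp add: matrix_mul_assoc[symmetric])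
    then show ?thesis using y k assms hecke_phi_KZ by (simp add: atom_apply)
  qed
  have "T (atom g w) x = sum t lcosets" using assms by (simp add: hecke_T_apply t_def)
  also have "\<dots> = hecke_phi r ?z w"
  proof (cases "?z \<in> hecke_supp")
    case True
    let ?C = "?z <#\<^bsub>GL2\<^esub> KZ"
    have C: "?C \<in> lcosets" "?z \<in> ?C" using True l_coset_self unfolding lcosets_def by blast+
    have "sum t lcosets = sum t {?C}"
    proof (rule sum.mono_neutral_right[OF lcosets_finite])
      show "\<forall>C\<in>lcosets - {?C}. t C = 0"
      proof
        fix C assume C: "C \<in> lcosets - {?C}"
        then obtain y where "C = y <#\<^bsub>GL2\<^esub> KZ" by (auto simp: lcosets_def)
        then have "?z \<notin> C" using C l_coset_eq[of ?z y] by blast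
        then show "t C = 0" using on C by blast
      qed
    qed (use C in simp)
    then show ?thesis using val C by simp
  next
    case False
    then have "?z \<notin> C" if "C \<in> lcosets" for C
      using that hecke_supp_mult(2) by (auto simp: lcosets_def l_coset)
    then have "t C = 0" if "C \<in> lcosets" for C using on that by blast
    then show ?thesis using False by (simp add: hecke_phi_def)
  qed
  finally show ?thesis .
qed

lemma sum_fun_apply: "(\<Sum>i\<in>A. f i) x = (\<Sum>i\<in>A. f i x)" for f :: "'i \<Rightarrow> 'a \<Rightarrow> 'b::ab_group_add"
  by (induction A rule: infinite_finite_induct) auto

text \<open>Compare both sides at \<open>x\<close>. By \<open>T_atom_apply\<close> the left side is
  \<open>hecke_phi\<close> at x g^-1. If this matrix is in the support, it lies in exactly one of
  the p + 1 orbits, so exactly one term on the right contributes; otherwise all terms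
  vanish.\<close>

lemma T_atom:
  assumes g: "invertible g" and w: "w \<in> Sym r"
  shows "T (atom g w) = atom (parent_mat ** g) (Sym_act (mat2 0 0 0 1) w) +
     (\<Sum>i<CARD('p). atom (child_mat i ** g) (Sym_act (mat2 1 (- of_nat i) 0 0) w))" (is "_ = ?a + sum ?b _")
proof (rule ext)
  fix x
  show "T (atom g w) x = (?a + (\<Sum>i<CARD('p). ?b i)) x"
  proof (cases "invertible x")
    case False
    have "?a x = 0" using False g orb_invertible atom_outside invertible_mult parent_mat_inv by metis
    moreover have "?b i x = 0" for i using False g orb_invertible atom_outside invertible_mult child_mat_inv by metis
    ultimately show ?thesis using False by (simp add: hecke_T_apply sum_fun_apply)
  next
    case True
    let ?z = "x ** matrix_inv g"
    have o: "x \<in> orb (h ** g) \<longleftrightarrow> ?z \<in> orb h" for h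
      using orb_mult_right_iff[of g ?z h] g by simp
    have v: "atom (h ** g) (hecke_phi r h w) x = hecke_phi r ?z w" if h: "?z \<in> orb h" "h \<in> hecke_supp" for h
    proof -
      obtain k where k: "k \<in> KZ" "?z = k ** h" using h unfolding orb_def by blast
      then have "x = k ** (h ** g)" using g by (metis mul_inv_cancel_right(1) matrix_mul_assoc)
      then have "atom (h ** g) (hecke_phi r h w) x = act k (hecke_phi r h w)"
        using k that g by (simp add: atom_apply invertible_mult)
      then show ?thesis using k that w hecke_phi_KZ(2) by simp
    qed
    have v1: "?a x = (if ?z \<in> orb parent_mat then hecke_phi r ?z w else 0)"
      using v[of parent_mat] o[of parent_mat] parent_mat_supp atom_outside w by (auto simp: hecke_phi_parent_mat)
    have v2: "?b i x = (if ?z \<in> orb (child_mat i) then hecke_phi r ?z w else 0)" for i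
      using v[of "child_mat i"] o[of "child_mat i"] child_mat_supp atom_outside w by (auto simp: hecke_phi_child_mat)
    have e: "(?a + (\<Sum>i<CARD('p). ?b i)) x = (if ?z \<in> orb parent_mat then hecke_phi r ?z w else 0) +
        (\<Sum>i<CARD('p). if ?z \<in> orb (child_mat i) then hecke_phi r ?z w else 0)"
      by (simp add: sum_fun_apply v1 v2)
    have "\<dots> = hecke_phi r ?z w"
    proof (cases "?z \<in> hecke_supp")
      case False
      then have "hecke_phi r ?z w = 0" by (simp add: hecke_phi_def)
      then show ?thesis by (simp cong: if_cong)
    next
      case True
      then consider "?z \<in> orb parent_mat" | i where "i < CARD('p)" "?z \<in> orb (child_mat i)" using supp_orbs by blast
      then show ?thesis
      proof cases
        case 1
        then have "?z \<notin> orb (child_mat i)" for i using orb_disjoint1 orb_eq orb_self by metis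
        then show ?thesis using 1 by simp
      next
        case 2
        then have "?z \<notin> orb parent_mat" using orb_disjoint1 orb_eq orb_self by metis
        moreover have "?z \<in> orb (child_mat j) \<longleftrightarrow> j = i" if "j < CARD('p)" for j
          using 2 that orb_disjoint2 orb_eq orb_self by metis
        then have "(\<Sum>j<CARD('p). if ?z \<in> orb (child_mat j) then hecke_phi r ?z w else 0) =
           (\<Sum>j<CARD('p). if j = i then hecke_phi r ?z w else 0)" by (intro sum.cong) auto
        ultimately show ?thesis using 2 by simp
      qed
    qed
    then show ?thesis using T_atom_apply[OF g w True] e by simp
  qed
qed

lemma T_transl:
  assumes "invertible (h :: 'p pmat)"
  shows "T (right_transl h f) = right_transl h (T f)"
proof (rule ext)
  fix g :: "'p pmat"
  have "invertible (g ** h) \<longleftrightarrow> invertible g"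
    using assms invertible_mult invertible_inv by (metis mul_inv_cancel_right(2))
  then show "T (right_transl h f) g = right_transl h (T f) g"
    by (simp add: right_transl_def hecke_T_apply matrix_mul_assoc)
qed

end

section \<open>Coinvariants along a branch\<close>

lemma coeff_linear_power:
  fixes a b :: "'a::comm_ring_1"
  shows "coeff ([:a, b:] ^ i) i = b ^ i" "i < j \<Longrightarrow> coeff ([:a, b:] ^ i) j = 0"
proof -
  have step: "coeff ([:a, b:] * q) (Suc k) = a * coeff q (Suc k) + b * coeff q k" for q k
    by simp
  have "coeff ([:a, b:] ^ i) i = b ^ i \<and> (\<forall>j>i. coeff ([:a, b:] ^ i) j = 0)"
  proof (induction i)
    case (Suc i)
    have "coeff ([:a, b:] ^ Suc i) j = 0" if "j > Suc i" for j
      using that Suc step[of "[:a, b:] ^ i" "j - 1"] by simp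
    then show ?case using Suc step[of "[:a, b:] ^ i" i] by simp
  qed simp
  then show "coeff ([:a, b:] ^ i) i = b ^ i" "i < j \<Longrightarrow> coeff ([:a, b:] ^ i) j = 0" by auto
qed

section \<open>Geometric sums modulo prime powers, for the iterates of affine maps\<close>

lemma cong_int_ex: "[x = y] (mod m) \<Longrightarrow> \<exists>k. x = y + m * k" for x y m :: int
  by (metis cong_iff_lin cong_sym)

lemma geometric_sum_add: "(\<Sum>j<m + n. a ^ j) = (\<Sum>j<m. a ^ j) + a ^ m * (\<Sum>j<n. a ^ j)" for a :: int
  by (induction n) (simp_all add: algebra_simps power_add)

text \<open>The m-th iterate of x -> a x - c is a^m x - c (1 + a + ... + a^(m-1)); the congruence
  gives its translation part after i q^d steps to one digit beyond q^d. The sum factors into sums of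
  \<open>q\<close> powers, each equal to \<open>q\<close> modulo q^2, and one sum of
  \<open>i\<close> powers, equal to \<open>i\<close> modulo \<open>q\<close>.\<close>

lemma geometric_sum_cong:
  fixes a :: int
  assumes "prime q" "odd q" "[a = 1] (mod int q)"
  shows "[(\<Sum>j<i * q ^ d. a ^ j) = int (i * q ^ d)] (mod int q ^ Suc d)"
proof -
  define s where "s m = (\<Sum>j<m. a ^ j)" for m
  have mul: "s (i * N) = s N * (\<Sum>j<i. (a ^ N) ^ j)" for i N
  proof (induction i)
    case (Suc i)
    have "s (Suc i * N) = s (i * N) + (a ^ N) ^ i * s N"
      unfolding s_def using geometric_sum_add[of a "i * N" N] by (simp add: add.commute power_mult[symmetric] mult.commute)
    then show ?case using Suc by (simp add: algebra_simps)
  qed (simp add: s_def)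
  have b1: "[a ^ m = 1] (mod int q)" for m using cong_pow[OF assms(3), of m] by simp
  have small: "[(\<Sum>j<i. b ^ j) = int i] (mod int q)" if "[b = 1] (mod int q)" for b :: int and i
  proof -
    have "[(\<Sum>j<i. b ^ j) = (\<Sum>j<i. 1)] (mod int q)"
      using that cong_pow[OF that] by (intro cong_sum) simp
    then show ?thesis by simp
  qed
  have full: "[(\<Sum>j<q. b ^ j) = int q] (mod int q ^ 2)" if b1: "[b = 1] (mod int q)" for b :: int
  proof -
    obtain e where b: "b = 1 + int q * e" using cong_int_ex[OF b1] by blast
    have pw: "[b ^ j = 1 + int j * (int q * e)] (mod int q ^ 2)" for j
    proof (induction j)
      case (Suc j)
      have "[b ^ Suc j = b * (1 + int j * (int q * e))] (mod int q ^ 2)" using cong_scalar_left[OF Suc] by simp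
      also have "b * (1 + int j * (int q * e)) = 1 + int (Suc j) * (int q * e) + int q ^ 2 * (int j * e * e)"
        by (simp add: b algebra_simps power2_eq_square)
      also have "[\<dots> = 1 + int (Suc j) * (int q * e)] (mod int q ^ 2)" by (simp add: cong_def)
      finally show ?case .
    qed simp
    have tri: "(\<Sum>j<q. int j) * 2 = int q * (int q - 1)" for q by (induction q) (auto simp: algebra_simps)
    \<comment> \<open>Oddness enters here: 0 + 1 + ... + (q - 1) = q (q - 1) / 2 is then a multiple
      of \<open>q\<close>.\<close>
    obtain t where "q = 2 * t + 1" using assms(2) by (blast elim: oddE)
    then have "int q - 1 = int t * 2" by simp
    then have "(\<Sum>j<q. int j) * 2 = (int q * int t) * 2" unfolding tri[of q] by (simp only: mult.assoc)
    then have st: "(\<Sum>j<q. int j) = int q * int t" by simp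
    have "[(\<Sum>j<q. b ^ j) = (\<Sum>j<q. 1 + int j * (int q * e))] (mod int q ^ 2)" by (intro cong_sum pw)
    also have "(\<Sum>j<q. 1 + int j * (int q * e)) = int q + (\<Sum>j<q. int j) * (int q * e)"
      by (simp add: sum.distrib sum_distrib_right)
    also have "\<dots> = int q + int q ^ 2 * (int t * e)" by (simp add: st power2_eq_square algebra_simps)
    also have "[\<dots> = int q] (mod int q ^ 2)" by (simp add: cong_def)
    finally show ?thesis .
  qed
  have sq: "[s (q ^ d) = int q ^ d] (mod int q ^ Suc d)" for d
  proof (induction d)
    case (Suc d)
    obtain z where z: "s (q ^ d) = int q ^ d + int q ^ Suc d * z" using cong_int_ex[OF Suc] by blast
    obtain y where y: "(\<Sum>j<q. (a ^ (q ^ d)) ^ j) = int q + int q ^ 2 * y"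
      using cong_int_ex[OF full[OF b1, of "q ^ d"]] by blast
    have "s (q ^ Suc d) = (int q ^ d + int q ^ Suc d * z) * (int q + int q ^ 2 * y)"
      using mul[of q "q ^ d"] by (simp add: y z)
    also have "\<dots> = int q ^ Suc d + int q ^ Suc (Suc d) * (y + z + int q * z * y)"
      by (simp add: algebra_simps power2_eq_square)
    finally show ?case by (simp add: cong_def)
  qed (simp add: s_def)
  obtain z where z: "s (q ^ d) = int q ^ d + int q ^ Suc d * z" using cong_int_ex[OF sq] by blast
  obtain y where y: "(\<Sum>j<i. (a ^ (q ^ d)) ^ j) = int i + int q * y"
    using cong_int_ex[OF small[OF b1, of "q ^ d" i]] by blast
  have "s (i * q ^ d) = (int q ^ d + int q ^ Suc d * z) * (int i + int q * y)"
    using mul[of i "q ^ d"] by (simp add: y z)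
  also have "\<dots> = int (i * q ^ d) + int q ^ Suc d * (y + z * int i + int q * z * y)"
    by (simp add: algebra_simps)
  finally show ?thesis by (simp add: s_def cong_def)
qed

context gl2
begin

section \<open>The coefficient of Y^r and the coinvariants of a unipotent element\<close>

definition top_coeff :: "'f poly poly \<Rightarrow> 'f" where "top_coeff P = coeff (coeff P r) 0"

definition Ypow :: "'f poly poly" where "Ypow = monom (monom 1 0) r"

lemma Ypow_Sym: "Ypow \<in> Sym r"
  unfolding Ypow_def by (rule Sym_monom) auto

lemma top_coeff_linear: "top_coeff (P + Q) = top_coeff P + top_coeff Q" "top_coeff 0 = 0" "top_coeff ([:[:c:]:] * P) = c * top_coeff P" "top_coeff (P - Q) = top_coeff P - top_coeff Q" "top_coeff Ypow = 1"
  by (simp_all add: top_coeff_def Ypow_def)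

lemma Sym_expand:
  assumes "P \<in> Sym r"
  obtains c where "P = (\<Sum>i\<le>r. monom (monom (c i) (r - i)) i)" "top_coeff P = c r"
proof -
  obtain c where P: "P = (\<Sum>i\<le>r. monom (monom (c i) (r - i)) i)" using assms by (auto simp: Sym_def)
  then have "top_coeff P = c r" by (simp add: top_coeff_def coeff_sum)
  then show ?thesis using that P by blast
qed

lemma Sym_act_monom:
  "Sym_act A (monom (monom a j) i) = [:[:a:]:] * lin_form (A $ 1 $ 1) (A $ 2 $ 1) ^ j * lin_form (A $ 1 $ 2) (A $ 2 $ 2) ^ i"
  for A :: "'f ^ 2 ^ 2"
proof -
  interpret comm_ring_hom "Sym_act A" by (rule Sym_act_hom)
  have "monom (monom a j) i = [:[:a:]:] * [:[:0,1:]:] ^ j * [:0,1:] ^ i"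
    by (simp add: monom_altdef poly_const_pow smult_power)
  then show ?thesis by (simp only: hom_mult hom_power Sym_act_simps)
qed

lemma lin_form_eq: "lin_form a c = [:[:0, a:], [:c:]:]"
  by (simp add: lin_form_alt)

text \<open>An upper triangular matrix sends \<open>X\<close> to a multiple of itself, so only the
  monomial \<open>Y^r\<close> contributes to the new coefficient of \<open>Y^r\<close>.\<close>

lemma top_coeff_upper:
  assumes "P \<in> Sym r" "A $ 2 $ 1 = 0"
  shows "top_coeff (Sym_act A P) = (A $ 2 $ 2) ^ r * top_coeff P"
proof -
  interpret comm_ring_hom "Sym_act A" by (rule Sym_act_hom)
  obtain c where P: "P = (\<Sum>i\<le>r. monom (monom (c i) (r - i)) i)" "top_coeff P = c r" using assms Sym_expand by blast
  have sum: "top_coeff (sum f S) = (\<Sum>i\<in>S. top_coeff (f i))" for f and S :: "nat set" by (simp add: top_coeff_def coeff_sum)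
  have "top_coeff (Sym_act A (monom (monom (c i) (r - i)) i)) = (if i = r then (A $ 2 $ 2) ^ r * c r else 0)" if "i \<le> r" for i
  proof -
    have l: "lin_form (A $ 1 $ 1) (A $ 2 $ 1) ^ (r - i) = [:[:0, A $ 1 $ 1:] ^ (r - i):]"
      by (simp add: lin_form_eq assms poly_const_pow)
    show ?thesis
      unfolding Sym_act_monom l top_coeff_def lin_form_eq[of "A $ 1 $ 2"]
      using that by (auto simp: coeff_linear_power poly_const_pow)
  qed
  then have "top_coeff (Sym_act A P) = (\<Sum>i\<le>r. if i = r then (A $ 2 $ 2) ^ r * c r else 0)"
    unfolding P(1) hom_sum sum by (intro sum.cong) auto
  then show ?thesis using P by simp
qed

lemma Sym_act_D: assumes "w \<in> Sym r" shows "Sym_act (mat2 0 0 0 1) w = [:[:top_coeff w:]:] * Ypow"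
proof -
  obtain c where c: "w = (\<Sum>i\<le>r. monom (monom (c i) (r - i)) i)" "top_coeff w = c r" using assms Sym_expand by blast
  then have "coeff w r = [:top_coeff w:]" by (simp add: coeff_sum monom_0)
  then show ?thesis using U_op_mat2[OF assms] by (simp add: U_op_def Ypow_def smult_monom monom_0)
qed

text \<open>A nontrivial unipotent acts on \<open>Sym\<^sup>r\<close>, \<open>r < p\<close>, by a single Jordan block.\<close>

lemma unipotent_coinvariants:
  assumes "0 \<in> K" "\<And>v w. v \<in> K \<Longrightarrow> w \<in> K \<Longrightarrow> v + w \<in> K" "\<And>c w. w \<in> K \<Longrightarrow> [:[:c:]:] * w \<in> K"
    and c: "c \<noteq> 0" and K: "\<And>w. w \<in> Sym r \<Longrightarrow> Sym_act (mat2 1 c 0 1) w - w \<in> K"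
    and w: "w \<in> Sym r"
  shows "w - [:[:top_coeff w:]:] * Ypow \<in> K"
proof -
  have Ksum: "sum f S \<in> K" if "finite S" "\<And>i. i \<in> S \<Longrightarrow> f i \<in> K" for f and S :: "nat set"
    using that by (induction S rule: finite_induct) (auto simp: assms)
  have mscale: "[:[:e:]:] * monom (monom b j) i = monom (monom (e * b) j) i" for e b :: 'f and i j
    by (simp add: smult_monom)
  have mon: "i < r \<Longrightarrow> monom (monom b (r - i)) i \<in> K" for i b
  proof (induction i arbitrary: b rule: less_induct)
    case (less i)
    let ?t = "\<lambda>k. monom (monom (of_nat (Suc i choose k) * c ^ (Suc i - k)) (r - k)) k"
    \<comment> \<open>For u the unipotent element, u - 1 sends X^(r-i-1) Y^(i+1) to (i + 1) c
      X^(r-i) Y^i plus monomials with lower powers of \<open>Y\<close>, which are in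
      \<open>K\<close> by induction.\<close>
    let ?w = "monom (monom 1 (r - Suc i)) (Suc i) :: 'f poly poly"
    have "?w \<in> Sym r" using less by (intro Sym_monom) auto
    have bin: "lin_form c 1 ^ Suc i = (\<Sum>k\<le>Suc i. of_nat (Suc i choose k) * (monom 1 1) ^ k * (monom (monom c 1) 0) ^ (Suc i - k))"
      unfolding lin_form_def using binomial_ring[of "monom 1 1" "monom (monom c 1) 0" "Suc i"]
      by (simp add: add.commute monom_0 one_pCons)
    have nat_poly: "of_nat m = monom (monom (of_nat m) 0) 0" for m by (simp add: of_nat_poly monom_0)
    have "Sym_act (mat2 1 c 0 1) ?w = lin_form 1 0 ^ (r - Suc i) * lin_form c 1 ^ Suc i"
      unfolding Sym_act_monom by (simp add: pCons_one)
    also have "lin_form 1 0 ^ (r - Suc i) = monom (monom 1 (r - Suc i)) (0 :: nat)"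
      by (simp add: lin_form_def monom_power)
    also have "monom (monom 1 (r - Suc i)) 0 * lin_form c 1 ^ Suc i = (\<Sum>k\<le>Suc i. ?t k)"
      unfolding bin sum_distrib_left
    proof (rule sum.cong)
      fix k assume k: "k \<in> {..Suc i}"
      have "r - Suc i + (Suc i - k) = r - k" using k less.prems by auto
      then show "monom (monom 1 (r - Suc i)) 0 * (of_nat (Suc i choose k) * (monom 1 1) ^ k * (monom (monom c 1) 0) ^ (Suc i - k)) = ?t k"
        unfolding nat_poly by (simp add: monom_power mult_monom)
    qed simp
    also have "\<dots> = (\<Sum>k<i. ?t k) + ?t i + ?w" by (simp add: lessThan_Suc_atMost[symmetric])
    finally have "(\<Sum>k<i. ?t k) + ?t i \<in> K" using K[OF \<open>?w \<in> Sym r\<close>] by simp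
    moreover have "(\<Sum>k<i. ?t k) \<in> K" using less by (intro Ksum) auto
    then have "[:[:-1:]:] * (\<Sum>k<i. ?t k) \<in> K" by (rule assms)
    ultimately have "(\<Sum>k<i. ?t k) + ?t i + [:[:-1:]:] * (\<Sum>k<i. ?t k) \<in> K" by (rule assms(2))
    then have ti: "?t i \<in> K" by (simp only: const_neg_one) simp
    \<comment> \<open>Since i < r <= p - 1, the number i + 1 is prime to the characteristic.\<close>
    have nz: "of_nat (Suc i) \<noteq> (0 :: 'f)"
      using less.prems r_le char of_nat_eq_0_iff_char_dvd[of "Suc i", where 'a = 'f] by (auto dest: dvd_imp_le)
    have "[:[: b / (of_nat (Suc i) * c) :]:] * ?t i \<in> K" using ti by (rule assms(3))
    then show ?case unfolding mscale using nz c by (simp del: of_nat_Suc)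
  qed
  obtain e where e: "w = (\<Sum>i\<le>r. monom (monom (e i) (r - i)) i)" "top_coeff w = e r" using w Sym_expand by blast
  have "w = (\<Sum>i<r. monom (monom (e i) (r - i)) i) + [:[:top_coeff w:]:] * Ypow"
    unfolding e(2) Ypow_def mscale by (subst e(1)) (simp add: lessThan_Suc_atMost[symmetric])
  then have "w - [:[:top_coeff w:]:] * Ypow = (\<Sum>i<r. monom (monom (e i) (r - i)) i)" by (simp only: eq_diff_eq[symmetric] diff_eq_eq)
  also have "\<dots> \<in> K" using mon by (intro Ksum) auto
  finally show ?thesis .
qed

section \<open>Functions on one branch in affine coordinates\<close>

definition subsp :: "('p, 'f) gl2_fun set \<Rightarrow> bool" where
  "subsp N \<longleftrightarrow> 0 \<in> N \<and> (\<forall>f\<in>N. \<forall>g\<in>N. f + g \<in> N) \<and> (\<forall>c. \<forall>f\<in>N. scale c f \<in> N)"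

lemma subsp_D:
  assumes "subsp N"
  shows "0 \<in> N" "f \<in> N \<Longrightarrow> g \<in> N \<Longrightarrow> f + g \<in> N" "f \<in> N \<Longrightarrow> scale c f \<in> N" "f \<in> N \<Longrightarrow> - f \<in> N" "f \<in> N \<Longrightarrow> g \<in> N \<Longrightarrow> f - g \<in> N"
proof -
  show 1: "0 \<in> N" "f \<in> N \<Longrightarrow> g \<in> N \<Longrightarrow> f + g \<in> N" "f \<in> N \<Longrightarrow> scale c f \<in> N" for f g c
    using assms by (auto simp: subsp_def)
  show 2: "f \<in> N \<Longrightarrow> - f \<in> N" for f using 1(3)[of f "-1"] by (simp add: scale_simps)
  show "f \<in> N \<Longrightarrow> g \<in> N \<Longrightarrow> f - g \<in> N" using 1(2)[of f "-g"] 2[of g] by simp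
qed

lemma subsp_sum: "subsp N \<Longrightarrow> (\<And>i. i \<in> A \<Longrightarrow> f i \<in> N) \<Longrightarrow> sum f A \<in> N"
  by (induction A rule: infinite_finite_induct) (auto simp: subsp_D)

lemma subsp_trans: "subsp N \<Longrightarrow> f - g \<in> N \<Longrightarrow> g - h \<in> N \<Longrightarrow> f - h \<in> N"
  using subsp_D(2)[of N "f - g" "g - h"] by simp

text \<open>The vertex has depth \<open>d\<close> and coordinate \<open>x\<close> on the branch
  rooted at \<open>g\<close>. It depends only on \<open>x\<close> modulo p^d, but changing
  \<open>x\<close> within its class twists the value \<open>w\<close> by a unipotent element
  (\<open>br_atom_shift\<close>).\<close>

definition br_atom :: "'p pmat \<Rightarrow> nat \<Rightarrow> 'p padic_int \<Rightarrow> 'f poly poly \<Rightarrow> 'p pmat \<Rightarrow> 'f poly poly" where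
  "br_atom g d x w = atom (mat2 1 (to_fract x) 0 (pp ^ d) ** g) w"

lemma br_atom_inv [simp]: "invertible (mat2 1 x 0 (pp ^ d :: 'p padic))"
  by (simp add: invertible_iff_det_unit dvd_field_iff)

lemma br_atom_ind_fns: "invertible g \<Longrightarrow> w \<in> Sym r \<Longrightarrow> br_atom g d x w \<in> ind_fns"
  unfolding br_atom_def by (intro atom_ind_fns invertible_mult br_atom_inv)

lemma br_atom_linear:
  assumes "invertible g"
  shows "br_atom g d x (v + w) = br_atom g d x v + br_atom g d x w" "br_atom g d x 0 = 0" "br_atom g d x (v - w) = br_atom g d x v - br_atom g d x w"
    "br_atom g d x ([:[:c:]:] * w) = scale c (br_atom g d x w)"
  unfolding br_atom_def by (intro atom_linear invertible_mult br_atom_inv assms)+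

text \<open>This form includes depth 0, where the parent may leave the branch; hence the parent is
  not written as a \<open>br_atom\<close>.\<close>

lemma T_Av0:
  assumes "invertible g" "w \<in> Sym r"
  shows "T (br_atom g d x w) = atom (parent_mat ** mat2 1 (to_fract x) 0 (pp ^ d) ** g) ([:[:top_coeff w:]:] * Ypow) +
    (\<Sum>i<CARD('p). br_atom g (Suc d) (x - of_nat i * of_nat CARD('p) ^ d) (Sym_act (mat2 1 (- of_nat i) 0 0) w))"
proof -
  have "child_mat i ** mat2 1 (to_fract x) 0 (pp ^ d) = mat2 1 (to_fract (x - of_nat i * of_nat CARD('p) ^ d)) 0 (pp ^ Suc d)" for i
    by (simp add: child_mat_def to_fract_power)
  then show ?thesis
    using assms by (simp add: br_atom_def T_atom invertible_mult matrix_mul_assoc Sym_act_D)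
qed

lemma T_br_atom:
  assumes "invertible g" "w \<in> Sym r"
  shows "T (br_atom g (Suc d) x w) = br_atom g d x ([:[:top_coeff w:]:] * Ypow) +
    (\<Sum>i<CARD('p). br_atom g (Suc (Suc d)) (x - of_nat i * of_nat CARD('p) ^ Suc d) (Sym_act (mat2 1 (- of_nat i) 0 0) w))"
proof -
  have "atom (parent_mat ** mat2 1 (to_fract x) 0 (pp ^ Suc d) ** g) v = br_atom g d x v" if "v \<in> Sym r" for v
    unfolding br_atom_def
  proof (rule atom_eqI[OF _ scalar_KZ])
    show "v = act (mat2 pp 0 0 pp) v" by (simp add: act_p)
  qed (use assms in \<open>auto simp: matrix_mul_assoc parent_mat_def intro!: invertible_mult\<close>)
  then show ?thesis using assms by (simp add: T_Av0 Sym_scale Ypow_Sym del: mult_pCons_left)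
qed

lemma br_atom_shift:
  assumes "invertible g"
  shows "br_atom g d (x + of_nat CARD('p) ^ d * y) w = br_atom g d x (Sym_act (mat2 1 (- red y) 0 1) w)"
  unfolding br_atom_def
proof (rule atom_eqI[OF _ unip_KZ[of y]])
  show "w = act (mat2 1 (to_fract y) 0 1) (Sym_act (mat2 1 (- red y) 0 1) w)"
    by (simp add: act_unip flip: Sym_act_mult) (metis Sym_act_one mat_mat2)
  show "mat2 1 (to_fract (x + of_nat CARD('p) ^ d * y)) 0 (pp ^ d) ** g =
    mat2 1 (to_fract y) 0 1 ** (mat2 1 (to_fract x) 0 (pp ^ d) ** g)"
    by (simp add: matrix_mul_assoc to_fract_power algebra_simps)
qed (use assms in \<open>auto intro!: invertible_mult\<close>)

lemma right_transl_atom: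
  assumes "invertible h" "invertible g"
  shows "right_transl h (atom g w) = atom (g ** matrix_inv h) w"
proof (rule ext)
  fix x
  have "x ** h \<in> orb g \<longleftrightarrow> x \<in> orb (g ** matrix_inv h)"
    using orb_mult_right_iff[of h x "g ** matrix_inv h"] assms by simp
  moreover have "x ** matrix_inv (g ** matrix_inv h) = x ** h ** matrix_inv g"
    using assms by (simp add: matrix_inv_mult matrix_inv_inv matrix_mul_assoc)
  ultimately show "right_transl h (atom g w) x = atom (g ** matrix_inv h) w x"
    by (simp add: right_transl_def atom_def)
qed

text \<open>Moving the affine matrix past the coordinate matrix leaves \<open>mat2 a 0 0 1\<close>
  on the left. As \<open>a\<close> is 1 modulo \<open>p\<close>, this element of K acts trivially on
  values, so only the coordinate changes.\<close>

lemma br_atom_move: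
  assumes "invertible g" "invertible h" and a: "[a = 1] (mod int CARD('p))"
    and gh: "g ** h = mat2 (of_int a) (of_int c) 0 1 ** g"
  shows "right_transl h (br_atom g d x w) = br_atom g d (of_int a * x - of_int c) w"
proof -
  have ra: "red (of_int a) = 1"
  proof -
    obtain k where "a = 1 + int CARD('p) * k" using cong_int_ex[OF a] by blast
    then show ?thesis using char of_nat_CHAR[where 'a = 'f] by (simp add: red.hom_add red.hom_mult red.hom_of_int red.hom_of_nat)
  qed
  have "\<not> of_nat CARD('p) dvd (of_int a :: 'p padic_int)"
  proof
    assume "of_nat CARD('p) dvd (of_int a :: 'p padic_int)"
    then have "int CARD('p) dvd a" by (simp only: p_dvd_of_int)
    then have "int CARD('p) dvd 1" using a by (metis cong_dvd_iff)
    then show False using p_ge by auto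
  qed
  then have ua: "(of_int a :: 'p padic_int) dvd 1" by (rule unit_if_not_p_dvd)
  let ?k = "mat2 (to_fract (of_int a)) (to_fract 0) (to_fract 0) (to_fract 1) :: 'p pmat"
  have k: "?k \<in> KZ" "act ?k w = w"
  proof -
    show "?k \<in> KZ" by (rule KZ_mat2) (use ua in simp)
    have "act ?k w = Sym_act (mat2 1 0 0 1) w" using act_mat2[of "of_int a" 1 0 0] ua ra by simp
    then show "act ?k w = w" by (metis Sym_act_one mat_mat2)
  qed
  let ?y = "of_int a * x - of_int c"
  have "mat2 1 (to_fract ?y) 0 (pp ^ d) ** g ** h = ?k ** (mat2 1 (to_fract x) 0 (pp ^ d) ** g)"
    unfolding matrix_mul_assoc[symmetric] gh by (simp add: matrix_mul_assoc)
  then have "mat2 1 (to_fract ?y) 0 (pp ^ d) ** g = ?k ** (mat2 1 (to_fract x) 0 (pp ^ d) ** g) ** matrix_inv h"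
    using assms(2) by (metis mul_inv_cancel_right(2))
  then have eq: "mat2 1 (to_fract ?y) 0 (pp ^ d) ** g = ?k ** (mat2 1 (to_fract x) 0 (pp ^ d) ** g ** matrix_inv h)"
    by (simp add: matrix_mul_assoc)
  have "atom (mat2 1 (to_fract ?y) 0 (pp ^ d) ** g) w = atom (mat2 1 (to_fract x) 0 (pp ^ d) ** g ** matrix_inv h) w"
    by (rule atom_eqI[OF _ k(1) eq]) (use k assms in \<open>auto intro!: invertible_mult\<close>)
  then show ?thesis using assms by (simp add: br_atom_def right_transl_atom invertible_mult)
qed

text \<open>Digit by digit: if m steps bring \<open>x\<close> to p^d y, another i p^d steps add -i c
  p^d modulo p^(d+1), because a^(i p^d) is 1 modulo \<open>p\<close>. As \<open>c\<close> is a unit,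
  some \<open>i\<close> clears the next digit.\<close>

lemma affine_orbit_zero:
  fixes x :: "'p padic_int" and a c :: int
  assumes a: "[a = 1] (mod int CARD('p))" and c: "\<not> int CARD('p) dvd c"
  shows "\<exists>m. of_nat CARD('p) ^ d dvd of_int (a ^ m) * x - of_int (c * (\<Sum>j<m. a ^ j))"
proof (induction d)
  case (Suc d)
  let ?p = "of_nat CARD('p) :: 'p padic_int"
  define s where "s m = (\<Sum>j<m. a ^ j)" for m
  obtain m where "?p ^ d dvd of_int (a ^ m) * x - of_int (c * s m)" using Suc s_def by auto
  then obtain y where y: "of_int (a ^ m) * x - of_int (c * s m) = ?p ^ d * y" by blast
  have "\<not> ?p dvd of_int (- c)" unfolding p_dvd_of_int using c by simp
  then have "(of_int (- c) :: 'p padic_int) dvd 1" by (rule unit_if_not_p_dvd)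
  then obtain i where i: "?p dvd of_nat i * of_int (- c) + y" using padic_dvd_digit by blast
  then obtain t where t: "of_nat i * of_int (- c) + y = ?p * t" by blast
  let ?n = "i * CARD('p) ^ d"
  obtain z where z: "s ?n = int ?n + int CARD('p) ^ Suc d * z"
    using cong_int_ex[OF geometric_sum_cong[OF odd_prime a, of i d]] unfolding s_def by blast
  have "[a ^ ?n = 1] (mod int CARD('p))" using cong_pow[OF a, of ?n] by simp
  then obtain u where u: "a ^ ?n = 1 + int CARD('p) * u" by (blast dest: cong_int_ex)
  have sadd: "s (m + n) = s m * a ^ n + s n" for n
    using geometric_sum_add[of a n m] by (simp add: s_def algebra_simps)
  have "of_int (a ^ (m + ?n)) * x - of_int (c * s (m + ?n))
      = of_int (a ^ ?n) * (of_int (a ^ m) * x - of_int (c * s m)) - of_int c * of_int (s ?n)"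
    by (simp add: sadd power_add algebra_simps)
  also have "\<dots> = (1 + ?p * of_int u) * (?p ^ d * y) - of_int c * (of_nat i * ?p ^ d + ?p ^ Suc d * of_int z)"
    unfolding y u z by simp
  also have "\<dots> = ?p ^ d * (of_nat i * of_int (- c) + y) + ?p ^ Suc d * (of_int u * y - of_int c * of_int z)"
    by (simp add: algebra_simps)
  also have "\<dots> = ?p ^ Suc d * (t + of_int u * y - of_int c * of_int z)" unfolding t by (simp add: algebra_simps)
  finally have "?p ^ Suc d dvd of_int (a ^ (m + ?n)) * x - of_int (c * s (m + ?n))" by simp
  then show ?case unfolding s_def by blast
qed simp

lemma br_atom_coinvariants:
  assumes N: "subsp N" and g: "invertible g"
    and a: "[a = 1] (mod int CARD('p))" and c: "\<not> int CARD('p) dvd c"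
    and step: "\<And>x w. w \<in> Sym r \<Longrightarrow> br_atom g d (of_int a * x - of_int c) w - br_atom g d x w \<in> N"
    and w: "w \<in> Sym r"
  shows "br_atom g d x w - scale (top_coeff w) (br_atom g d 0 Ypow) \<in> N"
proof -
  let ?p = "of_nat CARD('p) :: 'p padic_int"
  define th where "th m x = of_int (a ^ m) * x - of_int (c * (\<Sum>j<m. a ^ j))" for m and x :: "'p padic_int"
  have th_Suc: "th (Suc m) x = of_int a * th m x - of_int c" for m x
  proof -
    have s: "(\<Sum>j<Suc m. a ^ j) = 1 + a * (\<Sum>j<m. a ^ j)" by (subst sum.lessThan_Suc_shift) (simp add: sum_distrib_left)
    show ?thesis unfolding th_def s by (simp add: algebra_simps)
  qed
  have iter: "br_atom g d (th m x) v - br_atom g d x v \<in> N" if "v \<in> Sym r" for m x v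
  proof (induction m)
    case 0
    have "th 0 x = x" by (simp add: th_def)
    then show ?case using subsp_D(1)[OF N] by (metis diff_self)
  next
    case (Suc m)
    then show ?case using step[OF that, of "th m x"] subsp_trans[OF N] unfolding th_Suc by blast
  qed
  have fix0: "br_atom g d 0 v - scale (top_coeff v) (br_atom g d 0 Ypow) \<in> N" if v: "v \<in> Sym r" for v
  proof -
    obtain z where z: "(\<Sum>j<CARD('p) ^ d. a ^ j) = int (CARD('p) ^ d) + int CARD('p) ^ Suc d * z"
      using geometric_sum_cong[OF odd_prime a, of 1 d] by (simp only: mult_1) (blast dest: cong_int_ex)
    \<comment> \<open>After p^d steps the coordinate 0 becomes p^d times \<open>?y\<close>, which is
      the same vertex. The compensating unipotent entry, minus the reduction of \<open>?y\<close>,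
      is \<open>c\<close> modulo \<open>p\<close> and hence nonzero.\<close>
    let ?y = "- of_int c * (1 + ?p * of_int z) :: 'p padic_int"
    have t: "th (CARD('p) ^ d) 0 = 0 + ?p ^ d * ?y"
      unfolding th_def z by (simp add: algebra_simps)
    have ry: "- red ?y = of_int c"
      using char of_nat_CHAR[where 'a = 'f] by (simp add: red.hom_mult red.hom_add red.hom_uminus red.hom_of_int red.hom_of_nat)
    have cnz: "of_int c \<noteq> (0::'f)"
    proof
      assume "of_int c = (0::'f)"
      then have "int CARD('p) dvd c" using char of_int_eq_0_iff_char_dvd[of c, where 'a = 'f] by simp
      then show False using c by simp
    qed
    define K where "K = {v. br_atom g d 0 v \<in> N}"
    have "v - [:[:top_coeff v:]:] * Ypow \<in> K"
    proof (rule unipotent_coinvariants[OF _ _ _ cnz _ v])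
      fix u :: "'f poly poly" assume u: "u \<in> Sym r"
      have "br_atom g d (th (CARD('p) ^ d) 0) u = br_atom g d 0 (Sym_act (mat2 1 (of_int c) 0 1) u)"
        unfolding t br_atom_shift[OF g] ry ..
      then show "Sym_act (mat2 1 (of_int c) 0 1) u - u \<in> K"
        using iter[OF u, of "CARD('p) ^ d" 0] by (simp add: K_def br_atom_linear[OF g])
    qed (auto simp: K_def br_atom_linear[OF g] subsp_D[OF N] simp del: mult_pCons_left)
    then show ?thesis by (simp add: K_def br_atom_linear[OF g] del: mult_pCons_left)
  qed
  obtain m where "?p ^ d dvd th m x" using affine_orbit_zero[OF a c] unfolding th_def by blast
  then obtain y where y: "th m x = ?p ^ d * y" by blast
  \<comment> \<open>The compensating element is upper triangular with last entry 1, so the value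
    transported to coordinate 0 keeps its top coefficient.\<close>
  let ?v = "Sym_act (mat2 1 (- red y) 0 1) w"
  have v: "?v \<in> Sym r" "top_coeff ?v = top_coeff w" using w by (simp_all add: Sym_act_closed top_coeff_upper)
  have "br_atom g d (th m x) w = br_atom g d 0 ?v" using br_atom_shift[OF g, of d 0 y w] y by simp
  then have "br_atom g d 0 ?v - br_atom g d x w \<in> N" using iter[OF w, of m x] by simp
  then have "br_atom g d x w - br_atom g d 0 ?v \<in> N" using subsp_D(4)[OF N] minus_diff_eq by metis
  then show ?thesis using fix0[OF v(1)] unfolding v(2) by (rule subsp_trans[OF N])
qed

text \<open>In characteristic \<open>p\<close> the \<open>p\<close> equal contributions of the outward part of \<open>T\<close> cancel.\<close>

lemma T_outward_coinvariants:
  assumes N: "subsp N" and g: "invertible g" and w: "w \<in> Sym r"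
    and co: "\<And>x w. w \<in> Sym r \<Longrightarrow> br_atom g d x w - scale (top_coeff w) (br_atom g d 0 Ypow) \<in> N"
  shows "(\<Sum>i<CARD('p). br_atom g d (x i) (Sym_act (mat2 1 (- of_nat i) 0 0) w)) \<in> N"
proof -
  let ?v = "\<lambda>i. Sym_act (mat2 1 (- of_nat i) 0 0) w"
  \<comment> \<open>For r > 0 every term has top coefficient 0. For r = 0 the factor
    \<open>0 ^ r\<close> is 1, and the cancellation of \<open>p\<close> equal terms does the
    work.\<close>
  have v: "?v i \<in> Sym r" "top_coeff (?v i) = 0 ^ r * top_coeff w" for i using w by (simp_all add: Sym_act_closed top_coeff_upper)
  have "(\<Sum>i<CARD('p). br_atom g d (x i) (?v i) - scale (0 ^ r * top_coeff w) (br_atom g d 0 Ypow)) \<in> N"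
    using co[OF v(1)] v(2) by (intro subsp_sum[OF N]) auto
  then have "(\<Sum>i<CARD('p). br_atom g d (x i) (?v i)) - (\<Sum>i<CARD('p). scale (0 ^ r * top_coeff w) (br_atom g d 0 Ypow)) \<in> N"
    by (simp add: sum_subtractf)
  moreover have "(\<Sum>i<CARD('p). scale (0 ^ r * top_coeff w) (br_atom g d 0 Ypow)) = 0"
  proof (rule ext)
    fix y
    have "of_nat CARD('p) = (0 :: 'f poly poly)" using char of_nat_CHAR[where 'a = 'f] by (simp add: of_nat_poly)
    then show "(\<Sum>i<CARD('p). scale (0 ^ r * top_coeff w) (br_atom g d 0 Ypow)) y = 0 y"
      by (simp only: sum_fun_apply sum_constant card_lessThan) simp
  qed
  ultimately show ?thesis by simp
qed

end

section \<open>Position relative to the standard apartment\<close>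

text \<open>Membership in p^m times the p-adic integers, for any integer \<open>m\<close>. A
  predicate replaces the valuation so that 0 needs no special value.\<close>

definition pdiv :: "int \<Rightarrow> 'p::prime_card padic \<Rightarrow> bool" where
  "pdiv m x \<longleftrightarrow> (\<exists>y. x = pp powi m * to_fract y)"

lemma pdiv_add: "pdiv m x \<Longrightarrow> pdiv m y \<Longrightarrow> pdiv m (x + y)"
  unfolding pdiv_def by (metis distrib_left to_fract_add)

lemma pdiv_mult: "pdiv m x \<Longrightarrow> pdiv m (to_fract z * x)"
  unfolding pdiv_def by (metis mult.left_commute to_fract_mult)

lemma pdiv_diff: "pdiv m x \<Longrightarrow> pdiv m y \<Longrightarrow> pdiv m (x - y)"
  unfolding pdiv_def by (metis right_diff_distrib to_fract_diff)

lemma pdiv_lin: "pdiv m x \<Longrightarrow> pdiv m y \<Longrightarrow> pdiv m (to_fract e * x + to_fract f * y)"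
  by (intro pdiv_add pdiv_mult)

lemma pdiv_scale: "pdiv m (pp powi k * x) \<longleftrightarrow> pdiv (m - k) x"
proof -
  have e: "pp powi m = pp powi k * (pp powi (m - k) :: 'a padic)" by (simp flip: power_int_add)
  show ?thesis unfolding pdiv_def e by (simp add: mult.assoc)
qed

lemma pdiv_integral: "pdiv 0 (to_fract z)"
  unfolding pdiv_def by auto

lemma pdiv_zero: "pdiv m 0"
  unfolding pdiv_def by (metis mult_zero_right to_fract_0)

lemma pdiv_unit:
  assumes "u dvd 1" shows "pdiv m (to_fract (u :: 'p::prime_card padic_int)) \<longleftrightarrow> m \<le> 0"
proof
  assume "pdiv m (to_fract u)"
  then obtain y where y: "to_fract u = pp powi m * to_fract y" by (auto simp: pdiv_def)
  show "m \<le> 0"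
  proof (rule ccontr)
    assume "\<not> m \<le> 0"
    then obtain k where k: "m = int (Suc k)" by (metis gr0_implies_Suc not_le pos_int_cases)
    have "to_fract u = to_fract (of_nat CARD('p) * (of_nat CARD('p) ^ k * y))"
      unfolding y k power_int_of_nat by (simp add: to_fract_power mult.assoc)
    then have "u = of_nat CARD('p) * (of_nat CARD('p) ^ k * y)" by (simp only: to_fract_eq_iff)
    then have "of_nat CARD('p) dvd (1 :: 'p padic_int)" using assms by (metis dvd_mult_left)
    then show False using p_not_unit by blast
  qed
next
  assume "m \<le> 0"
  then obtain k where k: "m = - int k" by (metis nonpos_int_cases)
  have "to_fract u = pp powi m * to_fract (of_nat CARD('p) ^ k * u)"
    by (simp add: k to_fract_power power_int_minus)
  then show "pdiv m (to_fract u)" unfolding pdiv_def by blast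
qed

lemma pdiv_val: "x \<noteq> 0 \<Longrightarrow> \<exists>v. \<forall>m. pdiv m x \<longleftrightarrow> m \<le> v" for x :: "'p::prime_card padic"
proof -
  assume "x \<noteq> 0"
  then obtain v u where "u dvd 1" "x = pp powi v * to_fract u" using padic_field_decomp by blast
  then have "pdiv m x \<longleftrightarrow> m \<le> v" for m by (simp add: pdiv_scale pdiv_unit)
  then show ?thesis by blast
qed

definition cdiv :: "int \<Rightarrow> 'p::prime_card padic \<Rightarrow> 'p padic \<Rightarrow> bool" where
  "cdiv m x y \<longleftrightarrow> pdiv m x \<and> pdiv m y"

text \<open>The minimum of the valuations, with an arbitrary value if \<open>x = y = 0\<close>.\<close>

definition cval :: "'p::prime_card padic \<Rightarrow> 'p padic \<Rightarrow> int" where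
  "cval x y = (THE v. \<forall>m. cdiv m x y \<longleftrightarrow> m \<le> v)"

lemma cval_eqI: "(\<And>m. cdiv m x y \<longleftrightarrow> m \<le> v) \<Longrightarrow> cval x y = v"
  unfolding cval_def by (rule the_equality) (auto intro: order_antisym)

lemma cdiv_iff: assumes "x \<noteq> 0 \<or> y \<noteq> 0" shows "cdiv m x y \<longleftrightarrow> m \<le> cval x y"
proof -
  have "\<exists>v. \<forall>m. cdiv m x y \<longleftrightarrow> m \<le> v"
  proof (cases "x = 0 \<or> y = 0")
    case True
    then show ?thesis using assms pdiv_val unfolding cdiv_def by (metis pdiv_zero)
  next
    case False
    then obtain v w where "\<forall>m. pdiv m x \<longleftrightarrow> m \<le> v" "\<forall>m. pdiv m y \<longleftrightarrow> m \<le> w" using pdiv_val by metis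
    then have "\<forall>m. cdiv m x y \<longleftrightarrow> m \<le> min v w" by (auto simp: cdiv_def)
    then show ?thesis by blast
  qed
  then show ?thesis using cval_eqI by metis
qed

text \<open>The difference of the valuations of the two columns locates the projection of the vertex
  \<open>KZ g\<close> to the standard apartment.\<close>

definition apartment_pos :: "'p::prime_card padic ^ 2 ^ 2 \<Rightarrow> int" where
  "apartment_pos g = cval (g $ 1 $ 1) (g $ 2 $ 1) - cval (g $ 1 $ 2) (g $ 2 $ 2)"

lemma cols_nonzero:
  assumes "invertible (g :: 'p::prime_card padic ^ 2 ^ 2)"
  shows "g $ 1 $ 1 \<noteq> 0 \<or> g $ 2 $ 1 \<noteq> 0" "g $ 1 $ 2 \<noteq> 0 \<or> g $ 2 $ 2 \<noteq> 0"
  using assms by (auto simp: invertible_iff_det_unit det_2)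

text \<open>The inverse of \<open>A\<close> is integral too and expresses the old column through the
  new one, so both are divisible by the same powers of \<open>p\<close>, up to the scalar p^m. That
  shift is common to the two columns of a matrix and cancels in
  \<open>apartment_pos\<close>.\<close>

lemma cval_act:
  fixes A :: "'a::prime_card padic_int ^ 2 ^ 2"
  assumes A: "invertible A" and nz: "x \<noteq> 0 \<or> y \<noteq> 0" and "x' = pp powi m * (to_fract (A $ 1 $ 1) * x + to_fract (A $ 1 $ 2) * y)"
    "y' = pp powi m * (to_fract (A $ 2 $ 1) * x + to_fract (A $ 2 $ 2) * y)"
  shows "cval x' y' = cval x y + m"
proof (rule cval_eqI)
  fix s
  let ?a = "to_fract (A $ 1 $ 1)" and ?b = "to_fract (A $ 1 $ 2)" and ?c = "to_fract (A $ 2 $ 1)" and ?d = "to_fract (A $ 2 $ 2)"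
  obtain B :: "'a padic_int ^ 2 ^ 2" where B: "A ** B = mat 1" "B ** A = mat 1" using A unfolding invertible_def by blast
  obtain e f g h where Bm: "B = mat2 e f g h" by (rule mat2_cases)
  have i: "e * A $ 1 $ 1 + f * A $ 2 $ 1 = 1" "e * A $ 1 $ 2 + f * A $ 2 $ 2 = 0"
     "g * A $ 1 $ 1 + h * A $ 2 $ 1 = 0" "g * A $ 1 $ 2 + h * A $ 2 $ 2 = 1"
    using B(2) unfolding Bm by (subst (asm) mat2_eta[of A, symmetric], simp add: mat_mat2)+
  have i': "to_fract e * ?a + to_fract f * ?c = 1" "to_fract e * ?b + to_fract f * ?d = 0"
     "to_fract g * ?a + to_fract h * ?c = 0" "to_fract g * ?b + to_fract h * ?d = 1"
    unfolding to_fract_mult[symmetric] to_fract_add[symmetric] i by simp_all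
  have x: "x = to_fract e * (?a * x + ?b * y) + to_fract f * (?c * x + ?d * y)"
  proof -
    have "to_fract e * (?a * x + ?b * y) + to_fract f * (?c * x + ?d * y) =
      (to_fract e * ?a + to_fract f * ?c) * x + (to_fract e * ?b + to_fract f * ?d) * y" by (simp add: algebra_simps)
    then show ?thesis unfolding i' by simp
  qed
  have y: "y = to_fract g * (?a * x + ?b * y) + to_fract h * (?c * x + ?d * y)"
  proof -
    have "to_fract g * (?a * x + ?b * y) + to_fract h * (?c * x + ?d * y) =
      (to_fract g * ?a + to_fract h * ?c) * x + (to_fract g * ?b + to_fract h * ?d) * y" by (simp add: algebra_simps)
    then show ?thesis unfolding i' by simp
  qed
  have "cdiv s x' y' \<longleftrightarrow> cdiv (s - m) (?a * x + ?b * y) (?c * x + ?d * y)"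
    by (simp add: cdiv_def assms pdiv_scale)
  also have "\<dots> \<longleftrightarrow> cdiv (s - m) x y"
  proof
    assume c: "cdiv (s - m) (?a * x + ?b * y) (?c * x + ?d * y)"
    then have "pdiv (s - m) (to_fract e * (?a * x + ?b * y) + to_fract f * (?c * x + ?d * y))"
      "pdiv (s - m) (to_fract g * (?a * x + ?b * y) + to_fract h * (?c * x + ?d * y))"
      unfolding cdiv_def by (simp_all only: pdiv_lin)
    then show "cdiv (s - m) x y" unfolding cdiv_def x[symmetric] y[symmetric] by blast
  next
    assume "cdiv (s - m) x y"
    then show "cdiv (s - m) (?a * x + ?b * y) (?c * x + ?d * y)"
      unfolding cdiv_def by (simp only: pdiv_lin)
  qed
  also have "\<dots> \<longleftrightarrow> s - m \<le> cval x y" by (rule cdiv_iff[OF nz])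
  finally show "cdiv s x' y' \<longleftrightarrow> s \<le> cval x y + m" by (simp only: diff_le_eq)
qed

lemma apartment_pos_KZ:
  assumes "k \<in> KZ" "invertible (g :: 'p::prime_card padic ^ 2 ^ 2)"
  shows "apartment_pos (k ** g) = apartment_pos g"
proof -
  obtain m A where A: "invertible A" "k = mat (pp powi m) ** padic_mat A" using assms KZ_iff by blast
  have k: "k ** g = mat (pp powi m) ** (padic_mat A ** g)" by (simp add: A matrix_mul_assoc)
  have "(k ** g) $ i $ j = pp powi m * (to_fract (A $ i $ 1) * g $ 1 $ j + to_fract (A $ i $ 2) * g $ 2 $ j)" for i j
    unfolding k scalar_mat_nth by (simp add: matrix_matrix_mult_def sum_2)
  then have "cval ((k ** g) $ 1 $ j) ((k ** g) $ 2 $ j) = cval (g $ 1 $ j) (g $ 2 $ j) + m"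
    if "g $ 1 $ j \<noteq> 0 \<or> g $ 2 $ j \<noteq> 0" for j
    using that by (intro cval_act[OF A(1)])
  then show ?thesis using cols_nonzero[OF assms(2)] by (simp add: apartment_pos_def)
qed

lemma cval_powi_0: "cval (pp powi m) (0 :: 'p::prime_card padic) = m"
proof (rule cval_eqI)
  fix s
  show "cdiv s (pp powi m) (0 :: 'p padic) \<longleftrightarrow> s \<le> m"
    using pdiv_scale[of s m "1 :: 'p padic"] pdiv_unit[of "1 :: 'p padic_int" "s - m"] by (simp add: cdiv_def pdiv_zero)
qed

lemma cval_primitive:
  assumes "x dvd 1 \<or> y dvd (1 :: 'p::prime_card padic_int)" shows "cval (to_fract x) (to_fract y) = 0"
proof (rule cval_eqI)
  fix s
  have "pdiv s (to_fract z)" if "s \<le> 0" for z :: "'p padic_int"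
    using pdiv_mult[of s "to_fract 1" z] pdiv_unit[of 1 s] that by simp
  then show "cdiv s (to_fract x) (to_fract y) \<longleftrightarrow> s \<le> 0"
    using assms pdiv_unit by (auto simp: cdiv_def)
qed

lemma cval_integral:
  assumes "x \<noteq> 0 \<or> y \<noteq> (0 :: 'p::prime_card padic_int)" shows "cval (to_fract x) (to_fract y) \<ge> 0"
  using cdiv_iff[of "to_fract x" "to_fract y" 0] assms by (simp add: cdiv_def pdiv_integral)

context gl2
begin

lemma apartment_pos_swap: "apartment_pos (g ** mat2 0 1 1 0) = - apartment_pos g" for g :: "'p pmat"
  by (cases g rule: mat2_cases) (simp add: apartment_pos_def)

section \<open>Normal forms of vertices\<close>

lemma primitive_col:
  assumes "x \<noteq> 0 \<or> y \<noteq> (0 :: 'p padic)"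
  obtains a b :: "'p padic_int" where "x = pp powi cval x y * to_fract a" "y = pp powi cval x y * to_fract b" "a dvd 1 \<or> b dvd 1"
proof -
  let ?v = "cval x y"
  have "cdiv ?v x y" using cdiv_iff[OF assms] by simp
  then obtain a b where ab: "x = pp powi ?v * to_fract a" "y = pp powi ?v * to_fract b" by (auto simp: cdiv_def pdiv_def)
  have "a dvd 1 \<or> b dvd 1"
  proof (rule ccontr)
    assume n: "\<not> (a dvd 1 \<or> b dvd 1)"
    then have "Rep_padic_int a 1 = 0" "Rep_padic_int b 1 = 0" using padic_unit by blast+
    then obtain a' b' where "a = of_nat CARD('p) * a'" "b = of_nat CARD('p) * b'" using padic_p_dvd by metis
    then have "x = pp powi (?v + 1) * to_fract a'" "y = pp powi (?v + 1) * to_fract b'"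
      using ab by (simp_all add: power_int_add mult.assoc)
    then have "cdiv (?v + 1) x y" unfolding cdiv_def pdiv_def by blast
    then show False using cdiv_iff[OF assms] by simp
  qed
  then show ?thesis using that ab by blast
qed

text \<open>Elimination keeps the second column primitive: if \<open>p\<close> divided both new
  entries, it would divide \<open>b\<close> and then also \<open>e\<close>.\<close>

lemma unit_shear:
  fixes b c e z :: "'p padic_int"
  assumes "z dvd 1" "b dvd 1 \<or> e dvd 1"
  shows "z * b dvd 1 \<or> e - c * z * b dvd 1"
proof (rule disjCI)
  assume nu: "\<not> e - c * z * b dvd 1"
  show "z * b dvd 1"
  proof (cases "b dvd 1")
    case False
    then obtain b' where b': "b = of_nat CARD('p) * b'" using padic_unit padic_p_dvd by blast
    obtain y where "e - c * z * b = of_nat CARD('p) * y" using nu padic_unit padic_p_dvd by blast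
    then have "e = of_nat CARD('p) * (y + c * z * b')" by (simp add: b' algebra_simps)
    moreover have "\<not> of_nat CARD('p) dvd e" using assms(2) False p_not_unit dvd_trans by blast
    ultimately show ?thesis by simp
  qed (use assms in \<open>simp add: is_unit_mult_iff\<close>)
qed

text \<open>Geometrically \<open>m\<close> is the projection of the vertex to the apartment and
  \<open>d\<close> its distance from the apartment; for d > 0 the unit \<open>x\<close> records how
  the connecting path leaves the apartment.\<close>

lemma hermite_normal_form:
  assumes "invertible (g :: 'p pmat)"
  obtains m d and x :: "'p padic_int" where "g \<in> orb (mat2 (pp powi m) (to_fract x) 0 (pp ^ d))"
    "x dvd 1 \<or> d = 0" "m = apartment_pos g"
proof -
  define v1 v2 where v: "v1 = cval (g $ 1 $ 1) (g $ 2 $ 1)" "v2 = cval (g $ 1 $ 2) (g $ 2 $ 2)"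
  obtain a c where ac: "g $ 1 $ 1 = pp powi v1 * to_fract a" "g $ 2 $ 1 = pp powi v1 * to_fract c" "a dvd 1 \<or> c dvd 1"
    using cols_nonzero(1)[OF assms] primitive_col v by metis
  obtain b e where be: "g $ 1 $ 2 = pp powi v2 * to_fract b" "g $ 2 $ 2 = pp powi v2 * to_fract e" "b dvd 1 \<or> e dvd 1"
    using cols_nonzero(2)[OF assms] primitive_col v by metis
  have pw: "pp powi v1 = pp powi v2 * (pp powi apartment_pos g :: 'p padic)" by (simp add: apartment_pos_def v flip: power_int_add)
  have g: "g = mat2 (pp powi v2) 0 0 (pp powi v2) ** mat2 (pp powi apartment_pos g * to_fract a) (to_fract b) (pp powi apartment_pos g * to_fract c) (to_fract e)"
    using ac be unfolding pw by (simp add: vec_eq_iff forall_2 mult.assoc)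
  obtain k b' e' where k: "k \<in> KZ" and k': "mat2 (pp powi apartment_pos g * to_fract a) (to_fract b) (pp powi apartment_pos g * to_fract c) (to_fract e)
      = k ** mat2 (pp powi apartment_pos g) (to_fract b') 0 (to_fract e')" and be': "b' dvd 1 \<or> e' dvd 1"
  \<comment> \<open>One entry of the primitive first column is a unit and serves as pivot.\<close>
  proof (cases "a dvd 1")
    case True
    then obtain z where z: "a * z = 1" by (auto simp: dvd_def)
    let ?e = "e - c * z * b"
    have "mat2 (to_fract a) (to_fract 0) (to_fract c) (to_fract 1) \<in> (KZ :: ('p pmat) set)"
      by (rule KZ_mat2) (use True in simp)
    moreover have "to_fract a * to_fract z = (1 :: 'p padic)" using z by (metis to_fract_1 to_fract_mult)
    then have "mat2 (pp powi apartment_pos g * to_fract a) (to_fract b) (pp powi apartment_pos g * to_fract c) (to_fract e) =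
      mat2 (to_fract a) (to_fract 0) (to_fract c) (to_fract 1) ** mat2 (pp powi apartment_pos g) (to_fract (z * b)) 0 (to_fract (e - c * z * b))"
      by (simp add: algebra_simps)
    moreover have "z dvd 1" using z by (metis dvd_triv_right)
    then have "z * b dvd 1 \<or> e - c * z * b dvd 1" using be(3) by (rule unit_shear)
    ultimately show ?thesis using that by blast
  next
    case False
    then have "c dvd 1" using ac by simp
    then obtain z where z: "c * z = 1" by (auto simp: dvd_def)
    have "mat2 (to_fract a) (to_fract 1) (to_fract c) (to_fract 0) \<in> (KZ :: ('p pmat) set)"
      by (rule KZ_mat2) (use \<open>c dvd 1\<close> in simp)
    moreover have "to_fract c * to_fract z = (1 :: 'p padic)" using z by (metis to_fract_1 to_fract_mult)
    then have "mat2 (pp powi apartment_pos g * to_fract a) (to_fract b) (pp powi apartment_pos g * to_fract c) (to_fract e) =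
      mat2 (to_fract a) (to_fract 1) (to_fract c) (to_fract 0) ** mat2 (pp powi apartment_pos g) (to_fract (z * e)) 0 (to_fract (b - a * z * e))"
      by (simp add: algebra_simps)
    moreover have "z dvd 1" using z by (metis dvd_triv_right)
    then have "z * e dvd 1 \<or> b - a * z * e dvd 1" using be(3) by (intro unit_shear) auto
    ultimately show ?thesis using that by blast
  qed
  have g2: "g = (mat2 (pp powi v2) 0 0 (pp powi v2) ** k) ** mat2 (pp powi apartment_pos g) (to_fract b') 0 (to_fract e')"
    by (subst g, subst k') (simp add: matrix_mul_assoc)
  have "e' \<noteq> 0"
  proof
    assume "e' = 0"
    then have "det g = 0" by (subst g2) (simp add: det_mul)
    then show False using assms by (simp add: invertible_iff_det_unit)
  qed
  \<comment> \<open>The power of \<open>p\<close> in \<open>e'\<close> becomes the depth; its unit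
    part is moved into KZ.\<close>
  then obtain d u where u: "u dvd 1" "e' = of_nat CARD('p) ^ d * u" using padic_decomp by blast
  let ?l = "mat2 (to_fract 1) (to_fract 0) (to_fract 0) (to_fract u) :: 'p pmat"
  have "?l \<in> KZ" by (rule KZ_mat2) (use u in simp)
  then have "(mat2 (pp powi v2) 0 0 (pp powi v2) ** k) ** ?l \<in> KZ" using k by (intro KZ_mult KZ_scalar_mat2) auto
  moreover have "mat2 (pp powi apartment_pos g) (to_fract b') 0 (to_fract e') = ?l ** mat2 (pp powi apartment_pos g) (to_fract b') 0 (pp ^ d)"
    by (simp add: u to_fract_power mult.commute)
  then have "g = ((mat2 (pp powi v2) 0 0 (pp powi v2) ** k) ** ?l) ** mat2 (pp powi apartment_pos g) (to_fract b') 0 (pp ^ d)"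
    using g2 by (simp only: matrix_mul_assoc)
  ultimately have "g \<in> orb (mat2 (pp powi apartment_pos g) (to_fract b') 0 (pp ^ d))" using orb_I by metis
  moreover have "b' dvd 1 \<or> d = 0"
  proof (cases d)
    case (Suc l)
    have "\<not> e' dvd 1" unfolding u Suc using p_not_unit by (auto simp: is_unit_mult_iff)
    then show ?thesis using be' by simp
  qed simp
  ultimately show ?thesis using that by blast
qed

end

section \<open>Three regions of the tree and an element of T_1(p^n) for each\<close>

locale gl2_level = gl2 ptype r lam
  for ptype :: "'p::prime_card itself" and r :: nat and lam :: "'f::{field,finite}" +
  fixes n :: nat
  assumes n_pos: "n \<ge> 1"
begin

text \<open>Regions \<open>1\<close> and \<open>2\<close> are the two ends of the tree beyond the path, region \<open>0\<close> is the rest.\<close>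

definition region :: "'p pmat \<Rightarrow> nat" where
  "region g = (if apartment_pos g \<le> - int n then 1 else if apartment_pos g \<ge> int n then 2 else 0)"

text \<open>Each element fixes the path vertices of its region and maps every branch there to
  itself. The entry p^n has the least valuation that T_1(p^n) allows and becomes a unit translation
  in the coordinates at the end vertex.\<close>

definition shifter :: "nat \<Rightarrow> 'p pmat" where
  "shifter c = (if c = 1 then mat2 1 (pp ^ n) 0 1 else if c = 2 then mat2 1 0 (pp ^ n) 1 else mat2 (1 + pp) 0 0 1)"

lemma region_cases: "region g \<in> {0, 1, 2}"
  by (simp add: region_def)

lemma unit_1p: "(1 + of_nat CARD('p) :: 'p padic_int) dvd 1"
proof -
  have "\<not> of_nat CARD('p) dvd (1 + of_nat CARD('p) :: 'p padic_int)"
    using p_not_unit by (metis dvd_add_left_iff dvd_refl)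
  then show ?thesis by (rule unit_if_not_p_dvd)
qed

lemma one_plus_p_nonzero: "1 + pp \<noteq> (0 :: 'p padic)"
proof -
  have "(1 + of_nat CARD('p) :: 'p padic_int) \<noteq> 0" using unit_1p by auto
  then have "to_fract (1 + of_nat CARD('p) :: 'p padic_int) \<noteq> to_fract 0" by (simp only: to_fract_eq_iff) simp
  then show ?thesis by simp
qed

lemma shifter_inv [simp]: "invertible (shifter c)"
  using one_plus_p_nonzero by (simp add: shifter_def invertible_iff_det_unit dvd_field_iff)

lemma shifter_T1: "shifter c \<in> T1 n"
proof -
  let ?p = "of_nat CARD('p) :: 'p padic_int"
  have "shifter c = padic_mat (if c = 1 then mat2 1 (?p ^ n) 0 1 else if c = 2 then mat2 1 0 (?p ^ n) 1 else mat2 (1 + ?p) 0 0 1)"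
    by (simp add: shifter_def to_fract_power)
  then show ?thesis unfolding T1_def by (auto simp: shifter_def)
qed

text \<open>For n >= 1 such a matrix is the identity modulo \<open>p\<close>, so its determinant is
  a unit.\<close>

lemma T1_KZ: "(h :: 'p pmat) \<in> T1 n \<Longrightarrow> h \<in> KZ"
proof -
  assume "h \<in> T1 n"
  then obtain A :: "'p padic_int ^ 2 ^ 2" where A: "h = padic_mat A" "of_nat CARD('p) dvd A $ 1 $ 1 - 1" "of_nat CARD('p) ^ n dvd A $ 1 $ 2"
    "of_nat CARD('p) ^ n dvd A $ 2 $ 1" "of_nat CARD('p) dvd A $ 2 $ 2 - 1" by (auto simp: T1_def)
  let ?p = "of_nat CARD('p) :: 'p padic_int"
  have "?p dvd ?p ^ n" using n_pos by (simp add: dvd_power)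
  then have "?p dvd A $ 1 $ 2" using A dvd_trans by blast
  obtain a d where ad: "A $ 1 $ 1 = 1 + ?p * a" "A $ 2 $ 2 = 1 + ?p * d" using A by (metis add.commute diff_add_cancel dvdE)
  obtain b where b: "A $ 1 $ 2 = ?p * b" using \<open>?p dvd A $ 1 $ 2\<close> by blast
  have "det A = 1 + ?p * (a + d + ?p * a * d - b * A $ 2 $ 1)"
    by (simp add: det_2 ad b algebra_simps)
  then have "\<not> ?p dvd det A" using p_not_unit[where 'p = 'p] by (metis dvd_add_left_iff dvd_triv_left)
  then have "det A dvd 1" by (rule unit_if_not_p_dvd)
  then have "invertible A" by (simp add: invertible_iff_det_unit)
  then show "h \<in> KZ" using KZ_I[of A 0] by (simp add: A mat_mat2) (metis mat_mat2 matrix_mul_lid)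
qed

lemma region_orb: "g \<in> orb h \<Longrightarrow> invertible h \<Longrightarrow> region g = region h"
  by (auto simp: region_def orb_def apartment_pos_KZ)

text \<open>The added column is itself divisible by p to the power \<open>cval x y + int n\<close>,
  so it cannot affect this threshold, although it may change the valuation beyond it. This is why
  the end regions begin at distance \<open>n\<close>.\<close>

lemma cval_shear:
  assumes "x \<noteq> 0 \<or> y \<noteq> (0 :: 'p padic)" "z \<noteq> 0 \<or> w \<noteq> (0 :: 'p padic)" "z + pp ^ n * x \<noteq> 0 \<or> w + pp ^ n * y \<noteq> 0"
  shows "cval (z + pp ^ n * x) (w + pp ^ n * y) \<ge> cval x y + int n \<longleftrightarrow> cval z w \<ge> cval x y + int n"
proof -
  let ?m = "cval x y + int n"
  have c: "cdiv ?m (pp ^ n * x) (pp ^ n * y)"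
    using cdiv_iff[OF assms(1), of "cval x y"] pdiv_scale[of ?m "int n"] by (auto simp: cdiv_def)
  have "cdiv ?m (z + pp ^ n * x) (w + pp ^ n * y) \<longleftrightarrow> cdiv ?m z w"
    using c pdiv_add pdiv_diff unfolding cdiv_def by (metis add_diff_cancel_right')
  then show ?thesis using cdiv_iff[OF assms(2)] cdiv_iff[OF assms(3)] by simp
qed

text \<open>Scaling the first column by a unit changes no valuation, and each shear preserves the
  inequality that defines its own region.\<close>

lemma region_shifter:
  assumes g: "invertible g" and c: "c \<in> {0, 1, 2}"
  shows "region (g ** shifter c) = c \<longleftrightarrow> region g = c"
proof -
  obtain x z y w where gx: "g = mat2 x z y w" by (rule mat2_cases)
  note nz = cols_nonzero[OF g, unfolded gx mat2_nth]
  have "invertible (g ** shifter c)" using g by (simp add: invertible_mult)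
  note nz' = cols_nonzero[OF this]
  have l: "(region h = 1) = (apartment_pos h \<le> - int n)" "(region h = 2) = (apartment_pos h \<ge> int n)" for h
    using n_pos by (auto simp: region_def)
  consider "c = 0" | "c = 1" | "c = 2" using c by blast
  then show ?thesis
  proof cases
    case 1
    have "cval (x * (1 + pp)) (y * (1 + pp)) = cval x y + 0"
    proof (rule cval_act[of "mat (1 + of_nat CARD('p))"])
      show "invertible (mat (1 + of_nat CARD('p)) :: 'p padic_int ^ 2 ^ 2)"
        using unit_1p by (simp add: invertible_iff_det_unit mat_mat2 is_unit_mult_iff)
    qed (use nz in \<open>simp_all add: mat_mat2 mult.commute\<close>)
    then have "apartment_pos (g ** shifter c) = apartment_pos g" using 1 by (simp add: gx shifter_def apartment_pos_def)
    then show ?thesis by (simp add: region_def)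
  next
    case 2
    have "cval (z + pp ^ n * x) (w + pp ^ n * y) \<ge> cval x y + int n \<longleftrightarrow> cval z w \<ge> cval x y + int n"
      by (rule cval_shear) (use nz nz' 2 in \<open>simp_all add: gx shifter_def algebra_simps\<close>)
    moreover have "g ** shifter c = mat2 x (z + pp ^ n * x) y (w + pp ^ n * y)" using 2 by (simp add: gx shifter_def algebra_simps)
    ultimately show ?thesis unfolding 2 l by (simp add: apartment_pos_def gx) linarith
  next
    case 3
    have "cval (x + pp ^ n * z) (y + pp ^ n * w) \<ge> cval z w + int n \<longleftrightarrow> cval x y \<ge> cval z w + int n"
      by (rule cval_shear) (use nz nz' 3 in \<open>simp_all add: gx shifter_def algebra_simps\<close>)
    moreover have "g ** shifter c = mat2 (x + pp ^ n * z) z (y + pp ^ n * w) w" using 3 by (simp add: gx shifter_def algebra_simps)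
    ultimately show ?thesis unfolding 3 l by (simp add: apartment_pos_def gx) linarith
  qed
qed

section \<open>The path and the branches hanging off it\<close>

definition path_vertex :: "int \<Rightarrow> 'p pmat" where
  "path_vertex j = mat2 (pp powi j) 0 0 1"

definition path :: "('p pmat) set" where
  "path = (\<Union>j\<in>{- int n..int n}. orb (path_vertex j))"

text \<open>The components of the complement of the path, one for each inner vertex \<open>j\<close> and each of the
  remaining \<open>p - 1\<close> directions \<open>i\<close>, and one at each end (coded by \<open>i = 0\<close>).\<close>

definition branches :: "(int \<times> nat) set" where
  "branches = {(- int n, 0), (int n, 0)} \<union> {- int n<..<int n} \<times> {1..<CARD('p)}"

text \<open>For an inner branch this is the neighbour of the path vertex \<open>fst b\<close> in
  direction \<open>snd b\<close>. At an end it is the end vertex itself, so depth 0 still lies on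
  the path there; at the right end the columns are swapped, which turns the lower unipotent
  \<open>shifter\<close> into an upper unipotent matrix on the left.\<close>

definition br_root :: "int \<times> nat \<Rightarrow> 'p pmat" where
  "br_root b = (if snd b \<noteq> 0 then mat2 (pp powi fst b) (of_nat (snd b)) 0 pp
     else if fst b < 0 then mat2 (pp powi fst b) 0 0 1 else mat2 0 (pp powi (- fst b)) 1 0)"

definition branch_region :: "int \<times> nat \<Rightarrow> nat" where
  "branch_region b = (if snd b \<noteq> 0 then 0 else if fst b < 0 then 1 else 2)"

definition branch_mult :: "int \<times> nat \<Rightarrow> int" where "branch_mult b = (if snd b \<noteq> 0 then 1 + int CARD('p) else 1)"

text \<open>On an inner branch the coordinate i + p x, with i = \<open>snd b\<close>, is multiplied
  by 1 + p, so that \<open>x\<close> goes to (1 + p) x + i. In the convention x -> a x - c the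
  offset is therefore -i.\<close>

definition branch_offset :: "int \<times> nat \<Rightarrow> int" where "branch_offset b = (if snd b \<noteq> 0 then - int (snd b) else 1)"

lemma branches_cases:
  assumes "b \<in> branches"
  obtains "b = (- int n, 0)" | "b = (int n, 0)" | j i where "b = (j, i)" "- int n < j" "j < int n" "1 \<le> i" "i < CARD('p)"
  using assms by (auto simp: branches_def)

lemma path_vertex_inv [simp]: "invertible (path_vertex j)"
  by (simp add: path_vertex_def invertible_iff_det_unit dvd_field_iff)

lemma br_root_inv [simp]: "invertible (br_root b)"
  by (simp add: br_root_def invertible_iff_det_unit dvd_field_iff)

lemma branch_mult_cong: "[branch_mult b = 1] (mod int CARD('p))"
  by (simp add: branch_mult_def cong_def)

lemma branch_offset_ndvd: "b \<in> branches \<Longrightarrow> \<not> int CARD('p) dvd branch_offset b"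
proof (elim branches_cases)
  fix j i assume "b = (j, i)" "1 \<le> i" "i < CARD('p)"
  then show ?thesis by (auto simp: branch_offset_def dest: dvd_imp_le)
qed (use p_ge in \<open>auto simp: branch_offset_def\<close>)

lemma br_root_shifter: "b \<in> branches \<Longrightarrow> br_root b ** shifter (branch_region b) = mat2 (of_int (branch_mult b)) (of_int (branch_offset b)) 0 1 ** br_root b"
proof (elim branches_cases)
  have pw: "pp powi (- int n) * pp ^ n = (1 :: 'p padic)" by (simp add: power_int_minus)
  then show "b = (- int n, 0) \<Longrightarrow> br_root b ** shifter (branch_region b) = mat2 (of_int (branch_mult b)) (of_int (branch_offset b)) 0 1 ** br_root b"
    "b = (int n, 0) \<Longrightarrow> br_root b ** shifter (branch_region b) = mat2 (of_int (branch_mult b)) (of_int (branch_offset b)) 0 1 ** br_root b"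
    using n_pos by (simp_all add: br_root_def branch_region_def shifter_def branch_mult_def branch_offset_def)
  fix j i assume "b = (j, i)" "1 \<le> i"
  then show "br_root b ** shifter (branch_region b) = mat2 (of_int (branch_mult b)) (of_int (branch_offset b)) 0 1 ** br_root b"
    by (simp add: br_root_def branch_region_def shifter_def branch_mult_def branch_offset_def algebra_simps)
qed

lemma br_root_tri:
  "snd b \<noteq> 0 \<Longrightarrow> mat2 1 (to_fract x) 0 (pp ^ d) ** br_root b = mat2 (pp powi fst b) (to_fract (of_nat (snd b) + of_nat CARD('p) * x)) 0 (pp ^ Suc d)"
  "snd b = 0 \<Longrightarrow> fst b < 0 \<Longrightarrow> mat2 1 (to_fract x) 0 (pp ^ d) ** br_root b = mat2 (pp powi fst b) (to_fract x) 0 (pp ^ d)"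
  "snd b = 0 \<Longrightarrow> \<not> fst b < 0 \<Longrightarrow> mat2 1 (to_fract x) 0 (pp ^ d) ** br_root b = mat2 (to_fract x) (pp powi (- fst b)) (pp ^ d) 0"
  by (simp_all add: br_root_def mult.commute)

lemma nat_digit_unit: "1 \<le> i \<Longrightarrow> i < CARD('p) \<Longrightarrow> (of_nat i + of_nat CARD('p) * x :: 'p padic_int) dvd 1"
proof -
  assume i: "1 \<le> i" "i < CARD('p)"
  have "\<not> int CARD('p) dvd int i" using i by (auto dest: dvd_imp_le)
  then have "\<not> of_nat CARD('p) dvd (of_int (int i) :: 'p padic_int)" unfolding p_dvd_of_int .
  then have "\<not> of_nat CARD('p) dvd (of_nat i + of_nat CARD('p) * x :: 'p padic_int)" by (simp add: dvd_add_left_iff)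
  then show ?thesis by (rule unit_if_not_p_dvd)
qed

lemma pp_pow_nonzero: "(of_nat CARD('p) ^ d :: 'p padic_int) \<noteq> 0"
proof -
  have "to_fract (of_nat CARD('p) ^ d :: 'p padic_int) \<noteq> 0" by (simp add: to_fract_power)
  then show ?thesis by (metis to_fract_0)
qed

lemma cval_pow: "cval (to_fract x) (pp ^ d) \<ge> (0 :: int)" for x :: "'p padic_int"
  using cval_integral[of x "of_nat CARD('p) ^ d"] pp_pow_nonzero by (simp add: to_fract_power)

text \<open>On an inner branch i + p x is a unit, so the second column is primitive and the
  apartment position stays \<open>j\<close>; at an end the position can only move outward.\<close>

lemma region_branch: "b \<in> branches \<Longrightarrow> region (mat2 1 (to_fract x) 0 (pp ^ d) ** br_root b) = branch_region b"
proof (elim branches_cases)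
  assume b: "b = (- int n, 0)"
  then show ?thesis using n_pos cval_pow[of x d]
    by (simp add: br_root_tri branch_region_def region_def apartment_pos_def cval_powi_0)
next
  assume b: "b = (int n, 0)"
  then show ?thesis using n_pos cval_pow[of x d]
    by (simp add: br_root_tri branch_region_def region_def apartment_pos_def cval_powi_0)
next
  fix j i assume b: "b = (j, i)" "- int n < j" "j < int n" "1 \<le> i" "i < CARD('p)"
  have "cval (to_fract (of_nat i + of_nat CARD('p) * x)) (to_fract (of_nat CARD('p) ^ Suc d :: 'p padic_int)) = 0"
    by (rule cval_primitive) (use nat_digit_unit b in blast)
  then have "apartment_pos (mat2 1 (to_fract x) 0 (pp ^ d) ** br_root b) = j"
    using b by (simp add: br_root_tri apartment_pos_def cval_powi_0 to_fract_power del: to_fract_add)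
  then show ?thesis using b by (simp add: branch_region_def region_def)
qed

lemma apartment_pos_path_vertex: "apartment_pos (path_vertex j) = j"
  using cval_primitive[of 0 "1 :: 'p padic_int"] by (simp add: path_vertex_def apartment_pos_def cval_powi_0)

lemma path_vertex_unip: "mat2 (pp powi j) (to_fract x) 0 1 \<in> orb (path_vertex j)"
  using orb_I[OF unip_KZ[of x], of "path_vertex j"] by (simp add: path_vertex_def)

lemma path_vertex_lower: "mat2 (to_fract x) (pp powi (- j)) 1 0 \<in> orb (path_vertex j)"
proof -
  have k1: "mat2 (to_fract x) (to_fract 1) (to_fract 1) (to_fract 0) \<in> (KZ :: ('p pmat) set)"
    by (rule KZ_mat2) simp
  have k2: "mat2 (pp powi (- j)) 0 0 (pp powi (- j)) \<in> (KZ :: ('p pmat) set)" by (rule KZ_scalar_mat2) simp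
  have "pp powi (- j) * pp powi j = (1 :: 'p padic)" by (simp flip: power_int_add)
  then have "(mat2 (to_fract x) (to_fract 1) (to_fract 1) (to_fract 0) ** mat2 (pp powi (- j)) 0 0 (pp powi (- j))) ** path_vertex j
     = mat2 (to_fract x) (pp powi (- j)) 1 0"
    by (simp add: path_vertex_def mult.assoc)
  then show ?thesis using orb_I[OF KZ_mult[OF k1 k2], of "path_vertex j"] by simp
qed

lemma vertex_cases:
  assumes g: "invertible g"
  shows "g \<in> path \<or> (\<exists>b\<in>branches. \<exists>d x. g \<in> orb (mat2 1 (to_fract x) 0 (pp ^ d) ** br_root b))"
proof -
  have left: "\<exists>d x. g \<in> orb (mat2 (pp powi (- int n)) (to_fract x) 0 (pp ^ d))"
    if "apartment_pos g \<le> - int n" "invertible g" for g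
  proof -
    obtain d and x :: "'p padic_int" where x: "g \<in> orb (mat2 (pp powi apartment_pos g) (to_fract x) 0 (pp ^ d))"
      using hermite_normal_form[of g] \<open>invertible g\<close> by metis
    \<comment> \<open>Rescaling by p^k brings the corner entry to p^(-n); the depth grows by
      \<open>k\<close> accordingly.\<close>
    obtain k where k: "- int n = apartment_pos g + int k" using \<open>apartment_pos g \<le> - int n\<close> by (metis zle_iff_zadd)
    let ?s = "mat2 (pp powi (- int k)) 0 0 (pp powi (- int k)) :: 'p pmat"
    have "mat2 (pp powi apartment_pos g) (to_fract x) 0 (pp ^ d) = ?s ** mat2 (pp powi (- int n)) (to_fract (of_nat CARD('p) ^ k * x)) 0 (pp ^ (k + d))"
      unfolding k by (simp add: power_int_add power_int_minus to_fract_power power_add)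
    moreover have "?s \<in> KZ" by (rule KZ_scalar_mat2) simp
    ultimately have "g \<in> orb (mat2 (pp powi (- int n)) (to_fract (of_nat CARD('p) ^ k * x)) 0 (pp ^ (k + d)))"
      using x orb_I orb_eq by metis
    then show ?thesis by blast
  qed
  consider "apartment_pos g \<le> - int n" | "apartment_pos g \<ge> int n" | "- int n < apartment_pos g" "apartment_pos g < int n" by linarith
  then show ?thesis
  proof cases
    case 1
    then obtain d x where "g \<in> orb (mat2 (pp powi (- int n)) (to_fract x) 0 (pp ^ d))" using left g by blast
    then have "g \<in> orb (mat2 1 (to_fract x) 0 (pp ^ d) ** br_root (- int n, 0))" using n_pos by (simp add: br_root_tri)
    moreover have "(- int n, 0) \<in> branches" by (simp add: branches_def)
    ultimately show ?thesis by blast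
  next
    case 2
    \<comment> \<open>The swap reflects the apartment and reduces the right end to the left
      one.\<close>
    let ?g = "g ** mat2 0 1 1 0"
    have "apartment_pos ?g \<le> - int n" "invertible ?g" using 2 g KZ_invertible[OF swap_KZ] by (auto simp: apartment_pos_swap invertible_mult)
    then obtain d x where "?g \<in> orb (mat2 (pp powi (- int n)) (to_fract x) 0 (pp ^ d))" using left by blast
    then have "?g ** mat2 0 1 1 0 \<in> orb (mat2 (pp powi (- int n)) (to_fract x) 0 (pp ^ d) ** mat2 0 1 1 0)" by (rule orb_mult_right)
    moreover have "?g ** mat2 0 1 1 0 = g" by (cases g rule: mat2_cases) simp
    ultimately have "g \<in> orb (mat2 1 (to_fract x) 0 (pp ^ d) ** br_root (int n, 0))" using n_pos by (simp add: br_root_tri)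
    moreover have "(int n, 0) \<in> branches" by (simp add: branches_def)
    ultimately show ?thesis by blast
  next
    case 3
    obtain d and x :: "'p padic_int" where x: "g \<in> orb (mat2 (pp powi apartment_pos g) (to_fract x) 0 (pp ^ d))" "x dvd 1 \<or> d = 0"
      using hermite_normal_form[of g] g by metis
    show ?thesis
    proof (cases d)
      case 0
      then have "g \<in> orb (path_vertex (apartment_pos g))" using x path_vertex_unip orb_eq by (metis power_0)
      then show ?thesis using 3 unfolding path_def by auto
    next
      case (Suc l)
      then have "x dvd 1" using x by simp
      \<comment> \<open>The first digit of the unit \<open>x\<close> is the direction in which the
        vertex leaves the path; the remaining digits are its coordinate on the branch.\<close>
      obtain i where i: "i < CARD('p)" "of_nat CARD('p) dvd of_nat i * (- 1) + x" using padic_dvd_digit[of "- 1" x] by auto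
      then obtain y where y: "x = of_nat i + of_nat CARD('p) * y" by (metis add.commute add_diff_cancel_left' add_uminus_conv_diff dvdE mult_minus1_right diff_eq_eq)
      have "i \<noteq> 0"
      proof
        assume "i = 0"
        then have "of_nat CARD('p) dvd (1 :: 'p padic_int)" using \<open>x dvd 1\<close> y by (metis add_0 dvd_mult_left of_nat_0)
        then show False using p_not_unit by blast
      qed
      have "g \<in> orb (mat2 1 (to_fract y) 0 (pp ^ l) ** br_root (apartment_pos g, i))"
        using x \<open>i \<noteq> 0\<close> Suc by (simp add: br_root_tri y)
      moreover have "(apartment_pos g, i) \<in> branches" using 3 i \<open>i \<noteq> 0\<close> by (simp add: branches_def)
      ultimately show ?thesis by blast
    qed
  qed
qed

text \<open>At an end vertex the shear by p^n becomes integral after conjugation; the inner vertices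
  are fixed by diagonal matrices with unit entries. It follows that \<open>S\<close> maps functions
  on the path to functions on the path.\<close>

lemma path_vertex_shifter: "- int n \<le> j \<Longrightarrow> j \<le> int n \<Longrightarrow> path_vertex j ** shifter (region (path_vertex j)) \<in> orb (path_vertex j)"
proof -
  assume j: "- int n \<le> j" "j \<le> int n"
  consider "j = - int n" | "j = int n" | "- int n < j" "j < int n" using j by linarith
  then show ?thesis
  proof cases
    case 1
    then have "region (path_vertex j) = 1" using n_pos by (simp add: region_def apartment_pos_path_vertex)
    then have "path_vertex j ** shifter (region (path_vertex j)) = mat2 (pp powi j) (to_fract 1) 0 1"
      using 1 by (simp add: path_vertex_def shifter_def power_int_minus)
    then show ?thesis using path_vertex_unip by metis
  next
    case 2
    then have "region (path_vertex j) = 2" using n_pos by (simp add: region_def apartment_pos_path_vertex)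
    then have "path_vertex j ** shifter (region (path_vertex j)) = mat2 1 0 1 1 ** path_vertex j"
      using 2 by (simp add: path_vertex_def shifter_def)
    moreover have "mat2 1 0 1 1 \<in> (KZ :: ('p pmat) set)" using KZ_mat2[of 1 1 0 1] by simp
    ultimately show ?thesis using orb_I by simp
  next
    case 3
    then have "region (path_vertex j) = 0" by (simp add: region_def apartment_pos_path_vertex)
    then have "path_vertex j ** shifter (region (path_vertex j)) = mat2 (1 + pp) 0 0 1 ** path_vertex j"
      by (simp add: path_vertex_def shifter_def mult.commute)
    moreover have "mat2 (1 + pp) 0 0 1 \<in> (KZ :: ('p pmat) set)"
      using KZ_mat2[of "1 + of_nat CARD('p)" 1 0 0] unit_1p by simp
    ultimately show ?thesis using orb_I by simp
  qed
qed

section \<open>Edges between different regions\<close>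

definition near :: "'p pmat \<Rightarrow> 'p pmat \<Rightarrow> bool" where
  "near g h \<longleftrightarrow> region h = region g \<or> h \<in> path"

lemma path_I: "- int n \<le> j \<Longrightarrow> j \<le> int n \<Longrightarrow> g \<in> orb (path_vertex j) \<Longrightarrow> g \<in> path"
  unfolding path_def by auto

lemma orb_scalar: "mat2 (pp powi m) 0 0 (pp powi m) ** g \<in> orb g"
  by (intro orb_I KZ_scalar_mat2) simp

lemma near_path_vertex:
  assumes j: "- int n \<le> j" "j \<le> int n"
  shows "near (path_vertex j) (parent_mat ** path_vertex j)" "i < CARD('p) \<Longrightarrow> near (path_vertex j) (child_mat i ** path_vertex j)"
proof -
  have up: "parent_mat ** path_vertex j = path_vertex (j + 1)" by (simp add: parent_mat_def path_vertex_def power_int_add mult.commute)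
  show "near (path_vertex j) (parent_mat ** path_vertex j)"
  proof (cases "j = int n")
    case True
    then show ?thesis unfolding up near_def using n_pos by (simp add: region_def apartment_pos_path_vertex)
  next
    case False
    then show ?thesis unfolding up near_def using path_I[of "j + 1" "path_vertex (j + 1)"] j by simp
  qed
  show "near (path_vertex j) (child_mat i ** path_vertex j)" if "i < CARD('p)"
  proof (cases "i = 0")
    case True
    have eq: "child_mat i ** path_vertex j = mat2 (pp powi 1) 0 0 (pp powi 1) ** path_vertex (j - 1)"
      using True by (simp add: child_mat_def path_vertex_def power_int_diff)
    have o: "child_mat i ** path_vertex j \<in> orb (path_vertex (j - 1))" unfolding eq by (rule orb_scalar)
    show ?thesis
    proof (cases "j = - int n")
      case True
      then show ?thesis unfolding near_def using region_orb[OF o] n_pos by (simp add: region_def apartment_pos_path_vertex)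
    next
      case False
      then show ?thesis unfolding near_def using path_I[OF _ _ o] j by simp
    qed
  next
    case False
    \<comment> \<open>Modulo \<open>p\<close> the entry -i is the nonzero digit p - i, hence a
      unit.\<close>
    have i: "1 \<le> CARD('p) - i" "CARD('p) - i < CARD('p)" using that False by auto
    have u: "(- of_nat i :: 'p padic_int) dvd 1"
      using nat_digit_unit[OF i, of "- 1"] that by (simp add: of_nat_diff)
    have "cval (to_fract (- of_nat i)) (to_fract (of_nat CARD('p) :: 'p padic_int)) = 0"
      by (rule cval_primitive) (use u in blast)
    then have "apartment_pos (child_mat i ** path_vertex j) = j"
      by (simp add: child_mat_def path_vertex_def apartment_pos_def cval_powi_0)
    then show ?thesis by (simp add: near_def region_def apartment_pos_path_vertex)
  qed
qed

text \<open>On an inner branch the parent is the path vertex \<open>j\<close>. At an end the root is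
  the end vertex, and its parent is the next path vertex inward, which exists because n >=
  1.\<close>

lemma br_root_parent:
  assumes b: "b \<in> branches"
  shows "parent_mat ** mat2 1 (to_fract x) 0 (pp ^ 0) ** br_root b \<in> path"
proof -
  let ?g = "mat2 1 (to_fract x) 0 (pp ^ 0) ** br_root b"
  have "parent_mat ** ?g \<in> path"
    using b
  proof (elim branches_cases)
    assume b: "b = (- int n, 0)"
    then have "parent_mat ** ?g = mat2 (pp powi (1 - int n)) (to_fract (of_nat CARD('p) * x)) 0 1"
      using n_pos by (simp add: parent_mat_def br_root_def power_int_diff power_int_minus field_simps)
    then have "parent_mat ** ?g \<in> orb (path_vertex (1 - int n))" using path_vertex_unip by metis
    then show ?thesis using n_pos by (intro path_I[of "1 - int n"]) auto
  next
    assume b: "b = (int n, 0)"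
    then have "parent_mat ** ?g = mat2 (to_fract (of_nat CARD('p) * x)) (pp powi (- (int n - 1))) 1 0"
      using n_pos by (simp add: parent_mat_def br_root_def power_int_diff power_int_minus field_simps)
    then have "parent_mat ** ?g \<in> orb (path_vertex (int n - 1))" using path_vertex_lower by metis
    then show ?thesis using n_pos by (intro path_I[of "int n - 1"]) auto
  next
    fix j i assume b: "b = (j, i)" "- int n < j" "j < int n" "1 \<le> i"
    have "parent_mat ** ?g = mat2 (pp powi 1) 0 0 (pp powi 1) ** mat2 (pp powi j) (to_fract (of_nat i + of_nat CARD('p) * x)) 0 1"
      using b by (simp add: parent_mat_def br_root_def algebra_simps)
    then have "parent_mat ** ?g \<in> orb (path_vertex j)" using orb_scalar path_vertex_unip orb_eq by metis
    then show ?thesis using b by (intro path_I) auto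
  qed
  then show ?thesis by (simp only: matrix_mul_assoc)
qed
lemma near_branch:
  assumes b: "b \<in> branches" and g_def: "g = mat2 1 (to_fract x) 0 (pp ^ d) ** br_root b"
  shows "near g (parent_mat ** g)" "near g (child_mat i ** g)"
proof -
  have "child_mat i ** g = mat2 1 (to_fract (x - of_nat i * of_nat CARD('p) ^ d)) 0 (pp ^ Suc d) ** br_root b"
    by (simp add: g_def child_mat_def to_fract_power matrix_mul_assoc)
  then show "near g (child_mat i ** g)" unfolding near_def g_def using region_branch[OF b] by metis
  show "near g (parent_mat ** g)"
  proof (cases d)
    case (Suc l)
    let ?h = "mat2 1 (to_fract x) 0 (pp ^ l) ** br_root b"
    have "parent_mat ** g = mat2 (pp powi 1) 0 0 (pp powi 1) ** ?h" by (simp add: g_def parent_mat_def Suc matrix_mul_assoc)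
    then have "region (parent_mat ** g) = region ?h" using orb_scalar region_orb by (metis br_atom_inv invertible_mult br_root_inv)
    then show ?thesis unfolding near_def g_def using region_branch[OF b] by metis
  next
    case 0
    have "parent_mat ** g \<in> path" using br_root_parent[OF b, of x] by (simp only: g_def 0 matrix_mul_assoc)
    then show ?thesis by (simp add: near_def)
  qed
qed


end

section \<open>The counting argument\<close>

text \<open>Let K be the preimage of \<open>D\<close> and I = S V + D. The map V -> V/D induced by
  \<open>S\<close> gives |I| |K| <= |V| |D|, and \<open>M\<close> gives |V| <= |M| |I|. Quotients
  are avoided by an injection of I x K into V x D.\<close>

lemma card_preimage_le:
  fixes V D M :: "'a::ab_group_add set" and S :: "'a \<Rightarrow> 'a"
  assumes V: "finite V" "0 \<in> V" "\<And>v w. v \<in> V \<Longrightarrow> w \<in> V \<Longrightarrow> v + w \<in> V"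
    and D: "D \<subseteq> V" "0 \<in> D" "\<And>v w. v \<in> D \<Longrightarrow> w \<in> D \<Longrightarrow> v + w \<in> D" "\<And>v. v \<in> D \<Longrightarrow> - v \<in> D"
    and S: "\<And>v. v \<in> V \<Longrightarrow> S v \<in> V" "\<And>v w. v \<in> V \<Longrightarrow> w \<in> V \<Longrightarrow> S (v + w) = S v + S w"
    and M: "finite M" "\<And>v. v \<in> V \<Longrightarrow> \<exists>m\<in>M. \<exists>w\<in>V. \<exists>d\<in>D. v = m + (S w + d)"
  shows "card {v \<in> V. S v \<in> D} \<le> card M * card D"
proof -
  let ?K = "{v \<in> V. S v \<in> D}" and ?I = "(\<lambda>(v, d). S v + d) ` (V \<times> D)"
  have "finite D" using D(1) V(1) by (rule finite_subset)
  then have fin: "finite D" "finite ?I" using V(1) by simp_all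
  have "V \<subseteq> (\<lambda>(m, y). m + y) ` (M \<times> ?I)"
  proof
    fix v assume "v \<in> V"
    then obtain m w d where "m \<in> M" "w \<in> V" "d \<in> D" "v = m + (S w + d)" using M(2) by blast
    then show "v \<in> (\<lambda>(m, y). m + y) ` (M \<times> ?I)" by (intro image_eqI[where x = "(m, S w + d)"]) auto
  qed
  then have 1: "card V \<le> card M * card ?I"
    using surj_card_le[of "M \<times> ?I" V] M(1) fin(2) by (simp add: card_cartesian_product)
  have "\<forall>y\<in>?I. \<exists>v d. v \<in> V \<and> d \<in> D \<and> y = S v + d" by auto
  then obtain v0 d0 where 0: "\<And>y. y \<in> ?I \<Longrightarrow> v0 y \<in> V \<and> d0 y \<in> D \<and> y = S (v0 y) + d0 y" by metis
  \<comment> \<open>Applying \<open>S\<close> to the first entry of \<open>h (y, v)\<close> and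
    adding the second recovers \<open>y\<close>, and then \<open>v\<close>.\<close>
  define h where "h = (\<lambda>(y, v). (v0 y + v, d0 y + - S v))"
  have "inj_on h (?I \<times> ?K)"
  proof (rule inj_onI)
    fix a b assume a: "a \<in> ?I \<times> ?K" and b: "b \<in> ?I \<times> ?K" and eq: "h a = h b"
    obtain y v where av: "a = (y, v)" "y \<in> ?I" "v \<in> ?K" using a by blast
    obtain z w where bw: "b = (z, w)" "z \<in> ?I" "w \<in> ?K" using b by blast
    have e: "v0 y + v = v0 z + w" "d0 y + - S v = d0 z + - S w" using eq by (simp_all add: h_def av bw)
    have "S (v0 y + v) + (d0 y + - S v) = y" using 0[OF av(2)] av(3) S(2) by simp
    moreover have "S (v0 z + w) + (d0 z + - S w) = z" using 0[OF bw(2)] bw(3) S(2) by simp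
    ultimately have "y = z" using e by simp
    then show "a = b" using e av bw by simp
  qed
  moreover have "h ` (?I \<times> ?K) \<subseteq> V \<times> D"
  proof
    fix c assume "c \<in> h ` (?I \<times> ?K)"
    then obtain a where a: "a \<in> ?I \<times> ?K" "c = h a" by (rule imageE) simp
    obtain y v where yv: "a = (y, v)" "y \<in> ?I" "v \<in> ?K" using a(1) by blast
    then have c: "c = (v0 y + v, d0 y + - S v)" "y \<in> ?I" "v \<in> V" "S v \<in> D" using a(2) by (simp_all add: h_def)
    have "v0 y + v \<in> V" "d0 y + - S v \<in> D" using 0[OF c(2)] c(3,4) V(3) D(3) D(4) by blast+
    then show "c \<in> V \<times> D" using c(1) by simp
  qed
  ultimately have "card (?I \<times> ?K) \<le> card (V \<times> D)" by (rule card_inj_on_le) (use V(1) fin in simp)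
  then have "card ?I * card ?K \<le> card V * card D" by (simp only: card_cartesian_product)
  also have "\<dots> \<le> card M * card ?I * card D" using 1 by (rule mult_le_mono1)
  finally have "card ?I * card ?K \<le> card ?I * (card M * card D)" by (simp add: ac_simps)
  moreover have "?I \<noteq> {}" using V(2) D(2) by auto
  then have "card ?I > 0" using fin(2) by (simp add: card_gt_0_iff)
  ultimately show ?thesis by simp
qed

context gl2
begin

section \<open>Functions with prescribed support, and the image of T - lambda\<close>

lemma atom_rep:
  assumes "g \<in> orb h" "invertible h" "w \<in> Sym r"
  obtains w' where "w' \<in> Sym r" "atom g w = atom h w'"
proof -
  obtain k where k: "k \<in> KZ" "g = k ** h" using assms(1) by (auto simp: orb_def)
  have "w = act k (act (matrix_inv k) w)"
    using k by (simp add: KZ_inv matrix_inv_right act_one flip: act_mult)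
  then have "atom g w = atom h (act (matrix_inv k) w)" using atom_eqI[OF assms(2) k] by blast
  then show ?thesis using that k assms KZ_inv act_Sym by blast
qed

lemma right_transl_ind_fns:
  assumes "f \<in> ind_fns" "invertible h" shows "right_transl h f \<in> ind_fns"
  using assms(1)
proof (rule ind_fns_induct[where \<Omega> = UNIV])
  fix f and g :: "'p pmat" and w :: "'f poly poly" assume a: "right_transl h f \<in> ind_fns" "invertible g" "w \<in> Sym r"
  have "right_transl h (f + atom g w) = right_transl h f + right_transl h (atom g w)"
    by (auto simp: right_transl_def)
  then show "right_transl h (f + atom g w) \<in> ind_fns"
    using a assms(2) by (simp add: right_transl_atom ind_fns_add atom_ind_fns invertible_mult)
next
  have "right_transl h 0 = (0 :: ('p, 'f) gl2_fun)" by (auto simp: right_transl_def)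
  then show "right_transl h 0 \<in> ind_fns" using ind_fns_zero by (simp only:)
qed auto

definition fns_on :: "('p pmat) set \<Rightarrow> ('p, 'f) gl2_fun set" where
  "fns_on \<Omega> = {f \<in> ind_fns. \<forall>x. f x \<noteq> 0 \<longrightarrow> x \<in> \<Omega>}"

lemma fns_on_subsp: "subsp (fns_on \<Omega>)"
  unfolding subsp_def
proof (intro conjI ballI allI)
  show "0 \<in> fns_on \<Omega>" unfolding fns_on_def by (intro CollectI conjI ind_fns_zero) simp
next
  fix f g assume "f \<in> fns_on \<Omega>" "g \<in> fns_on \<Omega>"
  then have fg: "f \<in> ind_fns" "g \<in> ind_fns" "f x \<noteq> 0 \<Longrightarrow> x \<in> \<Omega>" "g x \<noteq> 0 \<Longrightarrow> x \<in> \<Omega>" for x by (auto simp: fns_on_def)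
  have "x \<in> \<Omega>" if "(f + g) x \<noteq> 0" for x
    using that fg(3,4)[of x] by (cases "f x = 0") auto
  then show "f + g \<in> fns_on \<Omega>" unfolding fns_on_def using ind_fns_add[OF fg(1,2)] by blast
next
  fix c f assume "f \<in> fns_on \<Omega>"
  then show "scale c f \<in> fns_on \<Omega>" unfolding fns_on_def using ind_fns_scale by (auto simp: scale_def)
qed

lemma fns_on_atom: "orb g \<subseteq> \<Omega> \<Longrightarrow> invertible g \<Longrightarrow> w \<in> Sym r \<Longrightarrow> atom g w \<in> fns_on \<Omega>"
  unfolding fns_on_def using atom_ind_fns atom_outside by blast

lemma fns_on_mono: "\<Omega> \<subseteq> \<Omega>' \<Longrightarrow> fns_on \<Omega> \<subseteq> fns_on \<Omega>'"
  unfolding fns_on_def by blast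

lemma fns_on_induct:
  assumes "f \<in> fns_on \<Omega>" and "subsp N" and "\<And>g w. invertible g \<Longrightarrow> g \<in> \<Omega> \<Longrightarrow> w \<in> Sym r \<Longrightarrow> atom g w \<in> N"
  shows "f \<in> N"
proof (rule ind_fns_induct[where \<Omega> = \<Omega>])
  show "f \<in> ind_fns" "f x \<noteq> 0 \<Longrightarrow> x \<in> \<Omega>" for x using assms(1) by (auto simp: fns_on_def)
  show "0 \<in> N" using assms(2) by (rule subsp_D)
qed (use assms subsp_D(2) in blast)

text \<open>By equivariance a function is determined by its values at one representative of each
  vertex.\<close>

lemma fns_on_card:
  assumes R: "finite R" "\<And>x. x \<in> \<Omega> \<Longrightarrow> \<exists>g\<in>R. x \<in> orb g"
  shows "finite (fns_on \<Omega>)" "card (fns_on \<Omega>) \<le> (CARD('f) ^ Suc r) ^ card R"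
proof -
  have inj: "inj_on (\<lambda>f. restrict f R) (fns_on \<Omega>)"
  proof (rule inj_onI)
    fix f h assume fh: "f \<in> fns_on \<Omega>" "h \<in> fns_on \<Omega>" "restrict f R = restrict h R"
    show "f = h"
    proof (rule ext)
      fix x
      show "f x = h x"
      proof (cases "x \<in> \<Omega>")
        case True
        then obtain g where g: "g \<in> R" "x \<in> orb g" using R by blast
        then obtain k where k: "k \<in> KZ" "x = k ** g" by (auto simp: orb_def)
        have "f g = h g" using fh(3) g(1) by (metis restrict_apply')
        moreover have "f \<in> ind_fns" "h \<in> ind_fns" using fh by (auto simp: fns_on_def)
        ultimately show ?thesis using k ind_fns_D(3) by metis
      next
        case False
        then have "f x = 0" "h x = 0" using fh(1,2) unfolding fns_on_def by blast+
        then show ?thesis by simp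
      qed
    qed
  qed
  have sub: "(\<lambda>f. restrict f R) ` fns_on \<Omega> \<subseteq> PiE R (\<lambda>_. Sym r)"
    by (auto simp: fns_on_def ind_fns_D(2))
  have fin: "finite (PiE R (\<lambda>_. Sym r :: 'f poly poly set))" using R(1) by (rule finite_PiE) (rule finite_Sym)
  show "finite (fns_on \<Omega>)" using inj sub fin by (rule inj_on_finite)
  have "card (fns_on \<Omega>) \<le> card (PiE R (\<lambda>_. Sym r :: 'f poly poly set))" using inj sub fin by (rule card_inj_on_le)
  also have "\<dots> = card (Sym r :: 'f poly poly set) ^ card R" using R(1) by (simp add: card_PiE)
  also have "\<dots> \<le> (CARD('f) ^ Suc r) ^ card R" using card_Sym by (rule power_mono) simp
  finally show "card (fns_on \<Omega>) \<le> (CARD('f) ^ Suc r) ^ card R" .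
qed

definition J :: "('p, 'f) gl2_fun set" where
  "J = (\<lambda>f. T f - scale lam f) ` ind_fns"

lemma J_I: "f \<in> ind_fns \<Longrightarrow> T f - scale lam f \<in> J"
  unfolding J_def by blast

lemma J_subsp: "subsp J"
  unfolding subsp_def
proof (intro conjI ballI allI)
  have "(0 :: ('p, 'f) gl2_fun) = T 0 - scale lam 0"
    unfolding T_linear(2)[OF ind_fns_zero ind_fns_zero] scale_simps by (rule diff_self[symmetric])
  then show "0 \<in> J" using J_I[OF ind_fns_zero] by (simp only:)
next
  fix f g assume "f \<in> J" "g \<in> J"
  then obtain a b where ab: "f = T a - scale lam a" "g = T b - scale lam b" "a \<in> ind_fns" "b \<in> ind_fns" by (auto simp: J_def)
  have "f + g = T (a + b) - scale lam (a + b)" using T_linear(1)[OF ab(3,4)] by (simp add: ab scale_simps algebra_simps)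
  then show "f + g \<in> J" using J_I[OF ind_fns_add[OF ab(3,4)]] by (simp only:)
next
  fix c f assume "f \<in> J"
  then obtain a where a: "f = T a - scale lam a" "a \<in> ind_fns" by (auto simp: J_def)
  have "scale c f = T (scale c a) - scale lam (scale c a)" using T_linear(3)[OF a(2,2)] by (simp add: a scale_simps mult.commute)
  then show "scale c f \<in> J" using J_I[OF ind_fns_scale[OF a(2)]] by (simp only:)
qed

lemma right_transl_J: "f \<in> J \<Longrightarrow> invertible h \<Longrightarrow> right_transl h f \<in> J"
proof -
  assume "f \<in> J" and h: "invertible h"
  then obtain a where a: "f = T a - scale lam a" "a \<in> ind_fns" by (auto simp: J_def)
  have "right_transl h f = T (right_transl h a) - scale lam (right_transl h a)"
    unfolding T_transl[OF h] a(1) by (auto simp: right_transl_def scale_def)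
  then show ?thesis using J_I[OF right_transl_ind_fns[OF a(2) h]] by (simp only:)
qed

lemma subsp_sum_set: "subsp A \<Longrightarrow> subsp B \<Longrightarrow> subsp {a + b | a b. a \<in> A \<and> b \<in> B}"
  unfolding subsp_def
proof (elim conjE, intro conjI ballI allI)
  assume A: "0 \<in> A" "\<forall>f\<in>A. \<forall>g\<in>A. f + g \<in> A" "\<forall>c. \<forall>f\<in>A. scale c f \<in> A"
    and B: "0 \<in> B" "\<forall>f\<in>B. \<forall>g\<in>B. f + g \<in> B" "\<forall>c. \<forall>f\<in>B. scale c f \<in> B"
  show "0 \<in> {a + b | a b. a \<in> A \<and> b \<in> B}"
    by (intro CollectI exI[of _ 0] conjI A B) (rule add_0[symmetric])
  fix f assume f: "f \<in> {a + b | a b. a \<in> A \<and> b \<in> B}"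
  obtain a b where ab: "f = a + b" "a \<in> A" "b \<in> B" using f by blast
  show "scale c f \<in> {a + b | a b. a \<in> A \<and> b \<in> B}" for c
    using A B ab by (intro CollectI exI[of _ "scale c a"] exI[of _ "scale c b"]) (simp add: scale_simps)
  fix g assume g: "g \<in> {a + b | a b. a \<in> A \<and> b \<in> B}"
  obtain a' b' where ab': "g = a' + b'" "a' \<in> A" "b' \<in> B" using g by blast
  have "f + g = (a + a') + (b + b')" by (simp add: ab ab' algebra_simps)
  then show "f + g \<in> {a + b | a b. a \<in> A \<and> b \<in> B}" using A B ab ab' by blast
qed

lemma subsp_Int: "subsp A \<Longrightarrow> subsp B \<Longrightarrow> subsp (A \<inter> B)"
  by (simp add: subsp_def)

lemma padic_residue: "\<exists>i<CARD('p) ^ d. \<exists>y. (x :: 'p padic_int) = of_nat i + of_nat CARD('p) ^ d * y"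
proof (induction d)
  case (Suc d)
  then obtain i y where i: "i < CARD('p) ^ d" "x = of_nat i + of_nat CARD('p) ^ d * y" by blast
  obtain i' where i': "i' < CARD('p)" "of_nat CARD('p) dvd of_nat i' * (- 1) + y" using padic_dvd_digit[of "- 1" y] by auto
  then obtain z where "of_nat i' * (- 1) + y = of_nat CARD('p) * z" by blast
  then have z: "y = of_nat i' + of_nat CARD('p) * z" by (simp add: algebra_simps)
  have "i + CARD('p) ^ d * i' < CARD('p) ^ d + CARD('p) ^ d * i'" using i by simp
  also have "\<dots> = CARD('p) ^ d * Suc i'" by simp
  also have "\<dots> \<le> CARD('p) ^ d * CARD('p)" using i' by (intro mult_le_mono2) simp
  finally have "i + CARD('p) ^ d * i' < CARD('p) ^ Suc d" by (simp add: mult.commute)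
  moreover have "x = of_nat (i + CARD('p) ^ d * i') + of_nat CARD('p) ^ Suc d * z"
    by (simp add: i z algebra_simps)
  ultimately show ?case by blast
qed simp

end

context gl2_level
begin

section \<open>Restriction to regions and the operator S\<close>

definition cutoff :: "nat \<Rightarrow> ('p, 'f) gl2_fun \<Rightarrow> 'p pmat \<Rightarrow> 'f poly poly" where
  "cutoff c f = (\<lambda>x. if region x = c then f x else 0)"

definition S :: "('p, 'f) gl2_fun \<Rightarrow> 'p pmat \<Rightarrow> 'f poly poly" where
  "S f = (\<lambda>g. f (g ** shifter (region g)) - f g)"

definition E :: "('p, 'f) gl2_fun set" where "E = fns_on path"

definition JE :: "('p, 'f) gl2_fun set" where "JE = {a + e | a e. a \<in> J \<and> e \<in> E}"

definition nbhd :: "nat \<Rightarrow> ('p pmat) set" where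
  "nbhd k = path \<union> {g. \<exists>b\<in>branches. \<exists>d\<le>k. \<exists>x. g \<in> orb (mat2 1 (to_fract x) 0 (pp ^ d) ** br_root b)}"

definition V :: "nat \<Rightarrow> ('p, 'f) gl2_fun set" where "V k = fns_on (nbhd k)"

lemma JE_subsp: "subsp JE"
  unfolding JE_def E_def by (intro subsp_sum_set J_subsp fns_on_subsp)

lemma JE_I: "a \<in> J \<Longrightarrow> a \<in> JE" "e \<in> E \<Longrightarrow> e \<in> JE"
proof -
  have 0: "0 \<in> J" "0 \<in> E" unfolding E_def by (rule subsp_D, rule J_subsp fns_on_subsp)+
  show "a \<in> JE" if "a \<in> J"
    unfolding JE_def by (intro CollectI exI[of _ a] exI[of _ 0] conjI 0 that) (rule add_0_right[symmetric])
  show "e \<in> JE" if "e \<in> E"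
    unfolding JE_def by (intro CollectI exI[of _ e] exI[of _ 0] conjI 0 that) (rule add_0[symmetric])
qed

lemma cutoff_linear: "cutoff c (f + g) = cutoff c f + cutoff c g" "cutoff c (scale e f) = scale e (cutoff c f)" "cutoff c 0 = 0" "cutoff c (f - g) = cutoff c f - cutoff c g"
  by (auto simp: cutoff_def scale_def)

lemma cutoff_sum: "cutoff c (sum f A) = (\<Sum>i\<in>A. cutoff c (f i))"
  by (induction A rule: infinite_finite_induct) (simp_all only: sum.infinite sum.empty sum.insert cutoff_linear simp_thms)

lemma cutoff_atom: "invertible g \<Longrightarrow> cutoff c (atom g w) = (if region g = c then atom g w else 0)"
  using region_orb by (auto simp: cutoff_def atom_def fun_eq_iff)

lemma orb_path: "g \<in> path \<Longrightarrow> orb g \<subseteq> path"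
  unfolding path_def using orb_eq by auto

lemma atom_E: "g \<in> path \<Longrightarrow> invertible g \<Longrightarrow> w \<in> Sym r \<Longrightarrow> atom g w \<in> E"
  unfolding E_def using fns_on_atom orb_path by blast

text \<open>A neighbour of a vertex in another region lies on the path.\<close>

lemma cutoff_T_atom:
  assumes g: "invertible g" and w: "w \<in> Sym r"
    and near: "near g (parent_mat ** g)" "\<And>i. i < CARD('p) \<Longrightarrow> near g (child_mat i ** g)"
  shows "cutoff c (T (atom g w) - scale lam (atom g w)) \<in> JE"
proof -
  let ?t = "T (atom g w) - scale lam (atom g w)"
  have E: "subsp E" unfolding E_def by (rule fns_on_subsp)
  have t: "?t \<in> J" unfolding J_def using atom_ind_fns[OF g w] by blast
  have piece: "cutoff c (atom h v) - (if region g = c then atom h v else 0) \<in> E"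
    if h: "near g h" "invertible h" "v \<in> Sym r" for h v
  proof (cases "region h = region g")
    case True
    have "cutoff c (atom h v) = (if region g = c then atom h v else 0)" using h True by (simp add: cutoff_atom)
    then show ?thesis using subsp_D(1)[OF E] by (simp only: diff_self)
  next
    case False
    then have "atom h v \<in> E" using h atom_E by (auto simp: near_def)
    moreover have "cutoff c (atom h v) \<in> {atom h v, 0}" using h by (simp add: cutoff_atom)
    then have "cutoff c (atom h v) \<in> E" using \<open>atom h v \<in> E\<close> subsp_D(1)[OF E] by (metis empty_iff insert_iff)
    moreover have "(if region g = c then atom h v else 0) \<in> E" using \<open>atom h v \<in> E\<close> subsp_D(1)[OF E] by (cases "region g = c") simp_all
    ultimately show ?thesis by (intro subsp_D(5)[OF E])
  qed
  have T: "T (atom g w) = atom (parent_mat ** g) (Sym_act (mat2 0 0 0 1) w) +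
     (\<Sum>i<CARD('p). atom (child_mat i ** g) (Sym_act (mat2 1 (- of_nat i) 0 0) w))" using T_atom[OF g w] .
  \<comment> \<open>\<open>?c\<close> keeps or drops a whole function according to the region of
    \<open>g\<close>, so it preserves \<open>J\<close>. On each term of \<open>T (atom g w)\<close>
    it differs from \<open>cutoff c\<close> by an element of \<open>E\<close>.\<close>
  let ?c = "\<lambda>f. if region g = c then f else 0 :: 'p pmat \<Rightarrow> 'f poly poly"
  have eq: "cutoff c (T (atom g w)) - ?c (T (atom g w)) = (cutoff c (atom (parent_mat ** g) (Sym_act (mat2 0 0 0 1) w)) - ?c (atom (parent_mat ** g) (Sym_act (mat2 0 0 0 1) w)))
    + (\<Sum>i<CARD('p). cutoff c (atom (child_mat i ** g) (Sym_act (mat2 1 (- of_nat i) 0 0) w)) - ?c (atom (child_mat i ** g) (Sym_act (mat2 1 (- of_nat i) 0 0) w)))"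
    unfolding T cutoff_linear cutoff_sum by (cases "region g = c") (simp_all add: sum_subtractf)
  have "cutoff c (T (atom g w)) - ?c (T (atom g w)) \<in> E"
    unfolding eq by (intro subsp_D(2)[OF E] subsp_sum[OF E] piece near) (use g w in \<open>simp_all add: invertible_mult Sym_act_closed\<close>)
  moreover have "cutoff c ?t - ?c ?t = cutoff c (T (atom g w)) - ?c (T (atom g w))"
    unfolding cutoff_linear using g by (simp add: cutoff_atom scale_simps)
  ultimately have "cutoff c ?t - ?c ?t \<in> JE" using JE_I(2) by (simp only:)
  moreover have "?c ?t \<in> JE" using t JE_I(1) subsp_D(1)[OF JE_subsp] by simp
  ultimately have "cutoff c ?t - ?c ?t + ?c ?t \<in> JE" by (rule subsp_D(2)[OF JE_subsp])
  then show ?thesis by (simp only: diff_add_cancel)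
qed

text \<open>Restriction to a region disturbs \<open>J\<close> only along edges between regions.
  Applied to the differences of a function and its translates, this puts \<open>S f\<close> into
  \<open>JE\<close> whenever \<open>f\<close> represents an invariant class
  (\<open>S_JE\<close>).\<close>

lemma cutoff_J:
  assumes "f \<in> J" shows "cutoff c f \<in> JE"
proof -
  obtain a where a: "f = T a - scale lam a" "a \<in> ind_fns" using assms by (auto simp: J_def)
  have "cutoff c (T a - scale lam a) \<in> JE"
    using a(2)
  proof (rule ind_fns_induct[where \<Omega> = UNIV])
    fix f and g :: "'p pmat" and w :: "'f poly poly"
    assume f: "cutoff c (T f - scale lam f) \<in> JE" "f \<in> ind_fns" and g: "invertible g" and w: "w \<in> Sym r"
    have at: "cutoff c (T (atom g w) - scale lam (atom g w)) \<in> JE"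
      using vertex_cases[OF g]
    proof
      assume "g \<in> path"
      then obtain j where j: "- int n \<le> j" "j \<le> int n" "g \<in> orb (path_vertex j)" unfolding path_def by auto
      obtain w' where "w' \<in> Sym r" "atom g w = atom (path_vertex j) w'" using atom_rep[OF j(3) path_vertex_inv w] .
      then show ?thesis using cutoff_T_atom[OF path_vertex_inv _ near_path_vertex[OF j(1,2)]] by simp
    next
      assume "\<exists>b\<in>branches. \<exists>d x. g \<in> orb (mat2 1 (to_fract x) 0 (pp ^ d) ** br_root b)"
      then obtain b d x where b: "b \<in> branches" "g \<in> orb (mat2 1 (to_fract x) 0 (pp ^ d) ** br_root b)" by blast
      have inv: "invertible (mat2 1 (to_fract x) 0 (pp ^ d) ** br_root b)" by (intro invertible_mult) simp_all
      obtain w' where "w' \<in> Sym r" "atom g w = atom (mat2 1 (to_fract x) 0 (pp ^ d) ** br_root b) w'"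
        using atom_rep[OF b(2) inv w] .
      then show ?thesis using cutoff_T_atom[OF inv _ near_branch[OF b(1) refl]] by simp
    qed
    have "cutoff c (T (f + atom g w) - scale lam (f + atom g w)) = cutoff c (T f - scale lam f) + cutoff c (T (atom g w) - scale lam (atom g w))"
      unfolding T_linear(1)[OF f(2) atom_ind_fns[OF g w]] scale_simps cutoff_linear[symmetric] by (simp add: algebra_simps)
    then show "cutoff c (T (f + atom g w) - scale lam (f + atom g w)) \<in> JE"
      using subsp_D(2)[OF JE_subsp f(1) at] by simp
  next
    have "cutoff c (T 0 - scale lam 0) = 0" unfolding T_linear(2)[OF ind_fns_zero ind_fns_zero] scale_simps by (auto simp: cutoff_def)
    then show "cutoff c (T 0 - scale lam 0) \<in> JE" using subsp_D(1)[OF JE_subsp] by (simp only:)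
  qed auto
  then show ?thesis using a by simp
qed

lemma S_eq: "S f = (\<Sum>c\<in>{0, 1, 2}. cutoff c (right_transl (shifter c) f - f))"
proof (rule ext)
  fix g
  show "S f g = (\<Sum>c\<in>{0, 1, 2}. cutoff c (right_transl (shifter c) f - f)) g"
    using region_cases[of g] unfolding sum_fun_apply by (auto simp: S_def cutoff_def right_transl_def)
qed

lemma S_JE:
  assumes "\<And>c. right_transl (shifter c) f - f \<in> J" shows "S f \<in> JE"
  unfolding S_eq by (intro subsp_sum[OF JE_subsp] cutoff_J assms)

lemma S_linear: "S (f + g) = S f + S g" "S (scale c f) = scale c (S f)" "S 0 = 0"
  by (auto simp: S_def scale_def algebra_simps)

text \<open>Each \<open>shifter\<close> preserves both its region and the complement. At a point of
  another region neither its own translate nor the one on the right side can reach the vertex of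
  \<open>g\<close>.\<close>

lemma S_atom:
  assumes g: "invertible g"
  shows "S (atom g w) = right_transl (shifter (region g)) (atom g w) - atom g w"
proof (rule ext)
  fix x
  let ?c = "region g"
  have "atom g w (x ** shifter (region x)) = atom g w (x ** shifter ?c)"
  proof (cases "invertible x")
    case False
    have "\<not> invertible (x ** shifter c)" for c
      using False invertible_mult[of "x ** shifter c" "matrix_inv (shifter c)"] by auto
    then show ?thesis using g orb_invertible atom_outside by metis
  next
    case True
    show ?thesis
    proof (cases "region x = ?c")
      case False
      have "x ** shifter (region x) \<notin> orb g"
      proof
        assume "x ** shifter (region x) \<in> orb g"
        then have "region (x ** shifter (region x)) = ?c" using region_orb g by blast
        then show False using region_shifter[OF True region_cases, of x] False by simp
      qed
      moreover have "x ** shifter ?c \<notin> orb g"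
      proof
        assume "x ** shifter ?c \<in> orb g"
        then have "region (x ** shifter ?c) = ?c" using region_orb g by blast
        then show False using region_shifter[OF True region_cases, of g] False by simp
      qed
      ultimately show ?thesis by (simp add: atom_outside)
    qed simp
  qed
  then show "S (atom g w) x = (right_transl (shifter ?c) (atom g w) - atom g w) x"
    by (simp add: S_def right_transl_def)
qed

section \<open>The finite spaces of functions of bounded depth\<close>

lemma orb_nbhd: "g \<in> nbhd k \<Longrightarrow> orb g \<subseteq> nbhd k"
proof -
  assume g: "g \<in> nbhd k"
  show ?thesis
  proof (cases "g \<in> path")
    case True
    then show ?thesis using orb_path unfolding nbhd_def by blast
  next
    case False
    then obtain b d x where "b \<in> branches" "d \<le> k" "g \<in> orb (mat2 1 (to_fract x) 0 (pp ^ d) ** br_root b)"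
      using g by (auto simp: nbhd_def)
    then show ?thesis unfolding nbhd_def using orb_eq by blast
  qed
qed

lemma V_subsp: "subsp (V k)"
  unfolding V_def by (rule fns_on_subsp)

lemma E_V: "E \<subseteq> V k"
  unfolding E_def V_def by (rule fns_on_mono) (auto simp: nbhd_def)

lemma V_mono: "k \<le> l \<Longrightarrow> V k \<subseteq> V l"
  unfolding V_def by (rule fns_on_mono) (use order_trans in \<open>fastforce simp: nbhd_def\<close>)

lemma br_atom_V:
  assumes "b \<in> branches" "d \<le> k" "w \<in> Sym r"
  shows "br_atom (br_root b) d x w \<in> V k"
proof -
  let ?g = "mat2 1 (to_fract x) 0 (pp ^ d) ** br_root b"
  have "?g \<in> nbhd k" unfolding nbhd_def using assms orb_self by blast
  then show ?thesis unfolding V_def br_atom_def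
    using assms by (intro fns_on_atom orb_nbhd invertible_mult) simp_all
qed

lemma V_exhaust: assumes "f \<in> ind_fns" shows "\<exists>k. f \<in> V k"
  using assms
proof (rule ind_fns_induct[where \<Omega> = UNIV])
  fix f and g :: "'p pmat" and w :: "'f poly poly" assume f: "\<exists>k. f \<in> V k" and g: "invertible g" and w: "w \<in> Sym r"
  obtain k where k: "f \<in> V k" using f by blast
  obtain l where "g \<in> nbhd l" using vertex_cases[OF g] by (auto simp: nbhd_def)
  then have "atom g w \<in> V l" unfolding V_def using fns_on_atom orb_nbhd g w by blast
  then have "f + atom g w \<in> V (max k l)"
    using k V_mono[of k "max k l"] V_mono[of l "max k l"] by (intro subsp_D(2)[OF V_subsp]) auto
  then show "\<exists>k. f + atom g w \<in> V k" by blast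
qed (use subsp_D(1)[OF V_subsp] in blast)+

lemma br_atom_cases:
  assumes "g \<in> nbhd k" "invertible g" "w \<in> Sym r"
  obtains "g \<in> path" | b d x w' where "b \<in> branches" "d \<le> k" "w' \<in> Sym r" "atom g w = br_atom (br_root b) d x w'"
proof (cases "g \<in> path")
  case False
  then obtain b d x where b: "b \<in> branches" "d \<le> k" "g \<in> orb (mat2 1 (to_fract x) 0 (pp ^ d) ** br_root b)"
    using assms(1) by (auto simp: nbhd_def)
  have inv: "invertible (mat2 1 (to_fract x) 0 (pp ^ d) ** br_root b)" by (intro invertible_mult) simp_all
  obtain w' where "w' \<in> Sym r" "atom g w = atom (mat2 1 (to_fract x) 0 (pp ^ d) ** br_root b) w'"
    using atom_rep[OF b(3) inv assms(3)] .
  then show ?thesis using that(2) b unfolding br_atom_def by blast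
qed (use that in blast)

lemma S_br_atom:
  assumes "b \<in> branches"
  shows "S (br_atom (br_root b) d x w) = br_atom (br_root b) d (of_int (branch_mult b) * x - of_int (branch_offset b)) w - br_atom (br_root b) d x w"
proof -
  have "region (mat2 1 (to_fract x) 0 (pp ^ d) ** br_root b) = branch_region b" by (rule region_branch[OF assms])
  moreover have "invertible (mat2 1 (to_fract x) 0 (pp ^ d) ** br_root b)" by (intro invertible_mult) simp_all
  ultimately have "S (br_atom (br_root b) d x w) = right_transl (shifter (branch_region b)) (br_atom (br_root b) d x w) - br_atom (br_root b) d x w"
    unfolding br_atom_def using S_atom by metis
  then show ?thesis using br_atom_move[OF br_root_inv shifter_inv branch_mult_cong br_root_shifter[OF assms]] by simp
qed

text \<open>The translations preserve the depth on a branch and fix the path vertices of their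
  region.\<close>

lemma S_V: "f \<in> V k \<Longrightarrow> S f \<in> V k"
proof -
  assume f: "f \<in> V k"
  have V: "subsp (V k)" by (rule V_subsp)
  have "f \<in> {f. S f \<in> V k}"
    using f[unfolded V_def]
  proof (rule fns_on_induct)
    show "subsp {f. S f \<in> V k}"
      unfolding subsp_def using subsp_D[OF V] by (simp only: mem_Collect_eq S_linear) blast
    fix g and w :: "'f poly poly" assume g: "invertible g" "g \<in> nbhd k" "w \<in> Sym r"
    from g(2,1,3) show "atom g w \<in> {f. S f \<in> V k}"
    proof (cases rule: br_atom_cases)
      case 1
      then obtain j where j: "- int n \<le> j" "j \<le> int n" "g \<in> orb (path_vertex j)" unfolding path_def by auto
      obtain w' where w': "w' \<in> Sym r" "atom g w = atom (path_vertex j) w'" using atom_rep[OF j(3) path_vertex_inv g(3)] .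
      let ?h = "shifter (region (path_vertex j))"
      have "path_vertex j ** ?h ** matrix_inv ?h \<in> orb (path_vertex j ** matrix_inv ?h)"
        using path_vertex_shifter[OF j(1,2)] by (rule orb_mult_right)
      then have "path_vertex j ** matrix_inv ?h \<in> orb (path_vertex j)" using orb_sym by simp
      then have "path_vertex j ** matrix_inv ?h \<in> path" using j by (intro path_I)
      then have "right_transl ?h (atom (path_vertex j) w') \<in> E"
        using w' by (simp add: right_transl_atom atom_E invertible_mult)
      moreover have "atom (path_vertex j) w' \<in> E" using j w' by (intro atom_E path_I[of j]) simp_all
      ultimately have "S (atom g w) \<in> V k"
        unfolding w'(2) S_atom[OF path_vertex_inv] using E_V by (intro subsp_D(5)[OF V]) blast+
      then show ?thesis by simp
    next
      case (2 b d x w')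
      then have "S (atom g w) \<in> V k" unfolding 2(4) S_br_atom[OF 2(1)] by (intro subsp_D(5)[OF V] br_atom_V)
      then show ?thesis by simp
    qed
  qed
  then show ?thesis by simp
qed

text \<open>At depth \<open>d\<close> the coordinate matters only modulo p^d; the bound p^k serves
  all depths at once.\<close>

lemma nbhd_reps:
  obtains R where "finite R" "\<And>x. x \<in> nbhd k \<Longrightarrow> \<exists>g\<in>R. x \<in> orb g"
proof -
  let ?R = "path_vertex ` {- int n..int n} \<union> (\<lambda>(b, d, i). mat2 1 (of_nat i) 0 (pp ^ d) ** br_root b) ` (branches \<times> {..k} \<times> {..CARD('p) ^ k})"
  have "finite branches" by (simp add: branches_def)
  then have "finite ?R" by simp
  moreover have "\<exists>g\<in>?R. y \<in> orb g" if y: "y \<in> nbhd k" for y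
  proof (cases "y \<in> path")
    case True
    then show ?thesis unfolding path_def by auto
  next
    case False
    then obtain b d x where b: "b \<in> branches" "d \<le> k" "y \<in> orb (mat2 1 (to_fract x) 0 (pp ^ d) ** br_root b)"
      using y by (auto simp: nbhd_def)
    obtain i z where i: "i < CARD('p) ^ d" "x = of_nat i + of_nat CARD('p) ^ d * z" using padic_residue by blast
    let ?g = "mat2 1 (of_nat i) 0 (pp ^ d) ** br_root b"
    have "mat2 1 (to_fract x) 0 (pp ^ d) ** br_root b = mat2 1 (to_fract z) 0 1 ** ?g"
      by (simp add: i matrix_mul_assoc to_fract_power algebra_simps)
    then have "mat2 1 (to_fract x) 0 (pp ^ d) ** br_root b \<in> orb ?g" using orb_I[OF unip_KZ[of z], of ?g] by simp
    then have "y \<in> orb ?g" using b(3) orb_eq by metis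
    moreover have "CARD('p) ^ d \<le> CARD('p) ^ k" using b(2) by (intro power_increasing) simp_all
    then have "?g \<in> ?R" using b i by (intro UnI2 image_eqI[where x = "(b, d, i)"]) auto
    ultimately show ?thesis by blast
  qed
  ultimately show ?thesis using that by blast
qed

lemma V_finite: "finite (V k)"
  unfolding V_def using nbhd_reps fns_on_card(1) by metis

lemma E_card: "card E \<le> CARD('f) ^ (Suc r * (2 * n + 1))"
proof -
  let ?R = "path_vertex ` {- int n..int n}"
  have "card E \<le> (CARD('f) ^ Suc r) ^ card ?R"
    unfolding E_def by (rule fns_on_card(2)) (auto simp: path_def)
  also have "\<dots> \<le> (CARD('f) ^ Suc r) ^ (2 * n + 1)"
    using card_image_le[of "{- int n..int n}" path_vertex] by (intro power_increasing) (simp_all add: Suc_le_eq nat_add_distrib)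
  finally show ?thesis by (simp only: power_mult)
qed

section \<open>The cokernel of S on functions of bounded depth\<close>

definition N :: "nat \<Rightarrow> ('p, 'f) gl2_fun set" where
  "N k = {s + d | s d. s \<in> S ` V k \<and> d \<in> JE \<inter> V k}"

text \<open>Two coefficients per branch, for the depths that the recursion
  \<open>T_br_atom_N\<close> cannot reach. For k = 0 truncated subtraction makes both depths 0, and
  the family is merely redundant.\<close>

definition top_comb :: "nat \<Rightarrow> (int \<times> nat \<Rightarrow> 'f \<times> 'f) \<Rightarrow> 'p pmat \<Rightarrow> 'f poly poly" where
  "top_comb k c = (\<Sum>b\<in>branches. scale (fst (c b)) (br_atom (br_root b) k 0 Ypow) + scale (snd (c b)) (br_atom (br_root b) (k - 1) 0 Ypow))"

definition M :: "nat \<Rightarrow> ('p, 'f) gl2_fun set" where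
  "M k = top_comb k ` PiE branches (\<lambda>_. UNIV)"

lemma branches_finite [simp]: "finite branches"
  by (simp add: branches_def)

lemma M_card: "finite (M k)" "card (M k) \<le> CARD('f) ^ (2 * card branches)"
proof -
  have fin: "finite (PiE branches (\<lambda>_. UNIV :: ('f \<times> 'f) set))" by (rule finite_PiE) simp_all
  then show "finite (M k)" unfolding M_def by simp
  have "card (M k) \<le> card (PiE branches (\<lambda>_. UNIV :: ('f \<times> 'f) set))" unfolding M_def using fin by (rule card_image_le)
  also have "\<dots> = CARD('f) ^ (2 * card branches)" by (simp add: card_PiE power_mult power2_eq_square)
  finally show "card (M k) \<le> CARD('f) ^ (2 * card branches)" .
qed

lemma top_comb_M: "top_comb k c \<in> M k"
proof -
  have "top_comb k c = top_comb k (restrict c branches)" unfolding top_comb_def by (rule sum.cong) simp_all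
  then show ?thesis unfolding M_def by (rule image_eqI[where x = "restrict c branches"]) simp
qed

lemma M_subsp: "subsp (M k)"
proof -
  have scsum: "scale e (sum f A) = (\<Sum>i\<in>A. scale e (f i))" for e and f :: "int \<times> nat \<Rightarrow> 'p pmat \<Rightarrow> 'f poly poly" and A
    by (induction A rule: infinite_finite_induct) (simp_all only: sum.infinite sum.empty sum.insert scale_simps simp_thms)
  show ?thesis
    unfolding subsp_def
  proof (intro conjI ballI allI)
    have "top_comb k (\<lambda>_. (0, 0)) = 0" by (simp only: top_comb_def fst_conv snd_conv scale_simps add_0 sum.neutral_const)
    then show "0 \<in> M k" using top_comb_M[of k "\<lambda>_. (0, 0)"] by (simp only:)
  next
    fix f g assume "f \<in> M k" "g \<in> M k"
    then obtain c d where "f = top_comb k c" "g = top_comb k d" unfolding M_def by blast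
    then have "f + g = top_comb k (\<lambda>b. (fst (c b) + fst (d b), snd (c b) + snd (d b)))"
      by (simp add: top_comb_def scale_simps sum.distrib algebra_simps)
    then show "f + g \<in> M k" using top_comb_M[of k "\<lambda>b. (fst (c b) + fst (d b), snd (c b) + snd (d b))"] by (simp only:)
  next
    fix e f assume "f \<in> M k"
    then obtain c where "f = top_comb k c" unfolding M_def by blast
    then have "scale e f = top_comb k (\<lambda>b. (e * fst (c b), e * snd (c b)))"
      by (simp add: top_comb_def scale_simps scsum)
    then show "scale e f \<in> M k" using top_comb_M[of k "\<lambda>b. (e * fst (c b), e * snd (c b))"] by (simp only:)
  qed
qed

lemma M_top: "b \<in> branches \<Longrightarrow> br_atom (br_root b) k 0 Ypow \<in> M k" "b \<in> branches \<Longrightarrow> br_atom (br_root b) (k - 1) 0 Ypow \<in> M k"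
proof -
  assume b: "b \<in> branches"
  have "top_comb k (\<lambda>b'. if b' = b then (1, 0) else (0, 0)) = (\<Sum>b'\<in>branches. if b' = b then br_atom (br_root b) k 0 Ypow else 0)"
    unfolding top_comb_def by (rule sum.cong) (simp_all add: scale_simps)
  also have "\<dots> = br_atom (br_root b) k 0 Ypow" using b by simp
  finally show "br_atom (br_root b) k 0 Ypow \<in> M k" using top_comb_M[of k "\<lambda>b'. if b' = b then (1, 0) else (0, 0)"] by (simp only:)
  have "top_comb k (\<lambda>b'. if b' = b then (0, 1) else (0, 0)) = (\<Sum>b'\<in>branches. if b' = b then br_atom (br_root b) (k - 1) 0 Ypow else 0)"
    unfolding top_comb_def by (rule sum.cong) (simp_all add: scale_simps)
  also have "\<dots> = br_atom (br_root b) (k - 1) 0 Ypow" using b by simp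
  finally show "br_atom (br_root b) (k - 1) 0 Ypow \<in> M k" using top_comb_M[of k "\<lambda>b'. if b' = b then (0, 1) else (0, 0)"] by (simp only:)
qed

lemma N_subsp: "subsp (N k)"
proof -
  have "subsp (S ` V k)"
    unfolding subsp_def
  proof (intro conjI ballI allI)
    have "S 0 \<in> S ` V k" using subsp_D(1)[OF V_subsp] by (rule imageI)
    then show "0 \<in> S ` V k" unfolding S_linear .
  next
    fix f g assume "f \<in> S ` V k" "g \<in> S ` V k"
    then obtain a b where ab: "f = S a" "g = S b" "a \<in> V k" "b \<in> V k" by blast
    have "S (a + b) \<in> S ` V k" using subsp_D(2)[OF V_subsp ab(3,4)] by (rule imageI)
    then show "f + g \<in> S ` V k" unfolding S_linear ab .
  next
    fix c f assume "f \<in> S ` V k"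
    then obtain a where a: "f = S a" "a \<in> V k" by blast
    have "S (scale c a) \<in> S ` V k" using subsp_D(3)[OF V_subsp a(2)] by (rule imageI)
    then show "scale c f \<in> S ` V k" unfolding S_linear a .
  qed
  then show ?thesis unfolding N_def by (intro subsp_sum_set subsp_Int JE_subsp V_subsp)
qed

lemma N_I: "v \<in> V k \<Longrightarrow> S v \<in> N k" "d \<in> JE \<Longrightarrow> d \<in> V k \<Longrightarrow> d \<in> N k"
proof -
  have 0: "0 \<in> JE \<inter> V k" "0 \<in> S ` V k"
    using subsp_D(1)[OF JE_subsp] subsp_D(1)[OF V_subsp] S_linear(3) by (auto intro: image_eqI[of _ _ 0])
  show "S v \<in> N k" if "v \<in> V k" unfolding N_def using that 0(1) by (intro CollectI exI[of _ "S v"] exI[of _ 0]) simp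
  show "d \<in> N k" if "d \<in> JE" "d \<in> V k" unfolding N_def using that 0(2) by (intro CollectI exI[of _ 0] exI[of _ d]) simp
qed

lemma br_atom_N:
  assumes "b \<in> branches" "d \<le> k" "w \<in> Sym r"
  shows "br_atom (br_root b) d x w - scale (top_coeff w) (br_atom (br_root b) d 0 Ypow) \<in> N k"
proof (rule br_atom_coinvariants[OF N_subsp br_root_inv branch_mult_cong branch_offset_ndvd[OF assms(1)] _ assms(3)])
  fix x and w :: "'f poly poly" assume "w \<in> Sym r"
  then show "br_atom (br_root b) d (of_int (branch_mult b) * x - of_int (branch_offset b)) w - br_atom (br_root b) d x w \<in> N k"
    using N_I(1)[OF br_atom_V[OF assms(1,2)]] S_br_atom[OF assms(1)] by metis
qed

lemma outward_N:
  assumes "b \<in> branches" "d \<le> k"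
  shows "(\<Sum>i<CARD('p). br_atom (br_root b) d (x i) (Sym_act (mat2 1 (- of_nat i) 0 0) Ypow)) \<in> N k"
  using T_outward_coinvariants[OF N_subsp br_root_inv Ypow_Sym] br_atom_N[OF assms] by blast

lemma const_one_mult: "[:[:top_coeff Ypow:]:] * Ypow = Ypow"
  by (simp add: top_coeff_linear pCons_one)

text \<open>Apply T - lambda to the class of depth d + 1: the part towards the root is the class of
  depth \<open>d\<close>, and the outward part dies in the coinvariants. Before it dies it has depth
  d + 2, and the element of \<open>JE\<close> must lie in \<open>V k\<close>; this explains the
  condition on \<open>k\<close>.\<close>

lemma T_br_atom_N:
  assumes b: "b \<in> branches" and d: "Suc (Suc d) \<le> k"
  shows "br_atom (br_root b) d 0 Ypow - scale lam (br_atom (br_root b) (Suc d) 0 Ypow) \<in> N k"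
proof -
  let ?o = "\<Sum>i<CARD('p). br_atom (br_root b) (Suc (Suc d)) (0 - of_nat i * of_nat CARD('p) ^ Suc d) (Sym_act (mat2 1 (- of_nat i) 0 0) Ypow)"
  let ?A = "br_atom (br_root b) (Suc d) 0 Ypow"
  have T: "T ?A = br_atom (br_root b) d 0 Ypow + ?o"
    using T_br_atom[OF br_root_inv Ypow_Sym, of b d 0] unfolding const_one_mult .
  have "T ?A - scale lam ?A \<in> J" unfolding J_def using br_atom_ind_fns[OF br_root_inv Ypow_Sym] by blast
  then have 1: "T ?A - scale lam ?A \<in> JE" by (rule JE_I)
  have "?o \<in> V k" using b d by (intro subsp_sum[OF V_subsp] br_atom_V Sym_act_closed Ypow_Sym)
  then have "T ?A - scale lam ?A \<in> V k" unfolding T using b d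
    by (intro subsp_D(2,3,5)[OF V_subsp] br_atom_V Ypow_Sym) simp_all
  then have "T ?A - scale lam ?A \<in> N k" using 1 N_I(2) by blast
  then have "T ?A - scale lam ?A - ?o \<in> N k" by (rule subsp_D(5)[OF N_subsp]) (rule outward_N[OF b d])
  moreover have "T ?A - scale lam ?A - ?o = br_atom (br_root b) d 0 Ypow - scale lam ?A" unfolding T by (simp add: algebra_simps)
  ultimately show ?thesis by (simp only:)
qed

text \<open>The same relation at depth 0, where the part towards the root sits on the path and so
  belongs to \<open>E\<close>.\<close>

lemma T_br_root_N:
  assumes b: "b \<in> branches" and k: "1 \<le> k"
  shows "scale lam (br_atom (br_root b) 0 0 Ypow) \<in> N k"
proof -
  let ?o = "\<Sum>i<CARD('p). br_atom (br_root b) (Suc 0) (0 - of_nat i * of_nat CARD('p) ^ 0) (Sym_act (mat2 1 (- of_nat i) 0 0) Ypow)"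
  let ?A = "br_atom (br_root b) 0 0 Ypow" and ?P = "atom (parent_mat ** mat2 1 (to_fract 0) 0 (pp ^ 0) ** br_root b) Ypow"
  have T: "T ?A = ?P + ?o" using T_Av0[OF br_root_inv Ypow_Sym, of b 0 0] unfolding const_one_mult .
  have P: "?P \<in> E" by (rule atom_E[OF br_root_parent[OF b] _ Ypow_Sym]) (intro invertible_mult parent_mat_inv br_atom_inv br_root_inv)
  have "T ?A - scale lam ?A \<in> J" unfolding J_def using br_atom_ind_fns[OF br_root_inv Ypow_Sym] by blast
  then have 1: "T ?A - scale lam ?A \<in> JE" by (rule JE_I)
  have "?o \<in> V k" using b k by (intro subsp_sum[OF V_subsp] br_atom_V Sym_act_closed Ypow_Sym) simp_all
  then have "T ?A - scale lam ?A \<in> V k" unfolding T using b k P E_V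
    by (intro subsp_D(2,3,5)[OF V_subsp] br_atom_V Ypow_Sym) auto
  then have "T ?A - scale lam ?A \<in> N k" using 1 N_I(2) by blast
  moreover have "?P \<in> N k" using P JE_I(2) E_V N_I(2) by blast
  moreover have "?o \<in> N k" using outward_N[OF b] k by simp
  ultimately have "?P + ?o - (T ?A - scale lam ?A) \<in> N k" using subsp_D(2,5)[OF N_subsp] by blast
  moreover have "?P + ?o - (T ?A - scale lam ?A) = scale lam ?A" unfolding T by (simp add: algebra_simps)
  ultimately show ?thesis by (simp only:)
qed

text \<open>For lambda = 0 the recursion gives the claim at each depth separately. Otherwise lambda
  can be cancelled, and the vanishing spreads outward from depth 0.\<close>

lemma br_atom_low:
  assumes b: "b \<in> branches" and d: "d + 2 \<le> k"
  shows "br_atom (br_root b) d 0 Ypow \<in> N k"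
proof (cases "lam = 0")
  case True
  then show ?thesis using T_br_atom_N[OF b, of d k] d by (simp add: scale_simps)
next
  case False
  have unsc: "f \<in> N k" if "scale lam f \<in> N k" for f
    using subsp_D(3)[OF N_subsp that, of "inverse lam"] False by (simp add: scale_simps)
  show ?thesis
    using d
  proof (induction d)
    case 0
    then show ?case using T_br_root_N[OF b, of k] unsc by simp
  next
    case (Suc d)
    then have "br_atom (br_root b) d 0 Ypow \<in> N k" "br_atom (br_root b) d 0 Ypow - scale lam (br_atom (br_root b) (Suc d) 0 Ypow) \<in> N k"
      using T_br_atom_N[OF b, of d k] by simp_all
    then have "br_atom (br_root b) d 0 Ypow - (br_atom (br_root b) d 0 Ypow - scale lam (br_atom (br_root b) (Suc d) 0 Ypow)) \<in> N k"
      by (rule subsp_D(5)[OF N_subsp])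
    then have "scale lam (br_atom (br_root b) (Suc d) 0 Ypow) \<in> N k" by (simp only: diff_diff_eq2 add_diff_cancel_left')
    then show ?case by (rule unsc)
  qed
qed

lemma V_span:
  assumes "f \<in> V k" shows "\<exists>m\<in>M k. \<exists>v\<in>V k. \<exists>d\<in>JE \<inter> V k. f = m + (S v + d)"
proof -
  let ?F = "{m + z | m z. m \<in> M k \<and> z \<in> N k}"
  have F: "subsp ?F" by (intro subsp_sum_set M_subsp N_subsp)
  have FM: "m \<in> ?F" if "m \<in> M k" for m
    using that subsp_D(1)[OF N_subsp] by (intro CollectI exI[of _ m] exI[of _ 0]) simp
  have FN: "z \<in> ?F" if "z \<in> N k" for z
    using that subsp_D(1)[OF M_subsp] by (intro CollectI exI[of _ 0] exI[of _ z]) simp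
  have "f \<in> ?F"
    using assms[unfolded V_def] F
  proof (rule fns_on_induct)
    fix g and w :: "'f poly poly" assume g: "invertible g" "g \<in> nbhd k" "w \<in> Sym r"
    from g(2,1,3) show "atom g w \<in> ?F"
    proof (cases rule: br_atom_cases)
      case 1
      then have "atom g w \<in> E" using g atom_E by blast
      then show ?thesis using FN N_I(2) JE_I(2) E_V by blast
    next
      case (2 b d x w')
      have "br_atom (br_root b) d 0 Ypow \<in> ?F"
      proof (cases "d + 2 \<le> k")
        case True
        then show ?thesis using FN br_atom_low[OF 2(1)] by blast
      next
        case False
        then have "d = k \<or> d = k - 1" using 2(2) by linarith
        then show ?thesis using FM M_top[OF 2(1)] by blast
      qed
      then have "scale (top_coeff w') (br_atom (br_root b) d 0 Ypow) \<in> ?F" by (rule subsp_D(3)[OF F])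
      moreover have "br_atom (br_root b) d x w' - scale (top_coeff w') (br_atom (br_root b) d 0 Ypow) \<in> ?F" using FN br_atom_N[OF 2(1-3)] by blast
      ultimately have "br_atom (br_root b) d x w' - scale (top_coeff w') (br_atom (br_root b) d 0 Ypow) + scale (top_coeff w') (br_atom (br_root b) d 0 Ypow) \<in> ?F"
        using subsp_D(2)[OF F] by blast
      then show ?thesis unfolding 2(4) by (simp only: diff_add_cancel)
    qed
  qed
  then show ?thesis unfolding N_def by blast
qed

section \<open>Counting invariant classes\<close>

lemma incongruent_card:
  assumes X: "finite X" "X \<subseteq> ind_fns" "\<And>f c. f \<in> X \<Longrightarrow> right_transl (shifter c) f - f \<in> J"
    and inc: "\<And>f g. f \<in> X \<Longrightarrow> g \<in> X \<Longrightarrow> f - g \<in> J \<Longrightarrow> f = g"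
  shows "card X \<le> CARD('f) ^ (2 * card branches + Suc r * (2 * n + 1))"
proof -
  obtain k where k: "X \<subseteq> V k"
  proof -
    have "\<exists>k. X \<subseteq> V k" using X(1,2)
    proof (induction X rule: finite_induct)
      case (insert f F)
      then obtain k l where "F \<subseteq> V k" "f \<in> V l" using V_exhaust by blast
      then have "insert f F \<subseteq> V (max k l)" using V_mono[of k "max k l"] V_mono[of l "max k l"] by auto
      then show ?case by blast
    qed simp
    then show ?thesis using that by blast
  qed
  \<comment> \<open>The depth \<open>k\<close> depends on \<open>X\<close>, the final bound does
    not. All sums x + j with x in \<open>X\<close> and j in \<open>?J\<close> lie in the preimage of
    \<open>?D\<close>, so |X| |?J| <= |M k| |?D|; since |?D| <= |?J| |E|, the factor |?J|
    cancels.\<close>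
  let ?D = "JE \<inter> V k" and ?J = "J \<inter> V k"
  have Dsub: "subsp ?D" by (intro subsp_Int JE_subsp V_subsp)
  have Jsub: "subsp ?J" by (intro subsp_Int J_subsp V_subsp)
  have K: "card {v \<in> V k. S v \<in> ?D} \<le> card (M k) * card ?D"
    by (rule card_preimage_le)
      (rule V_finite S_V S_linear(1) M_card(1) V_span Int_lower2 subsp_D(1,2)[OF V_subsp] subsp_D(1,2,4)[OF Dsub]; assumption)+
  have finD: "finite ?D" "finite ?J" "finite E" using V_finite E_V finite_subset by blast+
  have "?D \<subseteq> (\<lambda>(j, e). j + e) ` (?J \<times> E)"
  proof
    fix d assume d: "d \<in> ?D"
    then obtain j e where je: "d = j + e" "j \<in> J" "e \<in> E" unfolding JE_def by blast
    have "j = d - e" using je by simp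
    then have "j \<in> V k" using d je E_V subsp_D(5)[OF V_subsp] by blast
    then show "d \<in> (\<lambda>(j, e). j + e) ` (?J \<times> E)" using je by (intro image_eqI[where x = "(j, e)"]) auto
  qed
  then have D: "card ?D \<le> card ?J * card E"
    using surj_card_le[of "?J \<times> E" ?D] finD by (simp add: card_cartesian_product)
  let ?h = "\<lambda>(x, j). x + j :: 'p pmat \<Rightarrow> 'f poly poly"
  have "inj_on ?h (X \<times> ?J)"
  proof (rule inj_onI)
    fix a b assume a: "a \<in> X \<times> ?J" and b: "b \<in> X \<times> ?J" and eq: "?h a = ?h b"
    obtain x i y j where xy: "a = (x, i)" "b = (y, j)" "x \<in> X" "y \<in> X" "i \<in> J" "j \<in> J" using a b by blast
    have e: "x + i = y + j" using eq by (simp add: xy)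
    have "x = y + j - i" using e by (simp only: eq_diff_eq)
    then have "x - y = j - i" by simp
    then have "x - y \<in> J" using xy subsp_D(5)[OF J_subsp] by metis
    then have "x = y" using inc xy by blast
    then show "a = b" using e xy by simp
  qed
  moreover have "?h ` (X \<times> ?J) \<subseteq> {v \<in> V k. S v \<in> ?D}"
  proof
    fix y assume "y \<in> ?h ` (X \<times> ?J)"
    then obtain x j where xj: "y = x + j" "x \<in> X" "j \<in> ?J" by auto
    have "S x \<in> JE" using X(3) xj(2) by (intro S_JE)
    moreover have "right_transl (shifter c) j - j \<in> J" for c
      using xj(3) right_transl_J[OF _ shifter_inv] subsp_D(5)[OF J_subsp] by blast
    then have "S j \<in> JE" by (rule S_JE)
    ultimately have "S y \<in> JE" unfolding xj(1) S_linear by (rule subsp_D(2)[OF JE_subsp])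
    moreover have "y \<in> V k" unfolding xj(1) using xj k by (intro subsp_D(2)[OF V_subsp]) auto
    ultimately show "y \<in> {v \<in> V k. S v \<in> ?D}" using S_V by blast
  qed
  moreover have "finite {v \<in> V k. S v \<in> ?D}" using V_finite by simp
  ultimately have "card (X \<times> ?J) \<le> card {v \<in> V k. S v \<in> ?D}" by (rule card_inj_on_le)
  then have "card X * card ?J \<le> card (M k) * card ?D" using K by (simp add: card_cartesian_product)
  also have "\<dots> \<le> card (M k) * (card ?J * card E)" using D by (rule mult_le_mono2)
  finally have "card X * card ?J \<le> (card (M k) * card E) * card ?J" by (simp only: ac_simps)
  moreover have "card ?J > 0" using finD(2) subsp_D(1)[OF Jsub] by (auto simp only: card_gt_0_iff)
  ultimately have "card X \<le> card (M k) * card E" by simp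
  also have "\<dots> \<le> CARD('f) ^ (2 * card branches) * CARD('f) ^ (Suc r * (2 * n + 1))"
    using M_card(2) E_card by (rule mult_le_mono)
  finally show ?thesis by (simp only: power_add)
qed

lemma branches_card: "card branches \<le> 2 + 2 * n * CARD('p)"
proof -
  have "card branches \<le> card {(- int n, 0 :: nat), (int n, 0)} + card ({- int n<..<int n} \<times> {1..<CARD('p)})"
    unfolding branches_def by (rule card_Un_le)
  also have "card {(- int n, 0 :: nat), (int n, 0)} \<le> 2" by (simp add: card_insert_if)
  also have "card ({- int n<..<int n} \<times> {1..<CARD('p)}) \<le> 2 * n * CARD('p)"
    unfolding card_cartesian_product by (intro mult_le_mono) simp_all
  finally show ?thesis by simp
qed

end

section \<open>The quotient as a vector space\<close>

text \<open>A basis of b vectors over a field of q elements gives q^b different linear combinations,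
  so b is at most \<open>m\<close>.\<close>

lemma finite_vectorspace_dim:
  assumes vs: "vectorspace K V" and finV: "finite (carrier V)" and cardV: "card (carrier V) \<le> card (carrier K) ^ m"
    and K: "card (carrier K) \<ge> 2"
  shows "vectorspace.fin_dim K V" "vectorspace.dim K V \<le> m"
proof -
  interpret vectorspace K V by fact
  \<comment> \<open>A finite space is spanned by all of its elements, which yields finite dimension
    before any basis is known.\<close>
  have "carrier V \<subseteq> span (carrier V)" by (rule in_own_span) (rule order.refl)
  moreover have "span (carrier V) \<subseteq> carrier V" by (rule span_is_subset2) (rule order.refl)
  ultimately have gen: "span (carrier V) = carrier V" by blast
  show fd: "fin_dim" unfolding fin_dim_def using finV gen by (intro exI[of _ "carrier V"]) simp
  obtain B where B: "finite B" "basis B" using finite_basis_exists[OF fd] by blast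
  then have BV: "B \<subseteq> carrier V" by (simp add: basis_def)
  have "\<And>v. v \<in> carrier V \<Longrightarrow> \<exists>!a. a \<in> B \<rightarrow>\<^sub>E carrier K \<and> lincomb a B = v"
    using basis_criterion[OF B(1) BV] B(2) by blast
  moreover have "lincomb a B \<in> carrier V" if "a \<in> B \<rightarrow>\<^sub>E carrier K" for a
    using that BV by (intro lincomb_closed) auto
  ultimately have "inj_on (\<lambda>a. lincomb a B) (B \<rightarrow>\<^sub>E carrier K)" "(\<lambda>a. lincomb a B) ` (B \<rightarrow>\<^sub>E carrier K) \<subseteq> carrier V"
    unfolding inj_on_def by blast+
  then have "card (B \<rightarrow>\<^sub>E carrier K) \<le> card (carrier V)" using finV by (rule card_inj_on_le)
  then have "card (carrier K) ^ card B \<le> card (carrier K) ^ m" using cardV B(1) by (simp add: card_PiE)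
  then have "card B \<le> m" using K by (simp add: power_le_imp_le_exp)
  then show "dim \<le> m" using dim_basis[OF B] by simp
qed

lemma ring_of_field_field: "field (ring_of_field :: 'a::field ring)"
proof -
  have "cring (ring_of_field :: 'a ring)"
    by (rule cringI, rule abelian_groupI)
      (auto simp: ring_of_field_def algebra_simps intro!: comm_monoidI exI[of _ "- x" for x])
  then interpret cring "ring_of_field :: 'a ring" .
  show ?thesis
  proof (rule cring_fieldI2)
    fix a :: 'a assume "a \<noteq> \<zero>\<^bsub>ring_of_field\<^esub>"
    then show "\<exists>b\<in>carrier ring_of_field. a \<otimes>\<^bsub>ring_of_field\<^esub> b = \<one>\<^bsub>ring_of_field\<^esub>"
      by (auto simp: ring_of_field_def intro!: exI[of _ "inverse a"])
  qed (simp add: ring_of_field_def)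
qed

context gl2
begin

section \<open>Cosets of the image of T - lambda and invariant classes\<close>

definition coset_of :: "('p, 'f) gl2_fun \<Rightarrow> ('p, 'f) gl2_fun set" where
  "coset_of a = (\<lambda>j. j + a) ` J"

lemma cInd_add: "f \<oplus>\<^bsub>cInd r\<^esub> g = f + g"
  by (simp add: cInd_def plus_fun_def)

lemma cInd_smult: "c \<odot>\<^bsub>cInd r\<^esub> f = scale c f"
  by (simp add: cInd_def scale_def)

lemma image_J: "(\<lambda>f g. hecke_T r f g - [:[:lam:]:] * f g) ` carrier (cInd r) = J"
proof -
  have "(\<lambda>f g. hecke_T r f g - [:[:lam:]:] * f g) = (\<lambda>f. T f - scale lam f)"
    unfolding scale_def by (intro ext) (simp only: minus_apply)
  then show ?thesis unfolding J_def ind_fns_carrier by (simp only:)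
qed

lemma coset_of_coset: "J +>\<^bsub>cInd r\<^esub> a = coset_of a"
  by (auto simp: a_r_coset_def' cInd_add coset_of_def)

lemma J_closed: "0 \<in> J" "f \<in> J \<Longrightarrow> g \<in> J \<Longrightarrow> f + g \<in> J" "f \<in> J \<Longrightarrow> scale c f \<in> J" "f \<in> J \<Longrightarrow> - f \<in> J" "f \<in> J \<Longrightarrow> g \<in> J \<Longrightarrow> f - g \<in> J"
  by (rule subsp_D[OF J_subsp]; assumption)+

lemma coset_of_self: "a \<in> coset_of a"
  unfolding coset_of_def by (rule image_eqI[OF _ J_closed(1)]) simp

lemma coset_of_mem: "b \<in> coset_of a \<longleftrightarrow> b - a \<in> J"
proof
  assume "b - a \<in> J"
  then show "b \<in> coset_of a" unfolding coset_of_def by (intro image_eqI[of _ _ "b - a"]) simp_all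
qed (auto simp: coset_of_def)

lemma coset_of_eq_iff: "coset_of a = coset_of b \<longleftrightarrow> a - b \<in> J"
proof
  assume "coset_of a = coset_of b"
  then show "a - b \<in> J" using coset_of_self[of a] coset_of_mem by blast
next
  assume ab: "a - b \<in> J"
  have "x - a \<in> J \<longleftrightarrow> x - b \<in> J" for x
  proof
    assume "x - a \<in> J"
    then have "(x - a) + (a - b) \<in> J" using ab by (rule J_closed)
    then show "x - b \<in> J" by simp
  next
    assume "x - b \<in> J"
    then have "(x - b) - (a - b) \<in> J" using ab by (rule J_closed)
    then show "x - a \<in> J" by simp
  qed
  then show "coset_of a = coset_of b" using coset_of_mem by blast
qed

lemma coset_of_zero: "coset_of 0 = J"
  by (simp add: coset_of_def)

lemma pi_rep_simps:
  "carrier (pi_rep r lam) = coset_of ` ind_fns" "\<zero>\<^bsub>pi_rep r lam\<^esub> = coset_of 0"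
  "coset_of a \<oplus>\<^bsub>pi_rep r lam\<^esub> coset_of b = coset_of (a + b)" "c \<odot>\<^bsub>pi_rep r lam\<^esub> coset_of a = coset_of (scale c a)"
proof -
  have rep: "pi_rep r lam = quot_module (cInd r) J" unfolding pi_rep_def image_J ..
  show "carrier (pi_rep r lam) = coset_of ` ind_fns"
    unfolding rep quot_module_def by (auto simp: A_RCOSETS_def' coset_of_coset ind_fns_carrier)
  show "\<zero>\<^bsub>pi_rep r lam\<^esub> = coset_of 0" unfolding rep quot_module_def coset_of_zero by simp
  have "coset_of a <+>\<^bsub>cInd r\<^esub> coset_of b = coset_of (a + b)"
  proof (rule Set.set_eqI)
    fix x
    show "x \<in> coset_of a <+>\<^bsub>cInd r\<^esub> coset_of b \<longleftrightarrow> x \<in> coset_of (a + b)"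
    proof
      assume "x \<in> coset_of a <+>\<^bsub>cInd r\<^esub> coset_of b"
      then obtain y z where yz: "y - a \<in> J" "z - b \<in> J" "x = y + z"
        by (auto simp: set_add_def' cInd_add coset_of_mem)
      have "(y - a) + (z - b) \<in> J" using yz(1,2) by (rule J_closed)
      then show "x \<in> coset_of (a + b)" by (simp add: coset_of_mem yz algebra_simps)
    next
      assume "x \<in> coset_of (a + b)"
      then have "x - b \<in> coset_of a" by (simp add: coset_of_mem algebra_simps)
      moreover have "x = (x - b) + b" by simp
      ultimately show "x \<in> coset_of a <+>\<^bsub>cInd r\<^esub> coset_of b"
        unfolding set_add_def' cInd_add using coset_of_self by blast
    qed
  qed
  then show "coset_of a \<oplus>\<^bsub>pi_rep r lam\<^esub> coset_of b = coset_of (a + b)" unfolding rep quot_module_def by simp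
  have "coset_of (scale c x) = coset_of (scale c a)" if x: "x \<in> coset_of a" for x
  proof -
    have "scale c (x - a) \<in> J" using x J_closed(3) by (simp add: coset_of_mem)
    then show ?thesis by (simp add: coset_of_eq_iff scale_simps)
  qed
  then have "(\<Union>x\<in>coset_of a. coset_of (scale c x)) = coset_of (scale c a)" using coset_of_self by blast
  then show "c \<odot>\<^bsub>pi_rep r lam\<^esub> coset_of a = coset_of (scale c a)"
    unfolding rep quot_module_def by (simp add: coset_of_coset cInd_smult)
qed

lemma right_transl_linear: "right_transl h (f + g) = right_transl h f + right_transl h g"
  "right_transl h (f - g) = right_transl h f - right_transl h g"
  "right_transl h (scale c f) = scale c (right_transl h f)"
  by (auto simp: right_transl_def scale_def)

lemma right_transl_coset_of:
  assumes h: "invertible h"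
  shows "right_transl h ` coset_of a = coset_of (right_transl h a)"
proof (rule Set.set_eqI)
  fix x :: "('p, 'f) gl2_fun"
  have inv: "right_transl h (right_transl (matrix_inv h) x) = x"
    using h by (simp add: right_transl_def)
  have inv': "right_transl (matrix_inv h) (right_transl h x) = x" for x :: "('p, 'f) gl2_fun"
    using h by (simp add: right_transl_def)
  show "x \<in> right_transl h ` coset_of a \<longleftrightarrow> x \<in> coset_of (right_transl h a)"
  proof
    assume "x \<in> right_transl h ` coset_of a"
    then obtain y where y: "y - a \<in> J" "x = right_transl h y" using coset_of_mem by blast
    then show "x \<in> coset_of (right_transl h a)"
      using right_transl_J[OF y(1) h] by (simp add: coset_of_mem right_transl_linear)
  next
    assume "x \<in> coset_of (right_transl h a)"
    then have "right_transl (matrix_inv h) (x - right_transl h a) \<in> J"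
      using h by (intro right_transl_J) (simp_all add: coset_of_mem)
    then have "right_transl (matrix_inv h) x \<in> coset_of a" by (simp add: coset_of_mem right_transl_linear inv')
    then show "x \<in> right_transl h ` coset_of a" using inv by (metis image_eqI)
  qed
qed

text \<open>Invariance of a coset means invariance of a representative only modulo \<open>J\<close>;
  an honestly invariant representative is not asked for.\<close>

definition inv_reps :: "('p pmat) set \<Rightarrow> ('p, 'f) gl2_fun set" where
  "inv_reps H = {a \<in> ind_fns. \<forall>h\<in>H. right_transl h a - a \<in> J}"

lemma inv_reps_subsp: "subsp (inv_reps H)"
  unfolding subsp_def
proof (intro conjI ballI allI)
  have "right_transl h 0 = (0 :: ('p, 'f) gl2_fun)" for h :: "'p pmat" by (auto simp: right_transl_def)
  then show "0 \<in> inv_reps H" unfolding inv_reps_def using J_closed(1) by (intro CollectI conjI ind_fns_zero ballI) (simp only: diff_self)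
next
  fix f g assume fg: "f \<in> inv_reps H" "g \<in> inv_reps H"
  have "right_transl h (f + g) - (f + g) \<in> J" if "h \<in> H" for h
  proof -
    have "(right_transl h f - f) + (right_transl h g - g) \<in> J" using fg that by (intro J_closed(2)) (auto simp: inv_reps_def)
    then show ?thesis by (simp add: right_transl_linear algebra_simps)
  qed
  then show "f + g \<in> inv_reps H" using fg ind_fns_add by (auto simp: inv_reps_def)
next
  fix c f assume f: "f \<in> inv_reps H"
  have "right_transl h (scale c f) - scale c f \<in> J" if "h \<in> H" for h
  proof -
    have "scale c (right_transl h f - f) \<in> J" using f that by (intro J_closed(3)) (auto simp: inv_reps_def)
    then show ?thesis by (simp add: right_transl_linear scale_simps)
  qed
  then show "scale c f \<in> inv_reps H" using f ind_fns_scale by (auto simp: inv_reps_def)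
qed

lemma invariants_carrier:
  fixes H :: "('p pmat) set"
  assumes H: "\<And>h. h \<in> H \<Longrightarrow> invertible h"
  shows "carrier (invariants (pi_rep r lam) H) = coset_of ` inv_reps H"
proof -
  have eq: "right_transl h ` coset_of a = coset_of a \<longleftrightarrow> right_transl h a - a \<in> J" if "h \<in> H" for h a
    unfolding right_transl_coset_of[OF H[OF that]] by (rule coset_of_eq_iff)
  have "{A \<in> coset_of ` ind_fns. \<forall>h\<in>H. right_transl h ` A = A} = coset_of ` {a \<in> ind_fns. \<forall>h\<in>H. right_transl h ` coset_of a = coset_of a}"
    by (rule Compr_image_eq)
  also have "{a \<in> ind_fns. \<forall>h\<in>H. right_transl h ` coset_of a = coset_of a} = inv_reps H" unfolding inv_reps_def using eq by simp
  finally have "{A \<in> coset_of ` ind_fns. \<forall>h\<in>H. right_transl h ` A = A} = coset_of ` inv_reps H" .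
  then show ?thesis by (simp add: invariants_def pi_rep_simps)
qed

lemma invariants_simps:
  fixes H :: "('p pmat) set"
  shows "\<zero>\<^bsub>invariants (pi_rep r lam) H\<^esub> = coset_of 0" "coset_of a \<oplus>\<^bsub>invariants (pi_rep r lam) H\<^esub> coset_of b = coset_of (a + b)"
  "c \<odot>\<^bsub>invariants (pi_rep r lam) H\<^esub> coset_of a = coset_of (scale c a)"
  using pi_rep_simps by (simp_all add: invariants_def)

lemma invariants_vectorspace:
  fixes H :: "('p pmat) set"
  assumes H: "\<And>h. h \<in> H \<Longrightarrow> invertible h"
  shows "vectorspace ring_of_field (invariants (pi_rep r lam) H)"
proof -
  let ?V = "invariants (pi_rep r lam) H"
  have c: "carrier ?V = coset_of ` inv_reps H" by (rule invariants_carrier) (rule H)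
  note X = subsp_D[OF inv_reps_subsp[of H]]
  have K: "field (ring_of_field :: 'f ring)" by (rule ring_of_field_field)
  then interpret K: field "ring_of_field :: 'f ring" .
  have cl: "\<exists>a\<in>inv_reps H. v = coset_of a" if "v \<in> carrier ?V" for v using that unfolding c by blast
  have "module (ring_of_field :: 'f ring) ?V"
  proof (rule module_criteria)
    show "cring (ring_of_field :: 'f ring)" by (rule K.is_cring)
    show "\<zero>\<^bsub>?V\<^esub> \<in> carrier ?V" unfolding c invariants_simps using X(1) by blast
    show "\<forall>v w. v \<in> carrier ?V \<and> w \<in> carrier ?V \<longrightarrow> v \<oplus>\<^bsub>?V\<^esub> w \<in> carrier ?V"
      unfolding c using X(2) by (auto simp only: invariants_simps intro!: imageI)
    show "\<forall>v\<in>carrier ?V. \<exists>w\<in>carrier ?V. v \<oplus>\<^bsub>?V\<^esub> w = \<zero>\<^bsub>?V\<^esub>"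
    proof
      fix v assume "v \<in> carrier ?V"
      then obtain a where a: "a \<in> inv_reps H" "v = coset_of a" using cl by blast
      have "v \<oplus>\<^bsub>?V\<^esub> coset_of (- a) = \<zero>\<^bsub>?V\<^esub>" unfolding a(2) invariants_simps add.right_inverse ..
      then show "\<exists>w\<in>carrier ?V. v \<oplus>\<^bsub>?V\<^esub> w = \<zero>\<^bsub>?V\<^esub>" unfolding c using X(4)[OF a(1)] by blast
    qed
    show "\<forall>e v. e \<in> carrier ring_of_field \<and> v \<in> carrier ?V \<longrightarrow> e \<odot>\<^bsub>?V\<^esub> v \<in> carrier ?V"
      unfolding c using X(3) by (auto simp only: invariants_simps intro!: imageI)
    show "\<forall>v w. v \<in> carrier ?V \<and> w \<in> carrier ?V \<longrightarrow> v \<oplus>\<^bsub>?V\<^esub> w = w \<oplus>\<^bsub>?V\<^esub> v"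
      unfolding c by (auto simp only: invariants_simps add.commute)
    show "\<forall>v w x. v \<in> carrier ?V \<and> w \<in> carrier ?V \<and> x \<in> carrier ?V \<longrightarrow> v \<oplus>\<^bsub>?V\<^esub> w \<oplus>\<^bsub>?V\<^esub> x = v \<oplus>\<^bsub>?V\<^esub> (w \<oplus>\<^bsub>?V\<^esub> x)"
      unfolding c by (auto simp only: invariants_simps add.assoc)
    show "\<forall>v\<in>carrier ?V. v \<oplus>\<^bsub>?V\<^esub> \<zero>\<^bsub>?V\<^esub> = v"
      unfolding c by (auto simp only: invariants_simps add_0_right)
    show "\<forall>a b v. a \<in> carrier ring_of_field \<and> b \<in> carrier ring_of_field \<and> v \<in> carrier ?V \<longrightarrow>
        (a \<otimes>\<^bsub>ring_of_field\<^esub> b) \<odot>\<^bsub>?V\<^esub> v = a \<odot>\<^bsub>?V\<^esub> (b \<odot>\<^bsub>?V\<^esub> v)"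
      unfolding c by (auto simp only: invariants_simps scale_simps ring_of_field_def monoid.simps)
    show "\<forall>v\<in>carrier ?V. \<one>\<^bsub>ring_of_field\<^esub> \<odot>\<^bsub>?V\<^esub> v = v"
      unfolding c by (auto simp only: invariants_simps scale_simps ring_of_field_def monoid.simps)
    show "\<forall>a b v. a \<in> carrier ring_of_field \<and> b \<in> carrier ring_of_field \<and> v \<in> carrier ?V \<longrightarrow>
        (a \<oplus>\<^bsub>ring_of_field\<^esub> b) \<odot>\<^bsub>?V\<^esub> v = a \<odot>\<^bsub>?V\<^esub> v \<oplus>\<^bsub>?V\<^esub> b \<odot>\<^bsub>?V\<^esub> v"
      unfolding c by (auto simp only: invariants_simps scale_simps ring_of_field_def ring.simps)
    show "\<forall>a v w. a \<in> carrier ring_of_field \<and> v \<in> carrier ?V \<and> w \<in> carrier ?V \<longrightarrow>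
        a \<odot>\<^bsub>?V\<^esub> (v \<oplus>\<^bsub>?V\<^esub> w) = a \<odot>\<^bsub>?V\<^esub> v \<oplus>\<^bsub>?V\<^esub> a \<odot>\<^bsub>?V\<^esub> w"
      unfolding c by (auto simp only: invariants_simps scale_simps)
  qed
  then show ?thesis using K by (rule vectorspace.intro)
qed

end

context gl2_level
begin

lemma T1_invertible: "h \<in> T1 n \<Longrightarrow> invertible (h :: 'p pmat)"
  using T1_KZ KZ_invertible by blast

text \<open>Finiteness is not known in advance: \<open>incongruent_card\<close> bounds every finite
  set of invariant classes through chosen representatives, and a uniform bound on the finite subsets
  makes the whole set finite.\<close>

lemma invariants_card:
  "finite (carrier (invariants (pi_rep r lam) (T1 n :: ('p pmat) set)))"
  "card (carrier (invariants (pi_rep r lam) (T1 n :: ('p pmat) set))) \<le> CARD('f) ^ (2 * card branches + Suc r * (2 * n + 1))"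
proof -
  let ?Y = "carrier (invariants (pi_rep r lam) (T1 n :: ('p pmat) set))"
  have bound: "card F \<le> CARD('f) ^ (2 * card branches + Suc r * (2 * n + 1))" if F: "F \<subseteq> ?Y" "finite F" for F
  proof -
    have "F \<subseteq> coset_of ` inv_reps (T1 n)"
      using F(1) invariants_carrier[of "T1 n"] T1_invertible by simp
    then have "\<forall>A\<in>F. \<exists>a. a \<in> inv_reps (T1 n) \<and> A = coset_of a" by blast
    then obtain s where s: "\<And>A. A \<in> F \<Longrightarrow> s A \<in> inv_reps (T1 n) \<and> A = coset_of (s A)" by metis
    then have "inj_on s F" by (metis inj_onI)
    then have "card F = card (s ` F)" by (simp add: card_image)
    also have "\<dots> \<le> CARD('f) ^ (2 * card branches + Suc r * (2 * n + 1))"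
    proof (rule incongruent_card)
      show "finite (s ` F)" using F(2) by simp
      show "s ` F \<subseteq> ind_fns" using s by (auto simp: inv_reps_def)
      show "right_transl (shifter c) f - f \<in> J" if "f \<in> s ` F" for f c
        using that s shifter_T1 by (auto simp: inv_reps_def)
      show "f = g" if fg: "f \<in> s ` F" "g \<in> s ` F" "f - g \<in> J" for f g
      proof -
        obtain A B where "A \<in> F" "B \<in> F" "f = s A" "g = s B" using fg by blast
        moreover from this have "A = B" using s fg(3) coset_of_eq_iff by metis
        ultimately show ?thesis by simp
      qed
    qed
    finally show ?thesis .
  qed
  have "finite ?Y \<and> card ?Y \<le> CARD('f) ^ (2 * card branches + Suc r * (2 * n + 1))"
    by (rule finite_if_finite_subsets_card_bdd) (use bound in blast)
  then show "finite ?Y" "card ?Y \<le> CARD('f) ^ (2 * card branches + Suc r * (2 * n + 1))" by auto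
qed

lemma invariants_dim:
  "vectorspace.fin_dim ring_of_field (invariants (pi_rep r lam) (T1 n :: ('p pmat) set))"
  "vectorspace.dim ring_of_field (invariants (pi_rep r lam) (T1 n :: ('p pmat) set)) \<le> 2 * card branches + Suc r * (2 * n + 1)"
proof -
  have vs: "vectorspace ring_of_field (invariants (pi_rep r lam) (T1 n :: ('p pmat) set))"
    by (rule invariants_vectorspace) (rule T1_invertible)
  have K: "carrier (ring_of_field :: 'f ring) = UNIV" by (simp add: ring_of_field_def)
  have "card {0, 1 :: 'f} \<le> CARD('f)" by (rule card_mono) simp_all
  then have 2: "card (carrier (ring_of_field :: 'f ring)) \<ge> 2" unfolding K by simp
  have card: "card (carrier (invariants (pi_rep r lam) (T1 n :: ('p pmat) set)))
      \<le> card (carrier (ring_of_field :: 'f ring)) ^ (2 * card branches + Suc r * (2 * n + 1))"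
    unfolding K by (rule invariants_card(2))
  show "vectorspace.fin_dim ring_of_field (invariants (pi_rep r lam) (T1 n :: ('p pmat) set))"
    "vectorspace.dim ring_of_field (invariants (pi_rep r lam) (T1 n :: ('p pmat) set)) \<le> 2 * card branches + Suc r * (2 * n + 1)"
    using finite_vectorspace_dim[OF vs invariants_card(1) card 2] by blast+
qed

end

theorem theorem4p2:
  fixes r :: nat and lam :: "'f::{field,finite}"
  assumes "CARD('p::prime_card) \<ge> 5" and "CHAR('f) = CARD('p)" and "r \<le> CARD('p) - 1"
  shows "\<exists>C::real. \<forall>n\<ge>1.
    vectorspace.fin_dim ring_of_field
      (invariants (pi_rep r lam) (T1 n :: ('p padic ^ 2 ^ 2) set)) \<and>
    real (vectorspace.dim ring_of_field
      (invariants (pi_rep r lam) (T1 n :: ('p padic ^ 2 ^ 2) set))) \<le> C * real n"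
proof (intro exI allI impI conjI)
  fix n :: nat assume n: "n \<ge> 1"
  interpret gl2_level "TYPE('p)" r lam n
    using assms n by unfold_locales
  show "vectorspace.fin_dim ring_of_field (invariants (pi_rep r lam) (T1 n :: ('p pmat) set))"
    by (rule invariants_dim)
  have "2 * card branches + Suc r * (2 * n + 1) \<le> 2 * (2 + 2 * n * CARD('p)) + Suc r * (2 * n + 1)"
    using branches_card by simp
  \<comment> \<open>Here n >= 1 absorbs the constant terms, which gives the constant 4 + 4 p + 3 (r
    + 1).\<close>
  also have "\<dots> \<le> 2 * (2 * n + 2 * n * CARD('p)) + Suc r * (2 * n + n)"
    using n by (intro add_mono mult_le_mono) simp_all
  also have "\<dots> = (4 + 4 * CARD('p) + 3 * Suc r) * n" by (simp add: algebra_simps)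
  finally have "vectorspace.dim ring_of_field (invariants (pi_rep r lam) (T1 n :: ('p pmat) set)) \<le> (4 + 4 * CARD('p) + 3 * Suc r) * n"
    using invariants_dim(2) order_trans by blast
  then show "real (vectorspace.dim ring_of_field (invariants (pi_rep r lam) (T1 n :: ('p pmat) set)))
      \<le> real (4 + 4 * CARD('p) + 3 * Suc r) * real n"
    by (simp only: of_nat_mult[symmetric] of_nat_le_iff)
qed

end
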